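(* Let $G$ be a compact Lie group, $H\le G$ a closed subgroup, and let $H$ act continuously on a metrizable space $X$. Let $\mathcal B$ be a class of $H$-invariant subsets of $X$, and let $G\times_H\mathcal B=\{G\times_H B\mid B\in\mathcal B\}$, a class of $G$-invariant subsets of $G\times_H X$. Then $${}_{\mathcal B}\mathrm{cat}_H(X)={}_{G\times_H\mathcal B}\mathrm{cat}_G(G\times_H X).$$
   Context: $G\times_H X$ is the quotient of $G\times X$ by the relation $(gh^{-1},hx)\sim(g,x)$ for $h\in H$, with $G$ acting by $g\cdot[g_0,x]=[gg_0,x]$; for $B\subseteq X$ $H$-invariant, $G\times_H B$ is the image of $G\times B$ in it. For a $\Gamma$-space $Z$, a $\Gamma$-invariant subset $U\subseteq Z$ is $\Gamma$-compressible into $A\subseteq Z$ if the inclusion $U\hookrightarrow Z$ is $\Gamma$-homotopic (through $\Gamma$-equivariant maps $U\times I\to Z$) to a $\Gamma$-map $c\colon U\to Z$ with $c(U)\subseteq A$. For a class $\mathcal A$ of $\Gamma$-invariant subsets of $Z$, ${}_{\mathcal A}\mathrm{cat}_\Gamma(Z)$ is the least integer $k$ such that $Z$ is covered by $k$ $\Gamma$-invariant open sets, each $\Gamma$-compressible into some member of $\mathcal A$ (or $\infty$ if none exists). *)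

theory Defs
  imports "HOL-Analysis.Analysis" "HOL-Algebra.Group" "HOL-Library.Extended_Nat"
begin

text \<open>k-times continuously differentiable (derivatives taken within the domain T,
which in our use is a relatively open subset of a linear subspace).\<close>
fun smooth_k :: "nat \<Rightarrow> 'a::euclidean_space set \<Rightarrow> ('a \<Rightarrow> 'b::real_normed_vector) \<Rightarrow> bool" where
  "smooth_k 0 T f = continuous_on T f"
| "smooth_k (Suc k) T f =
     (\<exists>Df. (\<forall>x\<in>T. (f has_derivative Df x) (at x within T)) \<and> (\<forall>v. smooth_k k T (\<lambda>x. Df x v)))"

definition smooth_on :: "'a::euclidean_space set \<Rightarrow> ('a \<Rightarrow> 'b::real_normed_vector) \<Rightarrow> bool" where
  "smooth_on T f \<longleftrightarrow> (\<forall>k. smooth_k k T f)"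

text \<open>A smooth atlas on M, with charts onto relatively open subsets of a linear subspace S
of the Euclidean space 'e (S models R^n, n = dim S; this also allows dimension 0).\<close>
definition smooth_atlas :: "'g topology \<Rightarrow> 'e::euclidean_space set \<Rightarrow> ('g set \<times> ('g \<Rightarrow> 'e)) set \<Rightarrow> bool" where
  "smooth_atlas M S A \<longleftrightarrow> subspace S \<and> \<Union>(fst ` A) = topspace M \<and>
     (\<forall>(U,\<phi>)\<in>A. openin M U \<and> openin (top_of_set S) (\<phi> ` U) \<and>
                 homeomorphic_map (subtopology M U) (top_of_set (\<phi> ` U)) \<phi>) \<and>
     (\<forall>(U,\<phi>)\<in>A. \<forall>(V,\<psi>)\<in>A. smooth_on (\<phi> ` (U \<inter> V)) (\<psi> \<circ> inv_into U \<phi>))"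

definition topological_group :: "('g, 'b) monoid_scheme \<Rightarrow> 'g topology \<Rightarrow> bool" where
  "topological_group G TG \<longleftrightarrow> group G \<and> topspace TG = carrier G \<and>
     continuous_map (prod_topology TG TG) TG (\<lambda>(x,y). x \<otimes>\<^bsub>G\<^esub> y) \<and>
     continuous_map TG TG (\<lambda>x. inv\<^bsub>G\<^esub> x)"

definition lie_group :: "('g, 'b) monoid_scheme \<Rightarrow> 'g topology \<Rightarrow> 'e::euclidean_space itself \<Rightarrow> bool" where
  "lie_group G TG E \<longleftrightarrow> topological_group G TG \<and> Hausdorff_space TG \<and> second_countable TG \<and>
     (\<exists>(S::'e set) A. smooth_atlas TG S A \<and>
       (\<forall>(U,\<phi>)\<in>A. \<forall>(V,\<psi>)\<in>A. \<forall>(W,\<kappa>)\<in>A.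
          smooth_on {(a,b). a \<in> \<phi> ` U \<and> b \<in> \<psi> ` V \<and> inv_into U \<phi> a \<otimes>\<^bsub>G\<^esub> inv_into V \<psi> b \<in> W}
                    (\<lambda>(a,b). \<kappa> (inv_into U \<phi> a \<otimes>\<^bsub>G\<^esub> inv_into V \<psi> b))) \<and>
       (\<forall>(U,\<phi>)\<in>A. \<forall>(V,\<psi>)\<in>A.
          smooth_on (\<phi> ` {x\<in>U. inv\<^bsub>G\<^esub> x \<in> V}) (\<lambda>a. \<psi> (inv\<^bsub>G\<^esub> (inv_into U \<phi> a)))))"

definition continuous_action ::
  "('g, 'b) monoid_scheme \<Rightarrow> 'g topology \<Rightarrow> 'g set \<Rightarrow> 'x topology \<Rightarrow> ('g \<Rightarrow> 'x \<Rightarrow> 'x) \<Rightarrow> bool" where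
  "continuous_action G TG H X act \<longleftrightarrow>
     (\<forall>h\<in>H. \<forall>x\<in>topspace X. act h x \<in> topspace X) \<and>
     (\<forall>x\<in>topspace X. act \<one>\<^bsub>G\<^esub> x = x) \<and>
     (\<forall>h\<in>H. \<forall>k\<in>H. \<forall>x\<in>topspace X. act (h \<otimes>\<^bsub>G\<^esub> k) x = act h (act k x)) \<and>
     continuous_map (prod_topology (subtopology TG H) X) X (\<lambda>(h,x). act h x)"

definition invariant_set :: "'g set \<Rightarrow> ('g \<Rightarrow> 'x \<Rightarrow> 'x) \<Rightarrow> 'x set \<Rightarrow> bool" where
  "invariant_set \<Gamma> act U \<longleftrightarrow> (\<forall>g\<in>\<Gamma>. \<forall>x\<in>U. act g x \<in> U)"

definition compressible ::
  "'g set \<Rightarrow> ('g \<Rightarrow> 'z \<Rightarrow> 'z) \<Rightarrow> 'z topology \<Rightarrow> 'z set \<Rightarrow> 'z set \<Rightarrow> bool" where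
  "compressible \<Gamma> act Z U A \<longleftrightarrow>
     (\<exists>F. continuous_map (prod_topology (subtopology Z U) (top_of_set {0..1::real})) Z F \<and>
          (\<forall>x\<in>U. F (x, 0) = x) \<and> (\<forall>x\<in>U. F (x, 1) \<in> A) \<and>
          (\<forall>g\<in>\<Gamma>. \<forall>x\<in>U. \<forall>t\<in>{0..1}. F (act g x, t) = act g (F (x, t))))"

definition cat_cover_exists ::
  "'g set \<Rightarrow> ('g \<Rightarrow> 'z \<Rightarrow> 'z) \<Rightarrow> 'z topology \<Rightarrow> 'z set set \<Rightarrow> nat \<Rightarrow> bool" where
  "cat_cover_exists \<Gamma> act Z \<A> k \<longleftrightarrow>
     (\<exists>U :: nat \<Rightarrow> 'z set. (\<Union>i<k. U i) = topspace Z \<and>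
        (\<forall>i<k. openin Z (U i) \<and> invariant_set \<Gamma> act (U i) \<and>
               (\<exists>A\<in>\<A>. compressible \<Gamma> act Z (U i) A)))"

definition equiv_cat :: "'g set \<Rightarrow> ('g \<Rightarrow> 'z \<Rightarrow> 'z) \<Rightarrow> 'z topology \<Rightarrow> 'z set set \<Rightarrow> enat" where
  "equiv_cat \<Gamma> act Z \<A> =
     (if \<exists>k. cat_cover_exists \<Gamma> act Z \<A> k
      then enat (LEAST k. cat_cover_exists \<Gamma> act Z \<A> k) else \<infinity>)"

definition quotient_topology :: "'a topology \<Rightarrow> ('a \<Rightarrow> 'b) \<Rightarrow> 'b topology" where
  "quotient_topology X q = topology (\<lambda>U. U \<subseteq> q ` topspace X \<and> openin X {x \<in> topspace X. q x \<in> U})"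

definition twclass :: "('g, 'b) monoid_scheme \<Rightarrow> 'g set \<Rightarrow> ('g \<Rightarrow> 'x \<Rightarrow> 'x) \<Rightarrow> 'g \<times> 'x \<Rightarrow> ('g \<times> 'x) set" where
  "twclass G H act = (\<lambda>(g,x). {(g \<otimes>\<^bsub>G\<^esub> inv\<^bsub>G\<^esub> h, act h x) | h. h \<in> H})"

definition twisted_product ::
  "('g, 'b) monoid_scheme \<Rightarrow> 'g topology \<Rightarrow> 'g set \<Rightarrow> 'x topology \<Rightarrow> ('g \<Rightarrow> 'x \<Rightarrow> 'x) \<Rightarrow> ('g \<times> 'x) set topology" where
  "twisted_product G TG H X act = quotient_topology (prod_topology TG X) (twclass G H act)"

definition twisted_set ::
  "('g, 'b) monoid_scheme \<Rightarrow> 'g set \<Rightarrow> ('g \<Rightarrow> 'x \<Rightarrow> 'x) \<Rightarrow> 'x set \<Rightarrow> ('g \<times> 'x) set set" where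
  "twisted_set G H act B = twclass G H act ` (carrier G \<times> B)"

definition twisted_action :: "('g, 'b) monoid_scheme \<Rightarrow> 'g \<Rightarrow> ('g \<times> 'x) set \<Rightarrow> ('g \<times> 'x) set" where
  "twisted_action G g C = (\<lambda>(g0, x). (g \<otimes>\<^bsub>G\<^esub> g0, x)) ` C"

end

theory Submission
  imports Defs
begin

text \<open>An \<open>H\<close>-homotopy \<open>F\<close> of \<open>U\<close> induces the \<open>G\<close>-homotopy \<open>([g,x],t) \<mapsto> [g, F (x,t)]\<close> of
  \<open>G \<times>\<^sub>H U\<close>. Conversely, restrict a \<open>G\<close>-homotopy \<open>F\<close> of \<open>W\<close> in \<open>G \<times>\<^sub>H X\<close> to
  \<open>U = {x. [1,x] \<in> W}\<close>. Its \<open>G/H\<close>-component is an \<open>H\<close>-equivariant family of paths starting at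
  the base point; lifting it to \<open>\<Lambda>\<close> with values in \<open>G\<close> and \<open>\<Lambda> (hx,t) = h \<Lambda> (x,t) h\<inverse>\<close> makes
  \<open>\<Lambda> (x,t)\<inverse> F ([1,x],t)\<close> a homotopy in the fibre \<open>X\<close> over the base point.

  The lift is a product of short transports along a subdivision whose mesh depends continuously and
  invariantly on \<open>x\<close>. Transport needs an \<open>H\<times>H\<close>-equivariant retraction \<open>r\<close> of a neighbourhood
  of \<open>H\<close> onto \<open>H\<close>. Here \<open>r g\<close> is the unique minimiser over \<open>h \<in> H\<close> of \<open>f (h\<inverse> g)\<close>, where
  \<open>f\<close> is a supremum over \<open>H\<close> of conjugates of the squared coordinate norm; equivariance follows from
  uniqueness. Uniqueness holds because \<open>f\<close> is strongly convex near \<open>1\<close> and every small \<open>u \<in> H\<close> has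
  an approximate square root in \<open>H\<close> up to \<open>O(|u|\<^sup>2)\<close>, so that two distinct minimisers would
  have a better one almost midway between them. The only consequence of smoothness that enters is the
  bound on mixed second differences of the multiplication in one chart.\<close>

section \<open>Open maps, quotients and extrema over compact spaces\<close>

text \<open>The obstacle is the passage back to \<open>X\<close>: a \<open>G\<close>-homotopy moves
  points out of the fibre over the base coset, and they must be returned by elements of
  \<open>G\<close> chosen continuously and compatibly with \<open>H\<close>. A plain lift of the
  paths in \<open>G/H\<close> has no reason to be compatible. The two-sided equivariance of
  \<open>r\<close> supplies this. Right equivariance makes g inv(r g) constant on the coset gH, so
  it is a section of G -> G/H near the base coset; left equivariance lets this section be translated
  to any coset g1 H independently of the representative g1. The result is g2 inv(r(inv g1 g2)) inv
  g1, which carries g1 H to g2 H, depends on the two cosets alone, and is conjugated by g when both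
  are translated by g. Products of such elements inherit the conjugation law. The mesh must vary
  with x because \<open>X\<close> need not be compact, and must be invariant so that the products
  for x and hx have matching factors.

  The analytic difficulty is that \<open>H\<close> contains elements far from the identity, where
  the chart says nothing; conjugation by them is controlled through powers and quotients of small
  elements, which every conjugation respects.\<close>

lemma open_map_prod:
  assumes f: "open_map A B f" and g: "open_map C D g"
  shows "open_map (prod_topology A C) (prod_topology B D) (\<lambda>p. (f (fst p), g (snd p)))"
  unfolding open_map_def
proof (intro allI impI)
  fix W assume W: "openin (prod_topology A C) W"
  show "openin (prod_topology B D) ((\<lambda>p. (f (fst p), g (snd p))) ` W)"
    unfolding openin_prod_topology_alt
  proof (intro allI impI)
    fix x y assume "(x,y) \<in> (\<lambda>p. (f (fst p), g (snd p))) ` W"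
    then obtain a c where ac: "(a,c) \<in> W" "x = f a" "y = g c" by auto
    obtain S T where ST: "openin A S" "openin C T" "a \<in> S" "c \<in> T" "S \<times> T \<subseteq> W"
      using W[unfolded openin_prod_topology_alt, rule_format, OF ac(1)] by (elim exE conjE)
    have "f ` S \<times> g ` T \<subseteq> (\<lambda>p. (f (fst p), g (snd p))) ` W"
    proof (clarify)
      fix a' c' assume "a' \<in> S" "c' \<in> T"
      then have "(a',c') \<in> W" using ST(5) by blast
      then show "(f a', g c') \<in> (\<lambda>p. (f (fst p), g (snd p))) ` W" by force
    qed
    moreover have "openin B (f ` S)" "openin D (g ` T)"
      using f g ST(1,2) unfolding open_map_def by blast+
    ultimately show "\<exists>U V. openin B U \<and> openin D V \<and> x \<in> U \<and> y \<in> V \<and> U \<times> V \<subseteq> (\<lambda>p. (f (fst p), g (snd p))) ` W"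
      using ac ST(3,4) by blast
  qed
qed

text \<open>Products of quotient maps need not be quotient maps, but products of open maps are open,
  so openness of \<open>p\<close> is the hypothesis that survives taking products. An open
  \<open>W\<close> cutting out a preimage upstairs projects to an open set cutting out the preimage
  in \<open>S\<close>, because \<open>f\<close> factors through \<open>p\<close> on the full
  preimage of \<open>S\<close>. \<open>S\<close> is arbitrary since \<open>fibre_coord\<close> is
  continuous only on the pairs lying over the same coset.\<close>

lemma continuous_map_descend:
  assumes p: "open_map A B p" "topspace B \<subseteq> p ` topspace A" and Y: "f' \<in> topspace B \<inter> S \<rightarrow> topspace Y"
    and f: "continuous_map (subtopology A {a \<in> topspace A. p a \<in> S}) Y f"
    and eq: "\<And>a. a \<in> topspace A \<Longrightarrow> p a \<in> S \<Longrightarrow> f' (p a) = f a"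
  shows "continuous_map (subtopology B S) Y f'"
  unfolding continuous_map_def
proof (intro conjI allI impI)
  show "f' \<in> topspace (subtopology B S) \<rightarrow> topspace Y" using Y by auto
  fix U assume U: "openin Y U"
  let ?A = "{a \<in> topspace A. p a \<in> S}"
  have "openin (subtopology A ?A) {a \<in> topspace (subtopology A ?A). f a \<in> U}"
    by (rule openin_continuous_map_preimage[OF f U])
  then obtain W where W: "openin A W" "{a \<in> topspace (subtopology A ?A). f a \<in> U} = W \<inter> ?A"
    by (auto simp: openin_subtopology)
  have "{b \<in> topspace (subtopology B S). f' b \<in> U} = p ` W \<inter> S"
  proof (intro equalityI subsetI)
    fix b assume b: "b \<in> {b \<in> topspace (subtopology B S). f' b \<in> U}"
    then obtain a where a: "a \<in> topspace A" "b = p a" using p(2) by auto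
    then have "a \<in> {a \<in> topspace (subtopology A ?A). f a \<in> U}" using b eq by auto
    then have "a \<in> W" using W(2) by blast
    then show "b \<in> p ` W \<inter> S" using a b by auto
  next
    fix b assume "b \<in> p ` W \<inter> S"
    then obtain a where a: "a \<in> W" "b = p a" "b \<in> S" by blast
    have aA: "a \<in> topspace A" using a(1) openin_subset[OF W(1)] by blast
    then have "a \<in> {a \<in> topspace (subtopology A ?A). f a \<in> U}" using W(2) a by blast
    then have "f' b \<in> U" using eq a aA by auto
    moreover have "b \<in> topspace B"
      using open_map_imp_subset_topspace[OF p(1)] a(2) aA by blast
    ultimately show "b \<in> {b \<in> topspace (subtopology B S). f' b \<in> U}" using a(3) by simp
  qed
  moreover have "openin B (p ` W)" using p(1) W(1) unfolding open_map_def by blast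
  ultimately show "openin (subtopology B S) {b \<in> topspace (subtopology B S). f' b \<in> U}"
    by (auto simp: openin_subtopology)
qed

lemma openin_quotient_topology:
  "openin (quotient_topology X q) U \<longleftrightarrow> U \<subseteq> q ` topspace X \<and> openin X {x \<in> topspace X. q x \<in> U}"
proof -
  have "istopology (\<lambda>U. U \<subseteq> q ` topspace X \<and> openin X {x \<in> topspace X. q x \<in> U})"
    unfolding istopology_def
  proof (intro conjI allI impI; (elim conjE)?)
    fix S T assume "openin X {x \<in> topspace X. q x \<in> S}" "openin X {x \<in> topspace X. q x \<in> T}"
    then have "openin X ({x \<in> topspace X. q x \<in> S} \<inter> {x \<in> topspace X. q x \<in> T})" by blast
    then show "openin X {x \<in> topspace X. q x \<in> S \<inter> T}" by (rule back_subst[of "openin X"]) auto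
  next
    fix K assume K: "\<forall>S\<in>K. S \<subseteq> q ` topspace X \<and> openin X {x \<in> topspace X. q x \<in> S}"
    then have "openin X (\<Union>S\<in>K. {x \<in> topspace X. q x \<in> S})" by blast
    then show "openin X {x \<in> topspace X. q x \<in> \<Union>K}" by (rule back_subst[of "openin X"]) auto
    show "\<Union>K \<subseteq> q ` topspace X" using K by blast
  qed blast
  then show ?thesis by (simp add: quotient_topology_def)
qed

lemma topspace_quotient_topology: "topspace (quotient_topology X q) = q ` topspace X"
proof -
  have "{x \<in> topspace X. q x \<in> q ` topspace X} = topspace X" by blast
  then have "openin (quotient_topology X q) (q ` topspace X)" by (simp add: openin_quotient_topology)
  moreover have "topspace (quotient_topology X q) \<subseteq> q ` topspace X"
    using openin_topspace[of "quotient_topology X q"] unfolding openin_quotient_topology by blast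
  ultimately show ?thesis using openin_subset by blast
qed

text \<open>Compactness gives lower semicontinuity: projection along a compact factor is closed, and
  the set where m is at most c is the projection of the set where \<open>F\<close> is at most c.
  Upper semicontinuity comes from the openness of projections.\<close>

lemma compact_minimum:
  fixes F :: "'a \<times> 'b \<Rightarrow> real"
  assumes "compact_space K" "topspace K \<noteq> {}" "continuous_map (prod_topology Y K) euclideanreal F"
  obtains m where "continuous_map Y euclideanreal m"
    "\<And>y. y \<in> topspace Y \<Longrightarrow> \<exists>k\<in>topspace K. m y = F (y,k)"
    "\<And>y k. y \<in> topspace Y \<Longrightarrow> k \<in> topspace K \<Longrightarrow> m y \<le> F (y,k)"
proof -
  have ex: "\<exists>k\<in>topspace K. \<forall>k'\<in>topspace K. F (y,k) \<le> F (y,k')" if y: "y \<in> topspace Y" for y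
  proof -
    have "continuous_map K euclideanreal (\<lambda>k. F (y,k))"
      using continuous_map_compose[OF continuous_map_pairedI assms(3), of K "\<lambda>k. y" "\<lambda>k. k"] y
      by (simp add: o_def)
    then have "compact ((\<lambda>k. F (y,k)) ` topspace K)"
      using image_compactin[of K "topspace K" euclideanreal] assms(1)
      by (simp add: compact_space_def)
    from compact_attains_inf[OF this] assms(2) show ?thesis by force
  qed
  define m where "m y = F (y, SOME k. k \<in> topspace K \<and> (\<forall>k'\<in>topspace K. F (y,k) \<le> F (y,k')))" for y
  have m: "(\<exists>k\<in>topspace K. m y = F (y,k)) \<and> (\<forall>k\<in>topspace K. m y \<le> F (y,k))" if y: "y \<in> topspace Y" for y
    unfolding m_def using someI_ex[OF ex[OF y, unfolded Bex_def]] by blast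
  let ?P = "prod_topology Y K"
  have "openin Y {y \<in> topspace Y. m y > c}" for c
  proof -
    have "closedin ?P {p \<in> topspace ?P. F p \<in> {..c}}"
      by (rule closedin_continuous_map_preimage[OF assms(3)]) simp
    then have "closedin Y (fst ` {p \<in> topspace ?P. F p \<in> {..c}})"
      using closed_map_fst[OF assms(1)] by (auto simp: closed_map_def)
    moreover have "{y \<in> topspace Y. m y > c} = topspace Y - fst ` {p \<in> topspace ?P. F p \<in> {..c}}"
      using m by (force simp: not_less)
    ultimately show ?thesis by auto
  qed
  moreover have "openin Y {y \<in> topspace Y. m y < c}" for c
  proof -
    have "openin ?P {p \<in> topspace ?P. F p \<in> {..<c}}"
      by (rule openin_continuous_map_preimage[OF assms(3)]) simp
    then have "openin Y (fst ` {p \<in> topspace ?P. F p \<in> {..<c}})"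
      using open_map_fst by (auto simp: open_map_def)
    moreover have "{y \<in> topspace Y. m y < c} = fst ` {p \<in> topspace ?P. F p \<in> {..<c}}"
      using m by (force intro: le_less_trans)
    ultimately show ?thesis by auto
  qed
  ultimately have "continuous_map Y euclideanreal m"
    by (simp add: continuous_map_upper_lower_semicontinuous_lt)
  then show ?thesis using that m by blast
qed

lemma compact_maximum:
  fixes F :: "'a \<times> 'b \<Rightarrow> real"
  assumes "compact_space K" "topspace K \<noteq> {}" "continuous_map (prod_topology Y K) euclideanreal F"
  obtains m where "continuous_map Y euclideanreal m"
    "\<And>y. y \<in> topspace Y \<Longrightarrow> \<exists>k\<in>topspace K. m y = F (y,k)"
    "\<And>y k. y \<in> topspace Y \<Longrightarrow> k \<in> topspace K \<Longrightarrow> F (y,k) \<le> m y"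
proof -
  have "continuous_map (prod_topology Y K) euclideanreal (\<lambda>p. - F p)"
    using assms(3) by (intro continuous_intros)
  from compact_minimum[OF assms(1,2) this] obtain m where m: "continuous_map Y euclideanreal m"
    "\<And>y. y \<in> topspace Y \<Longrightarrow> \<exists>k\<in>topspace K. m y = - F (y,k)"
    "\<And>y k. y \<in> topspace Y \<Longrightarrow> k \<in> topspace K \<Longrightarrow> m y \<le> - F (y,k)" by blast
  show ?thesis
  proof (rule that[of "\<lambda>y. - m y"])
    show "continuous_map Y euclideanreal (\<lambda>y. - m y)" using m(1) by (intro continuous_intros)
  qed (use m(2,3) in force)+
qed

section \<open>Groups with local coordinates\<close>

locale top_group = group G for G (structure) +
  fixes TG :: "'a topology"
  assumes top_group: "topological_group G TG"
begin

lemma topspace_TG: "topspace TG = carrier G"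
  and mult_cont: "continuous_map (prod_topology TG TG) TG (\<lambda>(x,y). x \<otimes> y)"
  and inv_cont: "continuous_map TG TG (\<lambda>x. inv x)"
  using top_group by (auto simp: topological_group_def)

lemma cont_mult:
  assumes "continuous_map Z TG f" "continuous_map Z TG g"
  shows "continuous_map Z TG (\<lambda>x. f x \<otimes> g x)"
  using continuous_map_compose[OF continuous_map_pairedI[OF assms] mult_cont] by (simp add: o_def)

lemma cont_inv:
  assumes "continuous_map Z TG f"
  shows "continuous_map Z TG (\<lambda>x. inv (f x))"
  using continuous_map_compose[OF assms inv_cont] by (simp add: o_def)

lemma inv_cancel [simp]:
  assumes "h \<in> carrier G" "x \<in> carrier G"
  shows "inv h \<otimes> (h \<otimes> x) = x" "h \<otimes> (inv h \<otimes> x) = x"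
  using assms by (simp_all add: m_assoc[symmetric])

end

text \<open>A chart centred at the identity, reduced to the facts used later.
  \<open>mixed_diff_raw\<close> is the trace left by twice differentiable multiplication.
  \<open>C_rho\<close> makes each error term at most an eighth of a main term.
  \<open>cball_closed\<close> allows a function of the coordinates to be extended continuously by a
  constant, and \<open>midpoint_in_U\<close> provides the points at which convexity is
  tested.\<close>

locale lie_coords = top_group G TG for G (structure) and TG :: "'a topology" +
  fixes U :: "'a set" and \<phi> :: "'a \<Rightarrow> 'e::euclidean_space"
    and C \<rho> :: real
  assumes U_subset: "U \<subseteq> carrier G"
    and one_in_U: "\<one> \<in> U"
    and coord_one: "\<phi> \<one> = 0"
    and coord_inj: "inj_on \<phi> U"
    and rho_pos: "\<rho> > 0" and C_pos: "C > 0" and C_rho: "C * \<rho> \<le> 1/8"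
    and ball_open: "\<And>r. \<lbrakk>0 < r; r \<le> \<rho>\<rbrakk> \<Longrightarrow> openin TG {g\<in>U. norm (\<phi> g) < r}"
    and ball_basis: "\<And>V. \<lbrakk>openin TG V; \<one> \<in> V\<rbrakk> \<Longrightarrow> \<exists>r>0. r \<le> \<rho> \<and> {g\<in>U. norm (\<phi> g) < r} \<subseteq> V"
    and cball_closed: "\<And>r. \<lbrakk>0 \<le> r; r < \<rho>\<rbrakk> \<Longrightarrow> closedin TG {g\<in>U. norm (\<phi> g) \<le> r}"
    and midpoint_in_U: "\<And>x y. \<lbrakk>x \<in> U; y \<in> U; norm (\<phi> x) < \<rho>; norm (\<phi> y) < \<rho>\<rbrakk>
                  \<Longrightarrow> \<exists>p\<in>U. \<phi> p = (1/2) *\<^sub>R (\<phi> x + \<phi> y)"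
    and mult_in_U: "\<And>x y. \<lbrakk>x \<in> U; y \<in> U; norm (\<phi> x) < \<rho>; norm (\<phi> y) < \<rho>\<rbrakk> \<Longrightarrow> x \<otimes> y \<in> U"
    and mixed_diff_raw: "\<And>a a' b b'. \<lbrakk>a \<in> U; a' \<in> U; b \<in> U; b' \<in> U; norm (\<phi> a) < \<rho>;
         norm (\<phi> a') < \<rho>; norm (\<phi> b) < \<rho>; norm (\<phi> b') < \<rho>\<rbrakk> \<Longrightarrow>
       norm (\<phi> (a \<otimes> b) - \<phi> (a \<otimes> b') - \<phi> (a' \<otimes> b) + \<phi> (a' \<otimes> b'))
         \<le> C * norm (\<phi> a - \<phi> a') * norm (\<phi> b - \<phi> b')"
begin

section \<open>Products, quotients and powers in the chart\<close>

definition nb :: "real \<Rightarrow> 'a set" where "nb r = {g\<in>U. norm (\<phi> g) < r}"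

definition len :: "'a \<Rightarrow> real" where "len g = norm (\<phi> g)"

lemma len_nonneg [simp]: "len g \<ge> 0" by (simp add: len_def)
lemma len_one [simp]: "len \<one> = 0" by (simp add: len_def coord_one)

lemma nb_carrier: "g \<in> nb r \<Longrightarrow> g \<in> carrier G"
  using U_subset by (auto simp: nb_def)

lemma nb_U: "g \<in> nb r \<Longrightarrow> g \<in> U" by (auto simp: nb_def)

lemma nb_len: "g \<in> nb r \<Longrightarrow> len g < r" by (auto simp: nb_def len_def)

lemma nbI: "g \<in> U \<Longrightarrow> len g < r \<Longrightarrow> g \<in> nb r" by (auto simp: nb_def len_def)

lemma nb_mono: "g \<in> nb r \<Longrightarrow> r \<le> s \<Longrightarrow> g \<in> nb s" by (auto simp: nb_def)

lemma one_nb: "r > 0 \<Longrightarrow> \<one> \<in> nb r" by (simp add: nb_def one_in_U coord_one)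

lemma openin_nb: "0 < r \<Longrightarrow> r \<le> \<rho> \<Longrightarrow> openin TG (nb r)"
  using ball_open by (simp add: nb_def)

lemma nb_basis: "openin TG V \<Longrightarrow> \<one> \<in> V \<Longrightarrow> \<exists>r>0. r \<le> \<rho> \<and> nb r \<subseteq> V"
  using ball_basis by (simp add: nb_def)

lemma len_eq_0: "g \<in> U \<Longrightarrow> len g = 0 \<longleftrightarrow> g = \<one>"
  using coord_inj one_in_U coord_one unfolding len_def inj_on_def by (metis norm_eq_zero)

lemma nb_mult_U: "a \<in> nb \<rho> \<Longrightarrow> b \<in> nb \<rho> \<Longrightarrow> a \<otimes> b \<in> U"
  using mult_in_U by (simp add: nb_def)

lemma mixed_diff:
  assumes "a \<in> nb \<rho>" "a' \<in> nb \<rho>" "b \<in> nb \<rho>" "b' \<in> nb \<rho>"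
  shows "norm (\<phi> (a \<otimes> b) - \<phi> (a \<otimes> b') - \<phi> (a' \<otimes> b) + \<phi> (a' \<otimes> b'))
         \<le> C * norm (\<phi> a - \<phi> a') * norm (\<phi> b - \<phi> b')"
  using mixed_diff_raw assms by (simp add: nb_def)

text \<open>One of the four points of the mixed difference is taken to be \<open>\<one>\<close>. Up
  to a relative error of \<open>C * len a\<close>, translation by \<open>a\<close> then acts on
  coordinate differences as the identity.\<close>

lemma mult_diff_right:
  assumes "a \<in> nb \<rho>" "b \<in> nb \<rho>" "b' \<in> nb \<rho>"
  shows "norm (\<phi> (a \<otimes> b) - \<phi> (a \<otimes> b') - (\<phi> b - \<phi> b')) \<le> C * len a * norm (\<phi> b - \<phi> b')"
  using mixed_diff[OF assms(1) one_nb[OF rho_pos] assms(2,3)] nb_carrier[OF assms(2)] nb_carrier[OF assms(3)]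
  by (simp add: coord_one len_def algebra_simps)

lemma mult_diff_left:
  assumes "a \<in> nb \<rho>" "a' \<in> nb \<rho>" "b \<in> nb \<rho>"
  shows "norm (\<phi> (a \<otimes> b) - \<phi> (a' \<otimes> b) - (\<phi> a - \<phi> a')) \<le> C * norm (\<phi> a - \<phi> a') * len b"
  using mixed_diff[OF assms(1,2,3) one_nb[OF rho_pos]] nb_carrier[OF assms(1)] nb_carrier[OF assms(2)]
  by (simp add: coord_one len_def algebra_simps)

lemma mult_approx:
  assumes "a \<in> nb \<rho>" "b \<in> nb \<rho>"
  shows "norm (\<phi> (a \<otimes> b) - \<phi> a - \<phi> b) \<le> C * len a * len b"
  using mult_diff_right[OF assms one_nb[OF rho_pos]] nb_carrier[OF assms(1)]
  by (simp add: coord_one len_def algebra_simps)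

lemma C_len_le: "a \<in> nb \<rho> \<Longrightarrow> C * len a \<le> 1/8"
  using C_rho C_pos nb_len[of a \<rho>] by (smt (verit) mult_left_mono)

lemma C_len_mult_le:
  assumes "a \<in> nb \<rho>" "x \<ge> 0" shows "C * len a * x \<le> x / 8" "C * x * len a \<le> x / 8"
proof -
  show 1: "C * len a * x \<le> x / 8"
    using mult_right_mono[OF C_len_le[OF assms(1)] assms(2)] by simp
  have "C * x * len a = C * len a * x" by simp
  then show "C * x * len a \<le> x / 8" using 1 by linarith
qed

lemma len_mult_le:
  assumes "a \<in> nb \<rho>" "b \<in> nb \<rho>"
  shows "len (a \<otimes> b) \<le> len a + len b + len b / 8"
proof -
  have "\<phi> (a \<otimes> b) = (\<phi> (a \<otimes> b) - \<phi> a - \<phi> b) + \<phi> a + \<phi> b" by simp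
  then have "len (a \<otimes> b) \<le> norm (\<phi> (a \<otimes> b) - \<phi> a - \<phi> b) + len a + len b"
    unfolding len_def by (metis add_mono norm_triangle_le order_refl)
  then show ?thesis
    using mult_approx[OF assms] C_len_mult_le(1)[OF assms(1), of "len b"] by simp
qed

lemma inv_small:
  assumes "s > 0"
  obtains r where "r > 0" "r \<le> \<rho>" "\<And>a. a \<in> nb r \<Longrightarrow> inv a \<in> nb s"
proof -
  define s' where "s' = min s \<rho>"
  have s': "0 < s'" "s' \<le> \<rho>" "s' \<le> s" using assms rho_pos by (auto simp: s'_def)
  have "openin TG {x \<in> topspace TG. inv x \<in> nb s'}"
    using openin_continuous_map_preimage[OF inv_cont openin_nb] s' by auto
  moreover have "\<one> \<in> {x \<in> topspace TG. inv x \<in> nb s'}"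
    using one_nb[OF s'(1)] by (simp add: topspace_TG)
  ultimately obtain r where "r>0" "r \<le> \<rho>" "nb r \<subseteq> {x \<in> topspace TG. inv x \<in> nb s'}"
    using nb_basis by blast
  then show ?thesis using that[of r] nb_mono[OF _ s'(3)] by blast
qed

lemma len_inv_le:
  assumes "a \<in> nb \<rho>" "inv a \<in> nb \<rho>"
  shows "len (inv a) \<le> 2 * len a"
proof -
  have "norm (\<phi> a + \<phi> (inv a)) \<le> C * len a * len (inv a)"
    using mult_approx[OF assms] nb_carrier[OF assms(1)]
    by (simp add: coord_one norm_minus_commute) (metis add_uminus_conv_diff minus_add_distrib norm_minus_cancel)
  also have "\<dots> \<le> len a / 8" using C_len_mult_le(2)[OF assms(2), of "len a"] by simp
  finally have "norm (\<phi> a + \<phi> (inv a)) \<le> len a / 8" .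
  moreover have "len (inv a) \<le> norm (\<phi> a + \<phi> (inv a)) + len a"
    unfolding len_def by (metis add_diff_cancel_left' norm_triangle_ineq4)
  ultimately show ?thesis using len_nonneg[of a] by linarith
qed

lemma inv_nb:
  obtains r where "r > 0" "r \<le> \<rho>"
    "\<And>a. a \<in> nb r \<Longrightarrow> inv a \<in> nb \<rho> \<and> len (inv a) \<le> 2 * len a"
  using inv_small[OF rho_pos] len_inv_le nb_mono by metis

text \<open>Read with z = inv y x: the length of a quotient and the coordinate difference of the two
  points agree up to a factor 2. This is the dictionary between group expressions, which conjugation
  respects, and vector expressions, in which the estimates are made.\<close>

lemma left_quotient_bounds:
  assumes "y \<in> nb \<rho>" "z \<in> nb \<rho>"
  shows "len z \<le> 2 * norm (\<phi> (y \<otimes> z) - \<phi> y)" "norm (\<phi> (y \<otimes> z) - \<phi> y) \<le> 2 * len z"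
proof -
  have 1: "norm (\<phi> (y \<otimes> z) - \<phi> y - \<phi> z) \<le> len z / 8"
    using mult_approx[OF assms] C_len_mult_le(1)[OF assms(1), of "len z"] by simp
  show "norm (\<phi> (y \<otimes> z) - \<phi> y) \<le> 2 * len z"
    using 1 norm_triangle_ineq2[of "\<phi> (y \<otimes> z) - \<phi> y" "\<phi> z"] len_nonneg[of z] unfolding len_def by linarith
  show "len z \<le> 2 * norm (\<phi> (y \<otimes> z) - \<phi> y)"
    using 1 norm_triangle_ineq2[of "\<phi> z" "\<phi> (y \<otimes> z) - \<phi> y"] len_nonneg[of z]
      norm_minus_commute[of "\<phi> z" "\<phi> (y \<otimes> z) - \<phi> y"]
    unfolding len_def by linarith
qed

lemma right_quotient_bounds:
  assumes "y \<in> nb \<rho>" "z \<in> nb \<rho>"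
  shows "len z \<le> 2 * norm (\<phi> (z \<otimes> y) - \<phi> y)" "norm (\<phi> (z \<otimes> y) - \<phi> y) \<le> 2 * len z"
proof -
  have 1: "norm (\<phi> (z \<otimes> y) - \<phi> y - \<phi> z) \<le> len z / 8"
    using mult_approx[OF assms(2,1)] C_len_mult_le(2)[OF assms(1), of "len z"] by (simp add: algebra_simps)
  show "norm (\<phi> (z \<otimes> y) - \<phi> y) \<le> 2 * len z"
    using 1 norm_triangle_ineq2[of "\<phi> (z \<otimes> y) - \<phi> y" "\<phi> z"] len_nonneg[of z] unfolding len_def by linarith
  show "len z \<le> 2 * norm (\<phi> (z \<otimes> y) - \<phi> y)"
    using 1 norm_triangle_ineq2[of "\<phi> z" "\<phi> (z \<otimes> y) - \<phi> y"] len_nonneg[of z]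
      norm_minus_commute[of "\<phi> z" "\<phi> (z \<otimes> y) - \<phi> y"]
    unfolding len_def by linarith
qed

lemma quotient_small:
  assumes "s > 0" "s \<le> \<rho>"
  obtains r where "r > 0" "r \<le> \<rho>"
    "\<And>x y. x \<in> nb r \<Longrightarrow> y \<in> nb r \<Longrightarrow> inv y \<otimes> x \<in> nb s \<and> x \<otimes> inv y \<in> nb s"
proof -
  obtain t where t: "t > 0" "t \<le> \<rho>" "\<And>a. a \<in> nb t \<Longrightarrow> inv a \<in> nb \<rho> \<and> len (inv a) \<le> 2 * len a"
    using inv_nb by blast
  \<comment> \<open>Inversion at most doubles lengths, so the factors have lengths below s/5 and
    2s/5; even with an eighth of the second factor added, the sum stays below
    \<open>s\<close>.\<close>
  define r where "r = min t (s/5)"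
  have r: "r > 0" "r \<le> t" "r \<le> \<rho>" "r \<le> s/5" using t assms by (auto simp: r_def)
  have "inv y \<otimes> x \<in> nb s \<and> x \<otimes> inv y \<in> nb s" if "x \<in> nb r" "y \<in> nb r" for x y
  proof -
    have xr: "x \<in> nb \<rho>" using that r nb_mono by blast
    have y: "inv y \<in> nb \<rho>" "len (inv y) \<le> 2 * len y" using t(3) that(2) r(2) nb_mono by blast+
    have l: "len x < s/5" "len y < s/5" using that nb_len r(4) by fastforce+
    have "len (inv y \<otimes> x) < s" "len (x \<otimes> inv y) < s"
      using len_mult_le[OF y(1) xr] len_mult_le[OF xr y(1)] y(2) l assms(1) by - linarith+
    then show ?thesis
      using nb_mult_U[OF y(1) xr] nb_mult_U[OF xr y(1)] by (auto intro!: nbI)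
  qed
  then show ?thesis using that r by blast
qed

text \<open>The products of \<open>p\<close> and \<open>p \<otimes> inv z\<close> with
  \<open>z\<close> and \<open>\<one>\<close> are p z, p, p and p inv z, so the mixed difference
  collapses to the second difference along these points.\<close>

lemma second_difference:
  assumes "p \<in> nb \<rho>" "z \<in> nb \<rho>" "inv z \<in> nb \<rho>" "p \<otimes> inv z \<in> nb \<rho>"
  shows "norm (\<phi> (p \<otimes> z) + \<phi> (p \<otimes> inv z) - 2 *\<^sub>R \<phi> p) \<le> 4 * C * (len z)\<^sup>2"
proof -
  have eq: "p \<otimes> inv z \<otimes> z = p"
    using assms nb_carrier by (simp add: m_assoc)
  have "norm (\<phi> (p \<otimes> z) + \<phi> (p \<otimes> inv z) - 2 *\<^sub>R \<phi> p) \<le> C * norm (\<phi> p - \<phi> (p \<otimes> inv z)) * len z"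
    using mixed_diff[OF assms(1,4,2) one_nb[OF rho_pos]] nb_carrier[OF assms(1)] nb_carrier[OF assms(4)] eq
    by (simp add: coord_one len_def algebra_simps scaleR_2)
  also have "\<dots> \<le> C * (4 * len z) * len z"
  proof -
    have "norm (\<phi> p - \<phi> (p \<otimes> inv z)) \<le> 4 * len z"
      using left_quotient_bounds(2)[OF assms(1,3)] len_inv_le[OF assms(2,3)]
        norm_minus_commute[of "\<phi> p" "\<phi> (p \<otimes> inv z)"] by linarith
    then show ?thesis using C_pos by (intro mult_right_mono mult_left_mono) auto
  qed
  finally show ?thesis by (simp add: power2_eq_square)
qed

text \<open>Multiplying the j-th power by \<open>a\<close> adds an error of at most 2 j C (len a)^2,
  and these errors sum to the square of \<open>k\<close>. The hypothesis keeps the powers in the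
  chart; it also makes \<open>C * (real k * len a)\<close> at most 1, so the length bound follows
  from the error bound.\<close>

lemma pow_approx:
  assumes "a \<in> nb \<rho>" "2 * real k * len a < \<rho>"
  shows "a [^] k \<in> nb \<rho> \<and> len (a [^] k) \<le> 2 * (real k * len a) \<and>
    norm (\<phi> (a [^] k) - real k *\<^sub>R \<phi> a) \<le> C * (real k)\<^sup>2 * (len a)\<^sup>2"
  using assms(2)
proof (induction k)
  case 0
  then show ?case using one_nb[OF rho_pos] by (simp add: coord_one)
next
  case (Suc k)
  have k: "2 * real k * len a < \<rho>"
    proof -
    have "2 * real k * len a \<le> 2 * real (Suc k) * len a" by (intro mult_right_mono) auto
    then show ?thesis using Suc.prems by linarith
  qed
  have ak: "a [^] k \<in> nb \<rho>"
    and E: "norm (\<phi> (a [^] k) - real k *\<^sub>R \<phi> a) \<le> C * (real k)\<^sup>2 * (len a)\<^sup>2"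
    using Suc.IH[OF k] by auto
  have kC: "C * (real k * len a) \<le> 1"
  proof -
    have "0 \<le> real k * len a" by simp
    then have "real k * len a \<le> \<rho>" using k by linarith
    then have "C * (real k * len a) \<le> C * \<rho>" using C_pos by (intro mult_left_mono) auto
    then show ?thesis using C_rho by linarith
  qed
  have "norm (\<phi> (a [^] k) - real k *\<^sub>R \<phi> a) \<le> (C * (real k * len a)) * (real k * len a)"
    using E by (simp add: power2_eq_square algebra_simps)
  also have "\<dots> \<le> 1 * (real k * len a)" using kC by (intro mult_right_mono) auto
  finally have lk: "len (a [^] k) \<le> 2 * (real k * len a)"
    using norm_triangle_ineq2[of "\<phi> (a [^] k)" "real k *\<^sub>R \<phi> a"] by (simp add: len_def)
  have step: "norm (\<phi> (a [^] k \<otimes> a) - \<phi> (a [^] k) - \<phi> a) \<le> C * len (a [^] k) * len a"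
    using mult_approx[OF ak assms(1)] .
  also have "\<dots> \<le> C * (2 * (real k * len a)) * len a"
    using lk C_pos by (intro mult_right_mono mult_left_mono) auto
  finally have step: "norm (\<phi> (a [^] k \<otimes> a) - \<phi> (a [^] k) - \<phi> a) \<le> C * (2 * (real k * len a)) * len a" .
  have eq: "\<phi> (a [^] Suc k) - real (Suc k) *\<^sub>R \<phi> a
      = (\<phi> (a [^] k \<otimes> a) - \<phi> (a [^] k) - \<phi> a) + (\<phi> (a [^] k) - real k *\<^sub>R \<phi> a)"
    by (simp add: algebra_simps)
  have "norm (\<phi> (a [^] Suc k) - real (Suc k) *\<^sub>R \<phi> a)
      \<le> C * (2 * (real k * len a)) * len a + C * (real k)\<^sup>2 * (len a)\<^sup>2"
    unfolding eq by (rule norm_triangle_mono[OF step E])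
  also have "\<dots> \<le> C * (real (Suc k))\<^sup>2 * (len a)\<^sup>2"
    using C_pos by (simp add: power2_eq_square algebra_simps)
  finally have fin: "norm (\<phi> (a [^] Suc k) - real (Suc k) *\<^sub>R \<phi> a) \<le> C * (real (Suc k))\<^sup>2 * (len a)\<^sup>2" .
  have kC': "C * (real (Suc k) * len a) \<le> 1"
  proof -
    have "0 \<le> real (Suc k) * len a" by simp
    then have "real (Suc k) * len a \<le> \<rho>" using Suc.prems by linarith
    then have "C * (real (Suc k) * len a) \<le> C * \<rho>" using C_pos by (intro mult_left_mono) auto
    then show ?thesis using C_rho by linarith
  qed
  have "norm (\<phi> (a [^] Suc k) - real (Suc k) *\<^sub>R \<phi> a) \<le> (C * (real (Suc k) * len a)) * (real (Suc k) * len a)"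
    using fin by (simp add: power2_eq_square algebra_simps)
  also have "\<dots> \<le> 1 * (real (Suc k) * len a)" using kC' by (intro mult_right_mono) auto
  finally have lk: "len (a [^] Suc k) \<le> 2 * (real (Suc k) * len a)"
    using norm_triangle_ineq2[of "\<phi> (a [^] Suc k)" "real (Suc k) *\<^sub>R \<phi> a"] by (simp add: len_def)
  also have "\<dots> = 2 * real (Suc k) * len a" by simp
  finally have "a [^] Suc k \<in> nb \<rho>"
    using Suc.prems nb_mult_U[OF ak assms(1)] by (intro nbI) auto
  then show ?case using fin lk by blast
qed

definition conj :: "'a \<Rightarrow> 'a \<Rightarrow> 'a" where "conj h g = h \<otimes> g \<otimes> inv h"

lemma conj_closed [simp]: "h \<in> carrier G \<Longrightarrow> g \<in> carrier G \<Longrightarrow> conj h g \<in> carrier G"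
  by (simp add: conj_def)

lemma conj_one [simp]: "h \<in> carrier G \<Longrightarrow> conj h \<one> = \<one>"
  by (simp add: conj_def)

lemma conj_mult:
  assumes "h \<in> carrier G" "a \<in> carrier G" "b \<in> carrier G"
  shows "conj h (a \<otimes> b) = conj h a \<otimes> conj h b"
  using assms by (simp add: conj_def m_assoc)

lemma conj_pow:
  assumes "h \<in> carrier G" "a \<in> carrier G"
  shows "conj h (a [^] (n::nat)) = conj h a [^] n"
  by (induction n) (use assms in \<open>simp_all add: conj_mult\<close>)

lemma conj_inv:
  assumes "h \<in> carrier G" "a \<in> carrier G"
  shows "conj h (inv a) = inv (conj h a)"
  using assms by (simp add: conj_def inv_mult_group m_assoc)

lemma conj_conj_inv:
  assumes "h \<in> carrier G" "a \<in> carrier G"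
  shows "conj (inv h) (conj h a) = a"
  using assms by (simp add: conj_def m_assoc)

end

section \<open>Conjugation in local coordinates\<close>

locale compact_lie_coords = lie_coords +
  assumes compact_TG: "compact_space TG"
begin

text \<open>Tube lemma: the pairs whose conjugate leaves the target ball form a closed set, so their
  projection along the compact group is closed, and it misses \<open>\<one>\<close>.\<close>

lemma conj_small:
  assumes "s > 0"
  obtains r where "r > 0" "r \<le> \<rho>" "\<And>h g. h \<in> carrier G \<Longrightarrow> g \<in> nb r \<Longrightarrow> conj h g \<in> nb s"
proof -
  define s' where "s' = min s \<rho>"
  have s': "0 < s'" "s' \<le> \<rho>" "s' \<le> s" using assms rho_pos by (auto simp: s'_def)
  let ?P = "prod_topology TG TG"
  have cont: "continuous_map ?P TG (\<lambda>p. conj (snd p) (fst p))"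
    unfolding conj_def by (intro cont_mult cont_inv continuous_map_fst continuous_map_snd)
  define A where "A = topspace ?P - {p \<in> topspace ?P. conj (snd p) (fst p) \<in> nb s'}"
  have "closedin ?P A"
    unfolding A_def using openin_continuous_map_preimage[OF cont openin_nb] s' by blast
  then have "closedin TG (fst ` A)"
    using closed_map_fst[OF compact_TG] by (auto simp: closed_map_def)
  then have "openin TG (topspace TG - fst ` A)" by blast
  moreover have "\<one> \<in> topspace TG - fst ` A"
    using one_nb[OF s'(1)] by (auto simp: A_def topspace_TG)
  ultimately obtain r where r: "r > 0" "r \<le> \<rho>" "nb r \<subseteq> topspace TG - fst ` A" using nb_basis by blast
  have "conj h g \<in> nb s" if "h \<in> carrier G" "g \<in> nb r" for h g
  proof -
    have "g \<in> carrier G" using that nb_carrier by blast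
    then have "(g,h) \<in> topspace ?P" using that by (simp add: topspace_TG)
    moreover have "(g,h) \<notin> A" using r(3) that by force
    ultimately show ?thesis using nb_mono[OF _ s'(3)] by (auto simp: A_def)
  qed
  then show ?thesis using that r by blast
qed

text \<open>The escape time argument: powers of \<open>g\<close> stay near the identity for about \<open>1 / len g\<close>
  steps, hence so do powers of its conjugates, which forces these to have length \<open>O(len g)\<close>.\<close>

lemma conj_len_le:
  obtains r L where "r > 0" "r \<le> \<rho>" "L \<ge> 1"
    "\<And>h g. h \<in> carrier G \<Longrightarrow> g \<in> nb r \<Longrightarrow> conj h g \<in> nb \<rho> \<and> len (conj h g) \<le> L * len g"
proof -
  obtain r1 where r1: "r1 > 0" "r1 \<le> \<rho>" "\<And>h g. h \<in> carrier G \<Longrightarrow> g \<in> nb r1 \<Longrightarrow> conj h g \<in> nb \<rho>"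
    using conj_small[OF rho_pos] by blast
  \<comment> \<open>The constant combines two bounds derived below: \<open>r1\<close> is at most 4 k
    len g, and k len c is at most 2 \<rho>.\<close>
  define L where "L = 8 * \<rho> / r1"
  have L: "L \<ge> 1" using r1 rho_pos by (simp add: L_def field_simps)
  have "len (conj h g) \<le> L * len g" if h: "h \<in> carrier G" and g: "g \<in> nb (r1/2)" for h g
  proof (cases "len g = 0")
    case True
    then have "g = \<one>" using len_eq_0 nb_U[OF g] by simp
    then show ?thesis using h by simp
  next
    case False
    then have lg: "len g > 0" using len_nonneg[of g] by linarith
    have gc: "g \<in> carrier G" using g nb_carrier by blast
    have gr: "g \<in> nb r1" using g r1 nb_mono[of g "r1/2" r1] by simp
    have grho: "g \<in> nb \<rho>" using gr r1(2) nb_mono by blast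
    define c where "c = conj h g"
    have c: "c \<in> nb \<rho>" unfolding c_def using r1(3) h gr by blast
    define q where "q = r1 / (2 * len g)"
    have q: "q > 1" using nb_len[OF g] lg r1 by (simp add: q_def field_simps)
    \<comment> \<open>The largest integer strictly below \<open>q\<close>: strictness keeps the k-th
      power of \<open>g\<close> inside the open ball of radius \<open>r1\<close>. The radius
      \<open>r1/2\<close> for \<open>g\<close> gives \<open>q > 1\<close>, hence k is at least 1 and
      k + 1 is at most 2k.\<close>
    define k where "k = nat (\<lceil>q\<rceil> - 1)"
    have k: "k \<ge> 1" "real k < q" "q \<le> real k + 1" using q unfolding k_def by linarith+
    have kq: "2 * real k * len g < r1" "r1 \<le> 2 * (real k + 1) * len g"
      using k lg by (simp_all add: q_def field_simps)
    have pow_c: "c [^] j \<in> nb \<rho>" if "j \<le> k" for j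
    proof -
      have le: "2 * real j * len g \<le> 2 * real k * len g"
        using that lg by (intro mult_right_mono) auto
      then have "2 * real j * len g < \<rho>" using kq(1) r1(2) by linarith
      from pow_approx[OF grho this]
      have "g [^] j \<in> U" "len (g [^] j) \<le> 2 * real j * len g" by (auto dest: nb_U)
      then have "g [^] j \<in> nb r1" using le kq(1) by (intro nbI) auto
      then have "conj h (g [^] j) \<in> nb \<rho>" using r1(3) h by blast
      then show ?thesis using conj_pow[OF h gc] by (simp add: c_def)
    qed
    \<comment> \<open>\<open>pow_approx\<close> is not applicable to \<open>c\<close>, since its
      hypothesis bounds k len c, the very quantity sought. Instead, while the powers stay in the
      chart, each step moves by the coordinates of \<open>c\<close> up to an eighth of their norm;
      so the k-th power has travelled at least 7/8 of k len c, yet it is still within \<rho> of the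
      origin.\<close>
    have lin: "norm (\<phi> (c [^] j) - real j *\<^sub>R \<phi> c) \<le> real j * (len c / 8)" if "j \<le> k" for j
      using that
    proof (induction j)
      case 0
      then show ?case by (simp add: coord_one)
    next
      case (Suc j)
      have IH: "norm (\<phi> (c [^] j) - real j *\<^sub>R \<phi> c) \<le> real j * (len c / 8)" using Suc by simp
      have cj: "c [^] j \<in> nb \<rho>" using pow_c Suc.prems by simp
      have st: "norm (\<phi> (c [^] j \<otimes> c) - \<phi> (c [^] j) - \<phi> c) \<le> len c / 8"
        using mult_approx[OF cj c] C_len_mult_le(1)[OF cj len_nonneg[of c]] by linarith
      have eq: "\<phi> (c [^] Suc j) - real (Suc j) *\<^sub>R \<phi> c
        = (\<phi> (c [^] j \<otimes> c) - \<phi> (c [^] j) - \<phi> c) + (\<phi> (c [^] j) - real j *\<^sub>R \<phi> c)"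
        by (simp add: algebra_simps)
      have "norm (\<phi> (c [^] Suc j) - real (Suc j) *\<^sub>R \<phi> c) \<le> len c / 8 + real j * (len c / 8)"
        unfolding eq by (rule norm_triangle_mono[OF st IH])
      then show ?case by (simp add: algebra_simps)
    qed
    have "norm (real k *\<^sub>R \<phi> c) \<le> len (c [^] k) + real k * (len c / 8)"
      using lin[of k] norm_triangle_ineq2[of "real k *\<^sub>R \<phi> c" "\<phi> (c [^] k)"]
        norm_minus_commute[of "real k *\<^sub>R \<phi> c" "\<phi> (c [^] k)"] unfolding len_def by simp
    moreover have "norm (real k *\<^sub>R \<phi> c) = real k * len c" by (simp add: len_def)
    moreover have "len (c [^] k) < \<rho>" using pow_c nb_len by blast
    ultimately have kc: "real k * len c \<le> 2 * \<rho>"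
      using mult_nonneg_nonneg[of "real k" "len c"] rho_pos len_nonneg[of c] by linarith
    have "r1 \<le> 4 * real k * len g"
    proof -
      have "2 * (real k + 1) * len g \<le> 4 * real k * len g" using k(1) lg by (intro mult_right_mono) auto
      then show ?thesis using kq(2) by linarith
    qed
    then have "len c * r1 \<le> len c * (4 * real k * len g)" by (intro mult_left_mono) auto
    also have "\<dots> = (real k * len c) * (4 * len g)" by simp
    also have "\<dots> \<le> 2 * \<rho> * (4 * len g)" using kc by (intro mult_right_mono) auto
    finally have "len c \<le> L * len g" using r1(1) by (simp add: L_def field_simps)
    then show ?thesis by (simp add: c_def)
  qed
  moreover have "conj h g \<in> nb \<rho>" if "h \<in> carrier G" "g \<in> nb (r1/2)" for h g
    using r1(3)[OF that(1)] nb_mono[OF that(2), of r1] r1(1) by simp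
  ultimately show ?thesis using that[of "r1/2" L] r1 L by auto
qed

text \<open>The quotient of the conjugates is the conjugate of the quotient. So the length bound for
  one small element becomes a Lipschitz bound, with a factor 2 for each translation between
  quotients and coordinate differences.\<close>

lemma conj_lipschitz:
  obtains r L where "r > 0" "r \<le> \<rho>" "L \<ge> 1"
    "\<And>h x y. h \<in> carrier G \<Longrightarrow> x \<in> nb r \<Longrightarrow> y \<in> nb r \<Longrightarrow>
       norm (\<phi> (conj h x) - \<phi> (conj h y)) \<le> L * norm (\<phi> x - \<phi> y)"
proof -
  obtain r0 L0 where r0: "r0 > 0" "r0 \<le> \<rho>" "L0 \<ge> 1"
    and L0: "\<And>h g. h \<in> carrier G \<Longrightarrow> g \<in> nb r0 \<Longrightarrow> conj h g \<in> nb \<rho> \<and> len (conj h g) \<le> L0 * len g"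
    using conj_len_le by blast
  obtain r1 where r1: "r1 > 0" "r1 \<le> \<rho>"
    "\<And>x y. x \<in> nb r1 \<Longrightarrow> y \<in> nb r1 \<Longrightarrow> inv y \<otimes> x \<in> nb r0 \<and> x \<otimes> inv y \<in> nb r0"
    using quotient_small[OF r0(1,2)] by blast
  define r where "r = min r0 r1"
  have r: "r > 0" "r \<le> \<rho>" "r \<le> r0" "r \<le> r1" using r0 r1 by (auto simp: r_def)
  have "norm (\<phi> (conj h x) - \<phi> (conj h y)) \<le> (4 * L0) * norm (\<phi> x - \<phi> y)"
    if h: "h \<in> carrier G" and x: "x \<in> nb r" and y: "y \<in> nb r" for h x y
  proof -
    define z where "z = inv y \<otimes> x"
    have xc: "x \<in> carrier G" and yc: "y \<in> carrier G" using x y nb_carrier by auto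
    have z: "z \<in> nb r0" unfolding z_def using r1(3) x y r(4) nb_mono by blast
    have zr: "z \<in> nb \<rho>" using z r0(2) nb_mono by blast
    have zc: "z \<in> carrier G" using z nb_carrier by blast
    have yz: "y \<otimes> z = x" unfolding z_def using xc yc by (simp add: inv_solve_left m_assoc[symmetric])
    have yr: "y \<in> nb \<rho>" using y r(2) nb_mono by blast
    have cy: "conj h y \<in> nb \<rho>" using L0 h y r(3) nb_mono by blast
    have cz: "conj h z \<in> nb \<rho>" "len (conj h z) \<le> L0 * len z" using L0 h z by blast+
    have "norm (\<phi> (conj h x) - \<phi> (conj h y)) \<le> 2 * len (conj h z)"
      using left_quotient_bounds(2)[OF cy cz(1)] conj_mult[OF h yc zc] yz by simp
    also have "\<dots> \<le> 2 * (L0 * len z)" using cz by simp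
    also have "\<dots> \<le> 2 * (L0 * (2 * norm (\<phi> x - \<phi> y)))"
      using left_quotient_bounds(1)[OF yr zr] yz r0(3) by (intro mult_left_mono) auto
    finally show ?thesis by simp
  qed
  then show ?thesis using that[of r "4 * L0"] r r0(3) by simp
qed

text \<open>The lower bound is the upper bound for \<open>inv h\<close> applied to the conjugates;
  the radius is shrunk so that these stay where the upper bound is valid.\<close>

lemma conj_bilipschitz:
  obtains r L where "r > 0" "r \<le> \<rho>" "L \<ge> 1"
    "\<And>h x y. h \<in> carrier G \<Longrightarrow> x \<in> nb r \<Longrightarrow> y \<in> nb r \<Longrightarrow>
       norm (\<phi> (conj h x) - \<phi> (conj h y)) \<le> L * norm (\<phi> x - \<phi> y) \<and>
       norm (\<phi> x - \<phi> y) \<le> L * norm (\<phi> (conj h x) - \<phi> (conj h y))"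
proof -
  obtain r0 L where r0: "r0 > 0" "r0 \<le> \<rho>" "L \<ge> 1"
    and L: "\<And>h x y. h \<in> carrier G \<Longrightarrow> x \<in> nb r0 \<Longrightarrow> y \<in> nb r0 \<Longrightarrow>
       norm (\<phi> (conj h x) - \<phi> (conj h y)) \<le> L * norm (\<phi> x - \<phi> y)"
    using conj_lipschitz by blast
  obtain r1 where r1: "r1 > 0" "r1 \<le> \<rho>" "\<And>h g. h \<in> carrier G \<Longrightarrow> g \<in> nb r1 \<Longrightarrow> conj h g \<in> nb r0"
    using conj_small[OF r0(1)] by blast
  define r where "r = min r0 r1"
  have r: "r > 0" "r \<le> \<rho>" "r \<le> r0" "r \<le> r1" using r0 r1 by (auto simp: r_def)
  have "norm (\<phi> x - \<phi> y) \<le> L * norm (\<phi> (conj h x) - \<phi> (conj h y))"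
    if h: "h \<in> carrier G" and x: "x \<in> nb r" and y: "y \<in> nb r" for h x y
  proof -
    have "conj h x \<in> nb r0" "conj h y \<in> nb r0" using r1(3) h x y r(4) nb_mono by blast+
    from L[OF inv_closed[OF h] this]
    show ?thesis using conj_conj_inv[OF h] nb_carrier[OF x] nb_carrier[OF y] by simp
  qed
  then show ?thesis using that[of r L] r r0(3) L nb_mono[OF _ r(3)] by simp
qed

text \<open>Conjugations are not assumed differentiable here: the second difference is controlled by
  writing \<open>x = p \<otimes> z\<close> and replacing \<open>y\<close> by \<open>p \<otimes> inv z\<close>, which conjugation respects.\<close>

lemma conj_midpoint:
  obtains r K where "r > 0" "r \<le> \<rho>" "K > 0"
    "\<And>h x y p. h \<in> carrier G \<Longrightarrow> x \<in> nb r \<Longrightarrow> y \<in> nb r \<Longrightarrow> p \<in> nb r \<Longrightarrow>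
       \<phi> p = (1/2) *\<^sub>R (\<phi> x + \<phi> y) \<Longrightarrow>
       norm (\<phi> (conj h x) + \<phi> (conj h y) - 2 *\<^sub>R \<phi> (conj h p)) \<le> K * (norm (\<phi> x - \<phi> y))\<^sup>2"
proof -
  obtain r0 L0 where r0: "r0 > 0" "r0 \<le> \<rho>" "L0 \<ge> 1"
    and L0: "\<And>h g. h \<in> carrier G \<Longrightarrow> g \<in> nb r0 \<Longrightarrow> conj h g \<in> nb \<rho> \<and> len (conj h g) \<le> L0 * len g"
    using conj_len_le by blast
  obtain rl L where rl: "rl > 0" "rl \<le> \<rho>" "L \<ge> 1"
    and Ll: "\<And>h x y. h \<in> carrier G \<Longrightarrow> x \<in> nb rl \<Longrightarrow> y \<in> nb rl \<Longrightarrow>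
       norm (\<phi> (conj h x) - \<phi> (conj h y)) \<le> L * norm (\<phi> x - \<phi> y)"
    using conj_lipschitz by blast
  define rb where "rb = min rl r0"
  have rb: "rb > 0" "rb \<le> \<rho>" "L \<ge> 1" "rb \<le> r0" and "rb \<le> rl" using rl r0 by (auto simp: rb_def)
  note L = Ll[OF _ nb_mono[OF _ \<open>rb \<le> rl\<close>] nb_mono[OF _ \<open>rb \<le> rl\<close>]]
  \<comment> \<open>With len p below rb/2 and len (inv z) below rb/8, the product y' stays in the
    ball of radius \<open>rb\<close>, where conjugation is Lipschitz.\<close>
  define s where "s = min r0 (rb/8)"
  have s: "s > 0" "s \<le> r0" "s \<le> rb/8" "s \<le> \<rho>" using r0 rb by (auto simp: s_def)
  obtain ri where ri: "ri > 0" "ri \<le> \<rho>" "\<And>a. a \<in> nb ri \<Longrightarrow> inv a \<in> nb s"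
    using inv_small[OF s(1)] by blast
  define t where "t = min s ri"
  have t: "t > 0" "t \<le> \<rho>" "t \<le> s" "t \<le> ri" using s ri by (auto simp: t_def)
  obtain r1 where r1: "r1 > 0" "r1 \<le> \<rho>"
    "\<And>x y. x \<in> nb r1 \<Longrightarrow> y \<in> nb r1 \<Longrightarrow> inv y \<otimes> x \<in> nb t \<and> x \<otimes> inv y \<in> nb t"
    using quotient_small[OF t(1,2)] by blast
  define r where "r = min (min r0 r1) (rb/2)"
  have r: "r > 0" "r \<le> \<rho>" "r \<le> r0" "r \<le> r1" "r \<le> rb/2" "r \<le> rb" using r0 r1 rb by (auto simp: r_def)
  \<comment> \<open>The \<open>L\<close> part pays for replacing y by y' under conjugation, the
    squared \<open>L0\<close> part for the second difference of the conjugated triple, whose step is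
    the conjugate of z.\<close>
  define K where "K = 4 * C * (L + L0\<^sup>2)"
  have K: "K > 0" using C_pos rb(3) by (simp add: K_def add_pos_nonneg)
  have "norm (\<phi> (conj h x) + \<phi> (conj h y) - 2 *\<^sub>R \<phi> (conj h p)) \<le> K * (norm (\<phi> x - \<phi> y))\<^sup>2"
    if h: "h \<in> carrier G" and x: "x \<in> nb r" and y: "y \<in> nb r" and p: "p \<in> nb r"
      and mid: "\<phi> p = (1/2) *\<^sub>R (\<phi> x + \<phi> y)" for h x y p
  proof -
    define z where "z = inv p \<otimes> x"
    define y' where "y' = p \<otimes> inv z"
    have xc: "x \<in> carrier G" and yc: "y \<in> carrier G" and pc: "p \<in> carrier G" using x y p nb_carrier by auto
    have z: "z \<in> nb t" unfolding z_def using r1(3) x p r(4) nb_mono by blast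
    have iz: "inv z \<in> nb s" using ri(3) z t(4) nb_mono by blast
    have zc: "z \<in> carrier G" using z nb_carrier by blast
    have zr: "z \<in> nb \<rho>" "z \<in> nb r0" and izr: "inv z \<in> nb \<rho>" "inv z \<in> nb r0"
      using z iz t s nb_mono by (meson order_trans)+
    have pr: "p \<in> nb \<rho>" "p \<in> nb r0" using p r nb_mono by blast+
    have pz: "p \<otimes> z = x" unfolding z_def using xc pc by (simp add: m_assoc[symmetric])
    have "len y' < rb"
      using len_mult_le[OF pr(1) izr(1)] nb_len[OF p] nb_len[OF iz] r(5) s(3) rb(1) unfolding y'_def by linarith
    then have y'b: "y' \<in> nb rb" using nb_mult_U[OF pr(1) izr(1)] by (auto simp: y'_def intro: nbI)
    have y'r: "y' \<in> nb \<rho>" using y'b rb(2) nb_mono by blast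
    have sd: "norm (\<phi> x + \<phi> y' - 2 *\<^sub>R \<phi> p) \<le> 4 * C * (len z)\<^sup>2"
      using second_difference[OF pr(1) zr(1) izr(1)] y'r pz by (simp add: y'_def)
    \<comment> \<open>Since \<open>p\<close> is the coordinate midpoint of x and y, the second
      difference of x, p, y' is exactly the displacement from y to y'.\<close>
    have eq0: "\<phi> x + \<phi> y' - 2 *\<^sub>R \<phi> p = \<phi> y' - \<phi> y" using mid by simp
    have yy: "norm (\<phi> y' - \<phi> y) \<le> 4 * C * (len z)\<^sup>2" using sd unfolding eq0 .
    have "norm (\<phi> (conj h y') - \<phi> (conj h y)) \<le> L * norm (\<phi> y' - \<phi> y)"
      using L[OF h y'b] y r(6) nb_mono by blast
    also have "\<dots> \<le> L * (4 * C * (len z)\<^sup>2)" using yy rb(3) by (intro mult_left_mono) auto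
    finally have e1: "norm (\<phi> (conj h y) - \<phi> (conj h y')) \<le> L * (4 * C * (len z)\<^sup>2)"
      by (simp add: norm_minus_commute)
    have cz: "conj h z \<in> nb \<rho>" "len (conj h z) \<le> L0 * len z" using L0[OF h zr(2)] by auto
    have ciz: "inv (conj h z) \<in> nb \<rho>" using L0[OF h izr(2)] conj_inv[OF h zc] by simp
    have cp: "conj h p \<in> nb \<rho>" using L0[OF h pr(2)] by auto
    have "p \<otimes> inv z = y'" by (simp add: y'_def)
    then have cy': "conj h p \<otimes> inv (conj h z) = conj h y'"
      using conj_mult[OF h pc inv_closed[OF zc]] conj_inv[OF h zc] by simp
    have "conj h y' \<in> nb \<rho>" using L0[OF h] y'b rb(4) nb_mono by blast
    then have sd2: "norm (\<phi> (conj h x) + \<phi> (conj h y') - 2 *\<^sub>R \<phi> (conj h p)) \<le> 4 * C * (len (conj h z))\<^sup>2"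
      using second_difference[OF cp cz(1) ciz] cy' conj_mult[OF h pc zc] pz by simp
    have "(len (conj h z))\<^sup>2 \<le> (L0 * len z)\<^sup>2" using cz(2) by (intro power_mono) auto
    then have "4 * C * (len (conj h z))\<^sup>2 \<le> 4 * C * (L0 * len z)\<^sup>2" using C_pos by (intro mult_left_mono) auto
    then have e2: "norm (\<phi> (conj h x) + \<phi> (conj h y') - 2 *\<^sub>R \<phi> (conj h p)) \<le> 4 * C * (L0 * len z)\<^sup>2"
      using sd2 by linarith
    have eq: "\<phi> (conj h x) + \<phi> (conj h y) - 2 *\<^sub>R \<phi> (conj h p)
      = (\<phi> (conj h x) + \<phi> (conj h y') - 2 *\<^sub>R \<phi> (conj h p)) + (\<phi> (conj h y) - \<phi> (conj h y'))" by simp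
    have "norm (\<phi> (conj h x) + \<phi> (conj h y) - 2 *\<^sub>R \<phi> (conj h p))
        \<le> 4 * C * (L0 * len z)\<^sup>2 + L * (4 * C * (len z)\<^sup>2)"
      unfolding eq by (rule norm_triangle_mono[OF e2 e1])
    also have "\<dots> = K * (len z)\<^sup>2" by (simp add: K_def power_mult_distrib algebra_simps)
    also have "\<dots> \<le> K * (norm (\<phi> x - \<phi> y))\<^sup>2"
    proof -
      have "\<phi> x - \<phi> p = (1/2) *\<^sub>R (\<phi> x - \<phi> y)" using mid
        by (simp add: algebra_simps flip: scaleR_add_left)
      then have "len z \<le> norm (\<phi> x - \<phi> y)"
        using left_quotient_bounds(1)[OF pr(1) zr(1)] pz by simp
      then show ?thesis using K by (intro mult_left_mono power_mono) auto
    qed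
    finally show ?thesis .
  qed
  then show ?thesis using that[of r K] r K by blast
qed

end

section \<open>Equivariant retraction onto a closed subgroup\<close>

locale compact_lie_subgroup = compact_lie_coords +
  fixes H
  assumes subgroup_H: "subgroup H G" and closed_H: "closedin TG H"
begin

lemma H_carrier: "h \<in> H \<Longrightarrow> h \<in> carrier G"
  using subgroup.mem_carrier[OF subgroup_H] .

lemmas H_closed [simp] = subgroup.m_closed[OF subgroup_H] subgroup.m_inv_closed[OF subgroup_H]
  subgroup.one_closed[OF subgroup_H]

lemma H_pow: "h \<in> H \<Longrightarrow> h [^] (n::nat) \<in> H"
  by (induction n) auto

text \<open>An approximate square root of \<open>u\<close> is a large power of a much smaller element of \<open>H\<close>
  pointing in nearly the same direction; it exists since directions accumulate.\<close>

lemma approx_half: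
  obtains r where "r > 0" "r \<le> \<rho>"
    "\<And>u. u \<in> H \<Longrightarrow> u \<in> nb r \<Longrightarrow> \<exists>w. w \<in> H \<and> w \<in> nb \<rho> \<and> norm (\<phi> w - (1/2) *\<^sub>R \<phi> u) \<le> len u / 8"
proof (rule ccontr)
  define bad where "bad u \<longleftrightarrow> u \<in> H \<and> (\<forall>w. w \<in> H \<and> w \<in> nb \<rho> \<longrightarrow> norm (\<phi> w - (1/2) *\<^sub>R \<phi> u) > len u / 8)" for u
  note conclude = that
  assume "\<not> thesis"
  have no: "\<exists>u. u \<in> nb r \<and> bad u" if r: "r > 0" "r \<le> \<rho>" for r
  proof (rule ccontr)
    assume "\<nexists>u. u \<in> nb r \<and> bad u"
    then have nb: "\<not> bad u" if "u \<in> nb r" for u using that by blast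
    have thesis
    proof (rule conclude[OF r])
      fix u assume "u \<in> H" "u \<in> nb r"
      with nb[of u] show "\<exists>w. w \<in> H \<and> w \<in> nb \<rho> \<and> norm (\<phi> w - (1/2) *\<^sub>R \<phi> u) \<le> len u / 8"
        unfolding bad_def by (metis not_less)
    qed
    then show False using \<open>\<not> thesis\<close> by blast
  qed
  have "\<exists>u. u \<in> nb (min \<rho> (1 / real (Suc n))) \<and> bad u" for n
    by (rule no) (use rho_pos in auto)
  then obtain u where u: "\<And>n. u n \<in> nb (min \<rho> (1 / real (Suc n)))" "\<And>n. bad (u n)" by metis
  have uH: "u n \<in> H" for n using u(2) by (simp add: bad_def)
  have ur: "u n \<in> nb \<rho>" for n using u(1)[of n] nb_mono by (meson min.cobounded1)
  have lu: "len (u n) < 1 / real (Suc n)" for n using nb_len[OF u(1)[of n]] by simp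
  \<comment> \<open>Otherwise \<open>\<one>\<close> would be an exact half; hence every bad element
    has a direction.\<close>
  have pos: "len (u n) > 0" for n
  proof (rule ccontr)
    assume "\<not> len (u n) > 0"
    then have "len (u n) = 0" using len_nonneg[of "u n"] by linarith
    then have "\<phi> (u n) = 0" "len (u n) = 0" by (auto simp: len_def)
    moreover have "norm (\<phi> \<one> - (1/2) *\<^sub>R \<phi> (u n)) > len (u n) / 8"
      using u(2)[of n] one_nb[OF rho_pos] unfolding bad_def by simp
    ultimately show False by (simp add: coord_one)
  qed
  define d where "d n = (1 / len (u n)) *\<^sub>R \<phi> (u n)" for n
  have nd: "norm (d n) = 1" for n
    using pos[of n] by (simp add: d_def len_def)
  have phi_d: "\<phi> (u n) = len (u n) *\<^sub>R d n" for n
    using pos[of n] by (simp add: d_def)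
  have "bounded (range d)" using nd by (auto simp: bounded_iff)
  then obtain l s where s: "strict_mono s" "(d \<circ> s) \<longlonglongrightarrow> l"
    using bounded_imp_convergent_subsequence by blast
  then have "Cauchy (d \<circ> s)" using LIMSEQ_imp_Cauchy by blast
  then obtain N where N: "\<And>m n. m \<ge> N \<Longrightarrow> n \<ge> N \<Longrightarrow> norm (d (s m) - d (s n)) < 1/100"
    unfolding Cauchy_iff by (metis comp_apply divide_pos_pos zero_less_numeral zero_less_one)
  have small: "\<exists>m\<ge>N. len (u (s m)) < e" if "e > 0" for e
  proof -
    obtain k where k: "1 / real (Suc k) < e" using \<open>e > 0\<close> nat_approx_posE by blast
    define m where "m = max N k"
    have "k \<le> s m" using seq_suble[OF s(1), of m] by (simp add: m_def)
    then have "1 / real (Suc (s m)) \<le> 1 / real (Suc k)" by (intro divide_left_mono) auto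
    then have "len (u (s m)) < e" using lu[of "s m"] k by linarith
    then show ?thesis by (intro exI[of _ m]) (simp add: m_def)
  qed
  \<comment> \<open>Error budget: this smallness makes the quadratic error of the power at most
    V/100. Taking \<open>a\<close> afterwards with length below V/100 lets k A miss V/2 by at most
    V/100, and directions within 1/100 of each other cost V/200. The total is less than the V/8
    allowed.\<close>
  obtain n where n: "n \<ge> N" "len (u (s n)) < 1 / (25 * C)" using small[of "1 / (25 * C)"] C_pos by auto
  define v where "v = u (s n)"
  define V where "V = len v"
  have V: "V > 0" "C * V \<le> 1/25" "V < \<rho>"
    using pos n(2) C_pos nb_len[OF ur] by (auto simp: V_def v_def field_simps)
  obtain m where m: "m \<ge> N" "len (u (s m)) < V / 100" using small[of "V/100"] V by auto
  define a where "a = u (s m)"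
  define A where "A = len a"
  have A: "A > 0" "A < V/100" using pos m(2) by (auto simp: A_def a_def)
  \<comment> \<open>About \<open>q\<close> steps of length A in the common direction cover half the
    length of v.\<close>
  define q where "q = V / (2 * A)"
  define k where "k = nat \<lfloor>q\<rfloor>"
  have q: "q \<ge> 0" using V A by (simp add: q_def)
  have "real k \<le> q" "q < real k + 1" using q unfolding k_def by linarith+
  then have kA: "real k * A \<le> V/2" "V/2 < real k * A + A" using A by (simp_all add: q_def field_simps)
  have "a \<in> nb \<rho>" using ur by (simp add: a_def)
  moreover have "2 * real k * len a < \<rho>" using kA(1) V(3) by (simp add: A_def)
  ultimately have w: "a [^] k \<in> nb \<rho>" "norm (\<phi> (a [^] k) - real k *\<^sub>R \<phi> a) \<le> C * (real k)\<^sup>2 * A\<^sup>2"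
    using pow_approx unfolding A_def by blast+
  have "C * (real k)\<^sup>2 * A\<^sup>2 = C * (real k * A)\<^sup>2" by (simp add: power_mult_distrib)
  also have "\<dots> \<le> C * (V/2)\<^sup>2" using kA(1) A C_pos by (intro mult_left_mono power_mono) auto
  also have "\<dots> = (C * V) * (V / 4)" by (simp add: power2_eq_square)
  also have "\<dots> \<le> 1/25 * (V/4)" using V by (intro mult_right_mono) auto
  finally have e1: "norm (\<phi> (a [^] k) - real k *\<^sub>R \<phi> a) \<le> V / 100" using w(2) by simp
  have "real k *\<^sub>R \<phi> a - (1/2) *\<^sub>R \<phi> v = (real k * A) *\<^sub>R d (s m) - (V/2) *\<^sub>R d (s n)"
    using phi_d by (simp add: a_def v_def A_def V_def)
  also have "\<dots> = (real k * A - V/2) *\<^sub>R d (s m) + (V/2) *\<^sub>R (d (s m) - d (s n))"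
    by (simp add: algebra_simps)
  finally have "norm (real k *\<^sub>R \<phi> a - (1/2) *\<^sub>R \<phi> v)
      \<le> norm ((real k * A - V/2) *\<^sub>R d (s m)) + norm ((V/2) *\<^sub>R (d (s m) - d (s n)))"
    using norm_triangle_ineq by metis
  also have "\<dots> \<le> V/100 + V/2 * (1/100)"
  proof (rule add_mono)
    show "norm ((real k * A - V/2) *\<^sub>R d (s m)) \<le> V/100" using nd kA A by simp
    have "norm ((V/2) *\<^sub>R (d (s m) - d (s n))) = V/2 * norm (d (s m) - d (s n))" using V by simp
    also have "\<dots> \<le> V/2 * (1/100)" using N[OF m(1) n(1)] V by (intro mult_left_mono) auto
    finally show "norm ((V/2) *\<^sub>R (d (s m) - d (s n))) \<le> V/2 * (1/100)" .
  qed
  finally have e2: "norm (real k *\<^sub>R \<phi> a - (1/2) *\<^sub>R \<phi> v) \<le> V/100 + V/2 * (1/100)" .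
  have "norm (\<phi> (a [^] k) - (1/2) *\<^sub>R \<phi> v) \<le> V/100 + (V/100 + V/2 * (1/100))"
    using norm_triangle_mono[OF e1 e2] by simp
  moreover have "norm (\<phi> (a [^] k) - (1/2) *\<^sub>R \<phi> v) > V / 8"
    using u(2)[of "s n"] w(1) H_pow[OF uH] unfolding bad_def v_def V_def a_def by blast
  ultimately show False using V by linarith
qed

text \<open>The error of a nearly optimal square root \<open>w\<close> can be halved, up to a quadratic term, by
  correcting \<open>w\<close> with an approximate square root of \<open>w\<^sup>-\<^sup>2 u\<close>; so it is quadratic itself.\<close>

lemma quadratic_half:
  obtains r K where "r > 0" "r \<le> \<rho>" "K > 0"
    "\<And>u. u \<in> H \<Longrightarrow> u \<in> nb r \<Longrightarrow> \<exists>w. w \<in> H \<and> w \<in> nb \<rho> \<and> norm (\<phi> w - (1/2) *\<^sub>R \<phi> u) \<le> K * (len u)\<^sup>2"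
proof -
  obtain r0 where r0: "r0 > 0" "r0 \<le> \<rho>"
    and weak: "\<And>u. u \<in> H \<Longrightarrow> u \<in> nb r0 \<Longrightarrow> \<exists>w. w \<in> H \<and> w \<in> nb \<rho> \<and> norm (\<phi> w - (1/2) *\<^sub>R \<phi> u) \<le> len u / 8"
    using approx_half by blast
  obtain ri where ri: "ri > 0" "ri \<le> \<rho>" "\<And>a. a \<in> nb ri \<Longrightarrow> inv a \<in> nb \<rho> \<and> len (inv a) \<le> 2 * len a"
    using inv_nb by blast
  \<comment> \<open>For t = len u < r: 3t < r0 admits u1 to the weak estimate, 5t < \<rho> keeps all
    products in the chart, and t^2 is at most 3t/8, so the error t/8 + t^2 of a nearly optimal w is
    at most t/2.\<close>
  define r where "r = min (min (r0/3) ri) (min (\<rho>/5) (3/8))"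
  have r: "r > 0" "r \<le> r0/3" "r \<le> ri" "r \<le> \<rho>/5" "r \<le> 3/8" "r \<le> \<rho>" "r \<le> r0"
    using r0 ri rho_pos by (auto simp: r_def)
  \<comment> \<open>Solving err w <= err w / 4 + 12 C t^2 + t^2 gives the 16 C; the 2 rounds up
    4/3.\<close>
  define K where "K = 2 + 16 * C"
  have "\<exists>w. w \<in> H \<and> w \<in> nb \<rho> \<and> norm (\<phi> w - (1/2) *\<^sub>R \<phi> u) \<le> K * (len u)\<^sup>2" if uH: "u \<in> H" and u: "u \<in> nb r" for u
  proof (cases "len u = 0")
    case True
    then show ?thesis using uH u r(6) nb_mono by (intro exI[of _ u]) (auto simp: len_def)
  next
    case False
    define t where "t = len u"
    have t: "t > 0" "t < r" using False nb_len[OF u] len_nonneg[of u] unfolding t_def by linarith+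
    have ur: "u \<in> nb \<rho>" "u \<in> nb r0" using u r nb_mono by blast+
    have Ct: "C * t \<le> 1/8" using C_len_le[OF ur(1)] by (simp add: t_def)
    define err where "err w = norm (\<phi> w - (1/2) *\<^sub>R \<phi> u)" for w
    define S where "S = err ` (H \<inter> nb \<rho>)"
    have Sne: "S \<noteq> {}" using one_nb[OF rho_pos] subgroup.one_closed[OF subgroup_H] by (auto simp: S_def simp del: H_closed)
    have bdd: "bdd_below S" by (rule bdd_belowI[of _ 0]) (auto simp: S_def err_def)
    \<comment> \<open>Comparing with the infimum replaces iteration of the correction. A slack of
      t^2 above the infimum is harmless, being of the order of the error to be proved.\<close>
    define m where "m = Inf S"
    have m_le: "m \<le> err w" if "w \<in> H" "w \<in> nb \<rho>" for w
      unfolding m_def by (rule cInf_lower[OF _ bdd]) (use that in \<open>auto simp: S_def\<close>)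
    have m0: "m \<le> t / 8" using weak[OF uH ur(2)] m_le by (force simp: err_def t_def)
    have "t\<^sup>2 > 0" using t by simp
    then have "Inf S < m + t\<^sup>2" by (simp add: m_def)
    then obtain w where w: "w \<in> H" "w \<in> nb \<rho>" "err w < m + t\<^sup>2"
      using cInf_lessD[OF Sne] by (auto simp: S_def)
    have t2: "t\<^sup>2 \<le> 3/8 * t" using t r(5) by (simp add: power2_eq_square)
    have ew: "err w \<le> t / 2" using w(3) m0 t2 by linarith
    have wc: "w \<in> carrier G" using w(1) H_carrier by blast
    have "len w \<le> err w + t/2"
      using norm_triangle_ineq2[of "\<phi> w" "(1/2) *\<^sub>R \<phi> u"] by (simp add: err_def len_def t_def)
    then have lw: "len w \<le> t" using ew by linarith
    define v where "v = inv w"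
    have "w \<in> nb ri" using lw t r(3) nb_U[OF w(2)] by (intro nbI) auto
    then have v: "v \<in> nb \<rho>" "len v \<le> 2 * t" using ri(3) lw unfolding v_def by fastforce+
    have vw: "norm (\<phi> w + \<phi> v) \<le> 2 * C * t\<^sup>2"
    proof -
      have "\<phi> \<one> - \<phi> w - \<phi> v = - (\<phi> w + \<phi> v)" by (simp add: coord_one)
      then have "norm (\<phi> w + \<phi> v) = norm (\<phi> (w \<otimes> v) - \<phi> w - \<phi> v)"
        using wc by (simp only: v_def r_inv norm_minus_cancel)
      also have "\<dots> \<le> C * len w * len v" by (rule mult_approx[OF w(2) v(1)])
      also have "\<dots> \<le> C * t * (2 * t)" using lw v(2) C_pos t by (intro mult_mono mult_left_mono) auto
      finally show ?thesis by (simp add: power2_eq_square)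
    qed
    define u' where "u' = v \<otimes> u"
    have lu': "len u' \<le> 4 * t" using len_mult_le[OF v(1) ur(1)] v(2) t unfolding u'_def t_def by linarith
    have u': "u' \<in> nb \<rho>"
      using lu' t r(4) nb_mult_U[OF v(1) ur(1)] by (intro nbI) (auto simp: u'_def)
    have a1: "norm (\<phi> u' - \<phi> v - \<phi> u) \<le> 2 * C * t\<^sup>2"
    proof -
      have "norm (\<phi> u' - \<phi> v - \<phi> u) \<le> C * len v * len u" unfolding u'_def by (rule mult_approx[OF v(1) ur(1)])
      also have "\<dots> \<le> C * (2 * t) * t" using v(2) C_pos t by (intro mult_mono mult_left_mono) (auto simp: t_def)
      finally show ?thesis by (simp add: power2_eq_square)
    qed
    \<comment> \<open>This is inv w inv w u. Up to O(t^2) its coordinates are -2 times the defect of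
      \<open>w\<close> as a half of u.\<close>
    define u1 where "u1 = v \<otimes> u'"
    have a2: "norm (\<phi> u1 - \<phi> v - \<phi> u') \<le> 8 * C * t\<^sup>2"
    proof -
      have "norm (\<phi> u1 - \<phi> v - \<phi> u') \<le> C * len v * len u'" unfolding u1_def by (rule mult_approx[OF v(1) u'])
      also have "\<dots> \<le> C * (2 * t) * (4 * t)" using v(2) lu' C_pos t by (intro mult_mono mult_left_mono) auto
      finally show ?thesis by (simp add: power2_eq_square)
    qed
    have eq: "\<phi> u1 - (\<phi> u - 2 *\<^sub>R \<phi> w)
      = ((\<phi> u1 - \<phi> v - \<phi> u') + (\<phi> u' - \<phi> v - \<phi> u)) + ((\<phi> w + \<phi> v) + (\<phi> w + \<phi> v))"
      by (simp add: scaleR_2)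
    have a3: "norm (\<phi> u1 - (\<phi> u - 2 *\<^sub>R \<phi> w)) \<le> (8 * C * t\<^sup>2 + 2 * C * t\<^sup>2) + (2 * C * t\<^sup>2 + 2 * C * t\<^sup>2)"
      unfolding eq by (intro norm_triangle_mono a1 a2 vw)
    have a3: "norm (\<phi> u1 - (\<phi> u - 2 *\<^sub>R \<phi> w)) \<le> 14 * (C * t\<^sup>2)" using a3 by linarith
    have n2: "norm (\<phi> u - 2 *\<^sub>R \<phi> w) = 2 * err w"
    proof -
      have "\<phi> u - 2 *\<^sub>R \<phi> w = (-2) *\<^sub>R (\<phi> w - (1/2) *\<^sub>R \<phi> u)" by (simp add: algebra_simps)
      then show ?thesis by (simp add: err_def)
    qed
    have lu1: "len u1 \<le> 2 * err w + 14 * (C * t\<^sup>2)"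
      using norm_triangle_ineq2[of "\<phi> u1" "\<phi> u - 2 *\<^sub>R \<phi> w"] a3 n2 unfolding len_def by linarith
    have Ct2: "C * t\<^sup>2 \<le> t/8" using mult_right_mono[OF Ct, of t] t by (simp add: power2_eq_square algebra_simps)
    have lu1': "len u1 \<le> 3 * t" using lu1 ew Ct2 t(1) by linarith
    have u1: "u1 \<in> nb r0"
      using lu1' t r(2) nb_mult_U[OF v(1) u'] by (intro nbI) (auto simp: u1_def)
    have u1H: "u1 \<in> H" using w(1) uH by (simp add: u1_def u'_def v_def)
    obtain w1 where w1: "w1 \<in> H" "w1 \<in> nb \<rho>" "norm (\<phi> w1 - (1/2) *\<^sub>R \<phi> u1) \<le> len u1 / 8"
      using weak[OF u1H u1] by blast
    have "len w1 \<le> len u1 / 8 + len u1 / 2"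
      using w1(3) norm_triangle_ineq2[of "\<phi> w1" "(1/2) *\<^sub>R \<phi> u1"] by (simp add: len_def)
    then have lw1: "len w1 \<le> 3 * t" using lu1' len_nonneg[of u1] by linarith
    \<comment> \<open>Half of \<open>u1\<close> cancels the defect of \<open>w\<close>. What remains
      is the weak error len u1 / 8, about a quarter of err w, plus terms in C t^2; minimality of m
      bounds it from below.\<close>
    define w' where "w' = w \<otimes> w1"
    have b1: "norm (\<phi> w' - \<phi> w - \<phi> w1) \<le> 3 * (C * t\<^sup>2)"
    proof -
      have "norm (\<phi> w' - \<phi> w - \<phi> w1) \<le> C * len w * len w1" unfolding w'_def by (rule mult_approx[OF w(2) w1(2)])
      also have "\<dots> \<le> C * t * (3 * t)" using lw lw1 C_pos t by (intro mult_mono mult_left_mono) auto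
      finally show ?thesis by (simp add: power2_eq_square)
    qed
    have b2: "norm ((1/2) *\<^sub>R (\<phi> u1 - (\<phi> u - 2 *\<^sub>R \<phi> w))) \<le> 7 * (C * t\<^sup>2)" using a3 by simp
    have eq2: "\<phi> w' - (1/2) *\<^sub>R \<phi> u = (\<phi> w' - \<phi> w - \<phi> w1) + ((\<phi> w1 - (1/2) *\<^sub>R \<phi> u1) +
        (1/2) *\<^sub>R (\<phi> u1 - (\<phi> u - 2 *\<^sub>R \<phi> w)))" by (simp add: algebra_simps)
    have "err w' \<le> 3 * (C * t\<^sup>2) + (len u1 / 8 + 7 * (C * t\<^sup>2))"
      unfolding err_def eq2 by (intro norm_triangle_mono b1 b2 w1(3))
    moreover have "0 \<le> C * t\<^sup>2" using C_pos by simp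
    ultimately have ew': "err w' \<le> err w / 4 + 12 * (C * t\<^sup>2)"
      using lu1 by linarith
    have "len w' < \<rho>" using len_mult_le[OF w(2) w1(2)] lw lw1 t r(4) unfolding w'_def by linarith
    then have w': "w' \<in> nb \<rho>" "w' \<in> H"
      using nb_mult_U[OF w(2) w1(2)] w(1) w1(1) by (auto simp: w'_def intro: nbI)
    have "m \<le> err w / 4 + 12 * (C * t\<^sup>2)" using m_le[OF w'(2,1)] ew' by linarith
    then have "err w \<le> 2 * t\<^sup>2 + 16 * (C * t\<^sup>2)" using w(3) \<open>t\<^sup>2 > 0\<close> by linarith
    then have "err w \<le> K * (len u)\<^sup>2" by (simp add: K_def t_def algebra_simps)
    then show ?thesis using w by (auto simp: err_def)
  qed
  moreover have "K > 0" using C_pos by (simp add: K_def)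
  ultimately show ?thesis using that[of r K] r by blast
qed

text \<open>Extended to the whole group by its boundary value, because conjugates and cosets of
  \<open>H\<close> leave the chart while the extrema below range over all of
  \<open>H\<close>.\<close>

definition trunc_sq :: "'a \<Rightarrow> real" where
  "trunc_sq g = (if g \<in> nb (\<rho>/2) then (len g)\<^sup>2 else (\<rho>/2)\<^sup>2)"

lemma trunc_sq_nonneg: "trunc_sq g \<ge> 0" by (simp add: trunc_sq_def)

lemma trunc_sq_less:
  assumes "trunc_sq g < s\<^sup>2" "0 < s" "s \<le> \<rho>/2"
  shows "g \<in> nb s"
proof -
  have "s\<^sup>2 \<le> (\<rho>/2)\<^sup>2" using assms by (intro power_mono) auto
  then have "trunc_sq g \<noteq> (\<rho>/2)\<^sup>2" using assms(1) by linarith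
  then have "g \<in> nb (\<rho>/2)" unfolding trunc_sq_def by presburger
  moreover from this have "(len g)\<^sup>2 < s\<^sup>2" using assms(1) by (simp add: trunc_sq_def)
  ultimately have "g \<in> U" "len g < s"
    using power2_less_imp_less[of "len g" s] assms(2) nb_U by auto
  then show ?thesis by (rule nbI)
qed

text \<open>Strict sublevel sets are open chart balls and strict superlevel sets are complements of
  closed chart balls, apart from the trivial thresholds. \<open>cball_closed\<close> is what rules
  out a jump at points outside the chart.\<close>

lemma trunc_sq_cont: "continuous_map TG euclideanreal trunc_sq"
proof -
  have rho: "\<rho>/2 > 0" "\<rho>/2 < \<rho>" using rho_pos by auto
  have "openin TG {g \<in> topspace TG. trunc_sq g < c}" for c
  proof (cases "0 < c \<and> c \<le> (\<rho>/2)\<^sup>2")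
    case True
    define s where "s = sqrt c"
    have s: "s > 0" "c = s\<^sup>2" using True by (simp_all add: s_def)
    have "s \<le> \<rho>/2" using power2_le_imp_le[of s "\<rho>/2"] True rho(1) s(2) by simp
    note s = s this
    have "{g \<in> topspace TG. trunc_sq g < c} = nb s"
    proof (intro equalityI subsetI)
      fix g assume "g \<in> {g \<in> topspace TG. trunc_sq g < c}"
      then show "g \<in> nb s" using trunc_sq_less s by blast
    next
      fix g assume g: "g \<in> nb s"
      have "(len g)\<^sup>2 < s\<^sup>2" using nb_len[OF g] by (intro power_strict_mono) auto
      then show "g \<in> {g \<in> topspace TG. trunc_sq g < c}"
        using g nb_mono[OF g s(3)] nb_carrier[OF g] s(2) by (simp add: trunc_sq_def topspace_TG)
    qed
    then show ?thesis using openin_nb[of s] s rho by simp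
  next
    case False
    then consider "c \<le> 0" | "c > (\<rho>/2)\<^sup>2" by linarith
    then show ?thesis
    proof cases
      case 1
      then have "{g \<in> topspace TG. trunc_sq g < c} = {}" using trunc_sq_nonneg by (auto simp: not_less intro: order_trans)
      then show ?thesis by (simp only: openin_empty)
    next
      case 2
      have "trunc_sq g \<le> (\<rho>/2)\<^sup>2" for g
        using nb_len[of g "\<rho>/2"] by (auto simp: trunc_sq_def intro!: power_mono)
      then have "{g \<in> topspace TG. trunc_sq g < c} = topspace TG" using 2 by (auto intro: le_less_trans)
      then show ?thesis by (simp only: openin_topspace)
    qed
  qed
  moreover have "openin TG {g \<in> topspace TG. trunc_sq g > c}" for c
  proof (cases "0 \<le> c \<and> c < (\<rho>/2)\<^sup>2")
    case True
    define s where "s = sqrt c"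
    have s: "s \<ge> 0" "c = s\<^sup>2" using True by (simp_all add: s_def)
    have "s < \<rho>/2" using power2_less_imp_less[of s "\<rho>/2"] True rho(1) s(2) by simp
    note s = s this
    have *: "trunc_sq g \<le> s\<^sup>2 \<longleftrightarrow> g \<in> U \<and> len g \<le> s" for g
    proof
      assume a: "trunc_sq g \<le> s\<^sup>2"
      then have "trunc_sq g \<noteq> (\<rho>/2)\<^sup>2" using True s(2) by linarith
      then have "g \<in> nb (\<rho>/2)" unfolding trunc_sq_def by presburger
      moreover from this have "(len g)\<^sup>2 \<le> s\<^sup>2" using a by (simp add: trunc_sq_def)
      ultimately show "g \<in> U \<and> len g \<le> s" using power2_le_imp_le[of "len g" s] s(1) nb_U by blast
    next
      assume "g \<in> U \<and> len g \<le> s"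
      then have "g \<in> nb (\<rho>/2)" "(len g)\<^sup>2 \<le> s\<^sup>2" using s by (auto intro: nbI power_mono)
      then show "trunc_sq g \<le> s\<^sup>2" by (simp add: trunc_sq_def)
    qed
    have "trunc_sq g > c \<longleftrightarrow> \<not> (g \<in> U \<and> norm (\<phi> g) \<le> s)" for g
      using *[of g] unfolding len_def s(2) by linarith
    then have "{g \<in> topspace TG. trunc_sq g > c} = topspace TG - {g \<in> U. norm (\<phi> g) \<le> s}"
      by blast
    then show ?thesis using cball_closed[of s] s rho by auto
  next
    case False
    then consider "c < 0" | "c \<ge> (\<rho>/2)\<^sup>2" by linarith
    then show ?thesis
    proof cases
      case 1
      then have "{g \<in> topspace TG. trunc_sq g > c} = topspace TG" using trunc_sq_nonneg by (auto intro: less_le_trans)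
      then show ?thesis by (simp only: openin_topspace)
    next
      case 2
      have "trunc_sq g \<le> (\<rho>/2)\<^sup>2" for g
        using nb_len[of g "\<rho>/2"] by (auto simp: trunc_sq_def intro!: power_mono)
      then have "{g \<in> topspace TG. trunc_sq g > c} = {}" using 2 by (auto simp: not_less intro: order_trans)
      then show ?thesis by (simp only: openin_empty)
    qed
  qed
  ultimately show ?thesis by (simp add: continuous_map_upper_lower_semicontinuous_lt)
qed

section \<open>Maximising over conjugates and minimising over cosets of \<open>H\<close>\<close>

lemma compact_H: "compact_space (subtopology TG H)"
  using closedin_compact_space[OF compact_TG closed_H] by (simp add: compact_space_subtopology)

lemma topspace_H: "topspace (subtopology TG H) = H"
  using H_carrier by (auto simp: topspace_TG)

lemma cont_from_H: "continuous_map (subtopology TG H) TG (\<lambda>h. h)"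
  by (simp add: continuous_map_from_subtopology)

text \<open>\<open>f g\<close> is the maximum of \<open>trunc_sq\<close> over the
  \<open>H\<close>-conjugates of g, and conjugating g by k reparametrises this family by h -> h k.
  That gives one inequality; the other is the same inequality for \<open>inv k\<close>.\<close>

lemma conj_invariant_function:
  obtains f where "continuous_map TG euclideanreal f"
    "\<And>g. g \<in> carrier G \<Longrightarrow> \<exists>h\<in>H. f g = trunc_sq (conj h g)"
    "\<And>g h. g \<in> carrier G \<Longrightarrow> h \<in> H \<Longrightarrow> trunc_sq (conj h g) \<le> f g"
    "\<And>g k. g \<in> carrier G \<Longrightarrow> k \<in> H \<Longrightarrow> f (conj k g) = f g"
proof -
  let ?P = "prod_topology TG (subtopology TG H)"
  have cont: "continuous_map ?P TG (\<lambda>p. conj (snd p) (fst p))"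
    unfolding conj_def
    by (intro cont_mult cont_inv continuous_map_fst continuous_map_compose[OF continuous_map_snd cont_from_H, unfolded o_def])
  have cF: "continuous_map ?P euclideanreal (\<lambda>p. trunc_sq (conj (snd p) (fst p)))"
    using continuous_map_compose[OF cont trunc_sq_cont] by (simp add: o_def)
  have ne: "topspace (subtopology TG H) \<noteq> {}" using H_closed(3) topspace_H by blast
  obtain f where f: "continuous_map TG euclideanreal f"
    "\<And>g. g \<in> carrier G \<Longrightarrow> \<exists>h\<in>H. f g = trunc_sq (conj h g)"
    "\<And>g h. g \<in> carrier G \<Longrightarrow> h \<in> H \<Longrightarrow> trunc_sq (conj h g) \<le> f g"
    by (rule compact_maximum[OF compact_H ne cF, unfolded topspace_H topspace_TG fst_conv snd_conv]) blast
  have le: "f (conj k g) \<le> f g" if g: "g \<in> carrier G" and k: "k \<in> H" for g k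
  proof -
    have kc: "k \<in> carrier G" using k H_carrier by blast
    obtain h where h: "h \<in> H" "f (conj k g) = trunc_sq (conj h (conj k g))" using f(2)[of "conj k g"] g kc by auto
    have "conj h (conj k g) = conj (h \<otimes> k) g"
      using h(1) kc g H_carrier by (simp add: conj_def m_assoc inv_mult_group)
    then show ?thesis using f(3)[OF g, of "h \<otimes> k"] h k by simp
  qed
  have "f (conj k g) = f g" if g: "g \<in> carrier G" and k: "k \<in> H" for g k
  proof (rule antisym[OF le[OF g k]])
    have kc: "k \<in> carrier G" using k H_carrier by blast
    show "f g \<le> f (conj k g)"
      using le[of "conj k g" "inv k"] g k kc conj_conj_inv[OF kc g] by simp
  qed
  with f show ?thesis using that by blast
qed

lemma trunc_sq_eq: "g \<in> nb (\<rho>/2) \<Longrightarrow> trunc_sq g = (len g)\<^sup>2"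
  by (simp add: trunc_sq_def)

text \<open>A supremum of uniformly strongly convex functions is strongly convex; so no averaging over
  \<open>H\<close> is needed to obtain an invariant strongly convex function.\<close>

lemma invariant_strongly_convex:
  obtains f r \<kappa> M where "continuous_map TG euclideanreal f" "r > 0" "r \<le> \<rho>/2" "\<kappa> > 0" "M > 0"
    "f \<one> = 0" "\<And>g. g \<in> carrier G \<Longrightarrow> 0 \<le> f g"
    "\<And>g k. g \<in> carrier G \<Longrightarrow> k \<in> H \<Longrightarrow> f (conj k g) = f g"
    "\<And>g s. g \<in> carrier G \<Longrightarrow> 0 < s \<Longrightarrow> s \<le> r \<Longrightarrow> f g < s\<^sup>2 \<Longrightarrow> g \<in> nb s"
    "\<And>x y p m. x \<in> nb r \<Longrightarrow> y \<in> nb r \<Longrightarrow> p \<in> nb r \<Longrightarrow> \<phi> p = (1/2) *\<^sub>R (\<phi> x + \<phi> y) \<Longrightarrow>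
       f x \<le> m \<Longrightarrow> f y \<le> m \<Longrightarrow> f p \<le> m - \<kappa> * (norm (\<phi> x - \<phi> y))\<^sup>2"
    "\<And>x y s. s \<le> r \<Longrightarrow> x \<in> nb s \<Longrightarrow> y \<in> nb s \<Longrightarrow> f x \<le> f y + M * s * norm (\<phi> x - \<phi> y)"
proof -
  obtain f where f: "continuous_map TG euclideanreal f"
    and f_ex: "\<And>g. g \<in> carrier G \<Longrightarrow> \<exists>h\<in>H. f g = trunc_sq (conj h g)"
    and f_ge: "\<And>g h. g \<in> carrier G \<Longrightarrow> h \<in> H \<Longrightarrow> trunc_sq (conj h g) \<le> f g"
    and f_inv: "\<And>g k. g \<in> carrier G \<Longrightarrow> k \<in> H \<Longrightarrow> f (conj k g) = f g"
    using conj_invariant_function by blast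
  obtain rc where rc: "rc > 0" "rc \<le> \<rho>" "\<And>h g. h \<in> carrier G \<Longrightarrow> g \<in> nb rc \<Longrightarrow> conj h g \<in> nb (\<rho>/2)"
    using conj_small[of "\<rho>/2"] rho_pos by auto
  obtain rl L where rl: "rl > 0" "rl \<le> \<rho>" "L \<ge> 1"
    and L: "\<And>h x y. h \<in> carrier G \<Longrightarrow> x \<in> nb rl \<Longrightarrow> y \<in> nb rl \<Longrightarrow>
       norm (\<phi> (conj h x) - \<phi> (conj h y)) \<le> L * norm (\<phi> x - \<phi> y) \<and>
       norm (\<phi> x - \<phi> y) \<le> L * norm (\<phi> (conj h x) - \<phi> (conj h y))"
    using conj_bilipschitz by blast
  obtain rk K where rk: "rk > 0" "rk \<le> \<rho>" "K > 0"
    and K: "\<And>h x y p. h \<in> carrier G \<Longrightarrow> x \<in> nb rk \<Longrightarrow> y \<in> nb rk \<Longrightarrow> p \<in> nb rk \<Longrightarrow>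
       \<phi> p = (1/2) *\<^sub>R (\<phi> x + \<phi> y) \<Longrightarrow>
       norm (\<phi> (conj h x) + \<phi> (conj h y) - 2 *\<^sub>R \<phi> (conj h p)) \<le> K * (norm (\<phi> x - \<phi> y))\<^sup>2"
    using conj_midpoint by blast
  \<comment> \<open>\<open>r * Q\<close> times D^2 bounds the terms caused by the midpoint error e.
    The last bound in \<open>r\<close> makes this at most half of D^2 / L^2, the gain from the
    parallelogram law; dividing the remaining half by 4 gives \<kappa>.\<close>
  define Q where "Q = 4 * L * K + 4 * K\<^sup>2"
  have Q: "Q > 0" using rl(3) rk(3) by (simp add: Q_def add_pos_nonneg)
  define r where "r = min (min (min rc rl) (min rk (\<rho>/2))) (min 1 (1 / (2 * L\<^sup>2 * Q)))"
  have r: "r > 0" "r \<le> rc" "r \<le> rl" "r \<le> rk" "r \<le> \<rho>/2" "r \<le> 1" "r \<le> 1 / (2 * L\<^sup>2 * Q)" "r \<le> \<rho>"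
    using rc rl rk rho_pos Q by (auto simp: r_def)
  have rQ: "r * Q \<le> 1 / (2 * L\<^sup>2)"
    using mult_right_mono[OF r(7), of Q] Q rl(3) by simp
  define \<kappa> where "\<kappa> = 1 / (8 * L\<^sup>2)"
  have \<kappa>: "\<kappa> > 0" using rl(3) by (simp add: \<kappa>_def)
  have lenc: "len (conj h g) \<le> L * s" if "h \<in> H" "g \<in> nb s" "s \<le> r" for h g s
  proof -
    have "g \<in> nb rl" "\<one> \<in> nb rl" using that r nb_mono one_nb rl(1) by (meson order_trans)+
    from L[OF H_carrier[OF that(1)] this]
    have "len (conj h g) \<le> L * len g" using H_carrier[OF that(1)] by (simp add: coord_one len_def)
    also have "\<dots> \<le> L * s" using nb_len[OF that(2)] rl(3) by (intro mult_left_mono) auto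
    finally show ?thesis .
  qed
  have ts: "trunc_sq (conj h g) = (len (conj h g))\<^sup>2" if "h \<in> H" "g \<in> nb r" for h g
    using trunc_sq_eq[OF rc(3)[OF H_carrier[OF that(1)] nb_mono[OF that(2) r(2)]]] .
  show ?thesis
  proof (rule that[of f r \<kappa> "2 * L\<^sup>2"])
    show "2 * L\<^sup>2 > 0" using rl(3) by simp
    show "f \<one> = 0"
    proof -
      obtain h where "h \<in> H" "f \<one> = trunc_sq (conj h \<one>)" using f_ex[of \<one>] by auto
      then show ?thesis using ts[OF _ one_nb[OF r(1)]] H_carrier by simp
    qed
    show "0 \<le> f g" if "g \<in> carrier G" for g
      using f_ex[OF that] trunc_sq_nonneg by auto
    show "g \<in> nb s" if "g \<in> carrier G" "0 < s" "s \<le> r" "f g < s\<^sup>2" for g s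
    proof (rule trunc_sq_less[OF _ that(2)])
      have "conj \<one> g = g" using that by (simp add: conj_def)
      then show "trunc_sq g < s\<^sup>2" using f_ge[OF that(1), of \<one>] that(4) by simp
    qed (use that r in auto)
    show "f p \<le> m - \<kappa> * (norm (\<phi> x - \<phi> y))\<^sup>2"
      if x: "x \<in> nb r" and y: "y \<in> nb r" and p: "p \<in> nb r" and mid: "\<phi> p = (1/2) *\<^sub>R (\<phi> x + \<phi> y)"
        and m: "f x \<le> m" "f y \<le> m" for x y p m
    proof -
      define D where "D = norm (\<phi> x - \<phi> y)"
      have D: "0 \<le> D" "D \<le> 2 * r"
        using norm_triangle_ineq4[of "\<phi> x" "\<phi> y"] nb_len[OF x] nb_len[OF y] by (auto simp: D_def len_def)
      \<comment> \<open>A single conjugator, attaining the maximum at p, suffices: at x and y its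
        value is at most that of \<open>f\<close>, which is the direction needed.\<close>
      obtain h where h: "h \<in> H" "f p = trunc_sq (conj h p)" using f_ex nb_carrier[OF p] by blast
      have hc: "h \<in> carrier G" using h H_carrier by blast
      define a b q where "a = \<phi> (conj h x)" and "b = \<phi> (conj h y)" and "q = \<phi> (conj h p)"
      define e where "e = a + b - 2 *\<^sub>R q"
      have e: "norm e \<le> K * D\<^sup>2"
        using K[OF hc nb_mono[OF x r(4)] nb_mono[OF y r(4)] nb_mono[OF p r(4)] mid]
        by (simp add: e_def a_def b_def q_def D_def)
      have na: "norm a \<le> L * r" "norm b \<le> L * r"
        using lenc[OF h(1) x] lenc[OF h(1) y] by (auto simp: a_def b_def len_def)
      have na2: "(norm a)\<^sup>2 \<le> m" "(norm b)\<^sup>2 \<le> m"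
        using f_ge[OF nb_carrier[OF x] h(1)] f_ge[OF nb_carrier[OF y] h(1)] ts[OF h(1) x] ts[OF h(1) y] m
        by (auto simp: a_def b_def len_def)
      have "D \<le> L * norm (a - b)"
        using L[OF hc nb_mono[OF x r(3)] nb_mono[OF y r(3)]] by (simp add: a_def b_def D_def)
      then have "D\<^sup>2 \<le> (L * norm (a - b))\<^sup>2" using D by (intro power_mono) auto
      then have ab: "D\<^sup>2 / L\<^sup>2 \<le> (norm (a - b))\<^sup>2"
        using rl(3) by (simp add: power_mult_distrib field_simps)
      have "2 *\<^sub>R q = (a + b) - e" by (simp add: e_def)
      then have "2 * norm q \<le> norm (a + b) + norm e" using norm_triangle_ineq4[of "a + b" e]
        by (metis norm_scaleR abs_numeral)
      then have "(2 * norm q)\<^sup>2 \<le> (norm (a + b) + norm e)\<^sup>2" by (intro power_mono) auto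
      also have "\<dots> = (norm (a + b))\<^sup>2 + (2 * norm (a + b) * norm e + norm e * norm e)"
        by (simp add: power2_eq_square algebra_simps)
      also have "(norm (a + b))\<^sup>2 = 2 * (norm a)\<^sup>2 + 2 * (norm b)\<^sup>2 - (norm (a - b))\<^sup>2"
        by (simp add: power2_norm_eq_inner inner_add_left inner_add_right inner_diff_left inner_diff_right inner_commute)
      finally have q1: "4 * (norm q)\<^sup>2 \<le> 2 * (norm a)\<^sup>2 + 2 * (norm b)\<^sup>2 - (norm (a - b))\<^sup>2
          + (2 * norm (a + b) * norm e + norm e * norm e)" by (simp add: power_mult_distrib)
      have "2 * norm (a + b) * norm e \<le> 2 * (2 * L * r) * (K * D\<^sup>2)"
        using norm_triangle_ineq[of a b] na e rl(3) r(1) by (intro mult_mono) auto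
      moreover have "norm e * norm e \<le> (4 * K * r) * (K * D\<^sup>2)"
      proof (rule mult_mono)
        have "D\<^sup>2 \<le> (2 * r) * (2 * r)" using D r(1) unfolding power2_eq_square by (intro mult_mono) auto
        also have "\<dots> \<le> 4 * r" using r(1,6) by simp
        finally have "K * D\<^sup>2 \<le> K * (4 * r)" using rk(3) by (intro mult_left_mono) auto
        then show "norm e \<le> 4 * K * r" using e by simp
      qed (use e rk(3) r(1) in auto)
      ultimately have "2 * norm (a + b) * norm e + norm e * norm e \<le> (r * Q) * D\<^sup>2"
        by (simp add: Q_def power2_eq_square algebra_simps)
      also have "\<dots> \<le> 1 / (2 * L\<^sup>2) * D\<^sup>2" using rQ by (intro mult_right_mono) auto
      finally have "4 * (norm q)\<^sup>2 \<le> 2 * (norm a)\<^sup>2 + 2 * (norm b)\<^sup>2 - D\<^sup>2 / L\<^sup>2 + 1 / (2 * L\<^sup>2) * D\<^sup>2"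
        using q1 ab by linarith
      also have "\<dots> \<le> 4 * m - 4 * (\<kappa> * D\<^sup>2)"
        using na2 by (simp add: \<kappa>_def field_simps)
      finally show ?thesis using h(2) ts[OF h(1) p] by (simp add: q_def len_def D_def)
    qed
    show "f x \<le> f y + 2 * L\<^sup>2 * s * norm (\<phi> x - \<phi> y)"
      if s: "s \<le> r" and x: "x \<in> nb s" and y: "y \<in> nb s" for x y s
    proof -
      define D where "D = norm (\<phi> x - \<phi> y)"
      have s0: "0 < s" using nb_len[OF x] len_nonneg[of x] by linarith
      obtain h where h: "h \<in> H" "f x = trunc_sq (conj h x)" using f_ex nb_carrier[OF x] by blast
      have hc: "h \<in> carrier G" using h H_carrier by blast
      have xr: "x \<in> nb r" "y \<in> nb r" using x y s nb_mono by blast+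
      define a b where "a = len (conj h x)" and "b = len (conj h y)"
      have "a \<le> L * s" "b \<le> L * s" using lenc h(1) x y s by (auto simp: a_def b_def)
      moreover have "a - b \<le> L * D"
      proof -
        have "a - b \<le> norm (\<phi> (conj h x) - \<phi> (conj h y))"
          using norm_triangle_ineq2 by (simp add: a_def b_def len_def)
        then show ?thesis
          using L[OF hc nb_mono[OF xr(1) r(3)] nb_mono[OF xr(2) r(3)]] by (simp add: D_def)
      qed
      ultimately have "(a - b) * (a + b) \<le> (L * D) * (L * s + L * s)"
        using rl(3) s0 by (intro mult_mono) (auto simp: a_def b_def D_def)
      then have "a\<^sup>2 \<le> b\<^sup>2 + 2 * L\<^sup>2 * s * D" by (simp add: power2_eq_square algebra_simps)
      then show ?thesis
        using h ts[OF h(1) xr(1)] ts[OF h(1) xr(2)] f_ge[OF nb_carrier[OF y] h(1)]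
        by (simp add: a_def b_def D_def)
    qed
  qed (use f f_inv r \<kappa> in auto)
qed

text \<open>Let a and b = u a both minimise \<open>f\<close> on Ha, at coordinate distance D. The
  coordinate midpoint p lowers \<open>f\<close> by \<kappa> D^2 but need not lie in Ha. With w an
  approximate square root of u, the point c = w a does lie in Ha and is within O(D^2) of p. The
  Lipschitz constant of \<open>f\<close> near \<open>\<one>\<close> is proportional to the radius s,
  so moving from p to c costs only O(s D^2). For small s this contradicts minimality unless D =
  0.\<close>

lemma coset_minimiser:
  obtains f \<epsilon> where "continuous_map TG euclideanreal f" "\<epsilon> > (0::real)" "f \<one> = 0"
    "\<And>g. g \<in> carrier G \<Longrightarrow> 0 \<le> f g"
    "\<And>g k. g \<in> carrier G \<Longrightarrow> k \<in> H \<Longrightarrow> f (conj k g) = f g"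
    "\<And>a u. a \<in> carrier G \<Longrightarrow> u \<in> H \<Longrightarrow> f a < \<epsilon> \<Longrightarrow> f (u \<otimes> a) = f a \<Longrightarrow>
       (\<And>w. w \<in> H \<Longrightarrow> f a \<le> f (w \<otimes> a)) \<Longrightarrow> u = \<one>"
proof -
  obtain f r \<kappa> M where f: "continuous_map TG euclideanreal f" "r > 0" "r \<le> \<rho>/2" "\<kappa> > 0" "M > 0"
    "f \<one> = 0" "\<And>g. g \<in> carrier G \<Longrightarrow> 0 \<le> f g"
    "\<And>g k. g \<in> carrier G \<Longrightarrow> k \<in> H \<Longrightarrow> f (conj k g) = f g"
    and f_nb: "\<And>g s. g \<in> carrier G \<Longrightarrow> 0 < s \<Longrightarrow> s \<le> r \<Longrightarrow> f g < s\<^sup>2 \<Longrightarrow> g \<in> nb s"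
    and f_convex: "\<And>x y p m. x \<in> nb r \<Longrightarrow> y \<in> nb r \<Longrightarrow> p \<in> nb r \<Longrightarrow> \<phi> p = (1/2) *\<^sub>R (\<phi> x + \<phi> y) \<Longrightarrow>
       f x \<le> m \<Longrightarrow> f y \<le> m \<Longrightarrow> f p \<le> m - \<kappa> * (norm (\<phi> x - \<phi> y))\<^sup>2"
    and f_lip: "\<And>x y s. s \<le> r \<Longrightarrow> x \<in> nb s \<Longrightarrow> y \<in> nb s \<Longrightarrow> f x \<le> f y + M * s * norm (\<phi> x - \<phi> y)"
    using invariant_strongly_convex by blast
  obtain rh K where rh: "rh > 0" "rh \<le> \<rho>" "K > 0"
    and half: "\<And>u. u \<in> H \<Longrightarrow> u \<in> nb rh \<Longrightarrow> \<exists>w. w \<in> H \<and> w \<in> nb \<rho> \<and> norm (\<phi> w - (1/2) *\<^sub>R \<phi> u) \<le> K * (len u)\<^sup>2"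
    using quadratic_half by blast
  \<comment> \<open>\<open>1 / (2*K)\<close> ensures that the approximate root is no longer than u,
    and \<open>\<rho>/4\<close> that its square is still in the chart.\<close>
  define t where "t = min rh (min (1 / (2*K)) (\<rho>/4))"
  have t: "t > 0" "t \<le> rh" "t \<le> 1 / (2*K)" "t \<le> \<rho>/4" "t \<le> \<rho>" using rh rho_pos by (auto simp: t_def)
  have tK: "K * t \<le> 1/2" using t(3) rh(3) by (simp add: field_simps)
  obtain rq where rq: "rq > 0" "rq \<le> \<rho>"
    "\<And>x y. x \<in> nb rq \<Longrightarrow> y \<in> nb rq \<Longrightarrow> inv y \<otimes> x \<in> nb t \<and> x \<otimes> inv y \<in> nb t"
    using quotient_small[OF t(1,5)] by blast
  \<comment> \<open>The product of 6 M, from the Lipschitz constant on the ball of radius 6s that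
    contains c, and 8 (C + K), from the distance between c and the midpoint.\<close>
  define B where "B = 48 * M * (C + K)"
  have B: "B > 0" using f(5) C_pos rh(3) by (simp add: B_def)
  define s where "s = min (r/6) (min rq (\<kappa> / (2*B)))"
  have s: "s > 0" "6 * s \<le> r" "s \<le> rq" "s \<le> r" "s \<le> \<kappa> / (2*B)" "s \<le> \<rho>" "6 * s \<le> \<rho>"
    using f rq B rho_pos by (auto simp: s_def)
  have sB: "B * s < \<kappa>"
  proof -
    have "B * s \<le> B * (\<kappa> / (2*B))" using s(5) B by (intro mult_left_mono) auto
    also have "\<dots> = \<kappa> / 2" using B by simp
    also have "\<dots> < \<kappa>" using f(4) by simp
    finally show ?thesis .
  qed
  have unique: "u = \<one>"
    if ac: "a \<in> carrier G" and uH: "u \<in> H" and fa: "f a < s\<^sup>2" and fu: "f (u \<otimes> a) = f a"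
      and min: "\<And>w. w \<in> H \<Longrightarrow> f a \<le> f (w \<otimes> a)" for a u
  proof -
    have uc: "u \<in> carrier G" using uH H_carrier by blast
    define b where "b = u \<otimes> a"
    have bc: "b \<in> carrier G" using ac uc by (simp add: b_def)
    have as: "a \<in> nb s" and bs: "b \<in> nb s"
      using f_nb[OF ac s(1,4) fa] f_nb[OF bc s(1,4)] fa fu by (auto simp: b_def)
    have ar: "a \<in> nb \<rho>" and br: "b \<in> nb \<rho>" using as bs s nb_mono by blast+
    have "b \<otimes> inv a = u" using ac uc by (simp add: b_def m_assoc)
    then have ut: "u \<in> nb t" using rq(3)[of b a] as bs s(3) nb_mono by metis
    then have ur: "u \<in> nb \<rho>" "u \<in> nb rh" using t nb_mono by blast+
    define D where "D = norm (\<phi> b - \<phi> a)"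
    define l where "l = len u"
    have l0: "l \<ge> 0" "l < t" using nb_len[OF ut] by (auto simp: l_def)
    have lD: "l \<le> 2 * D" using right_quotient_bounds(1)[OF ar ur(1)] by (simp add: l_def D_def b_def)
    have Ds: "D \<le> 2 * s"
      using norm_triangle_ineq4[of "\<phi> b" "\<phi> a"] nb_len[OF as] nb_len[OF bs] by (simp add: D_def len_def)
    obtain w where w: "w \<in> H" "w \<in> nb \<rho>" "norm (\<phi> w - (1/2) *\<^sub>R \<phi> u) \<le> K * l\<^sup>2"
      using half[OF uH ur(2)] by (auto simp: l_def)
    have wc: "w \<in> carrier G" using w H_carrier by blast
    have "K * l\<^sup>2 \<le> l / 2"
    proof -
      have "K * l\<^sup>2 = (K * l) * l" by (simp add: power2_eq_square)
      also have "\<dots> \<le> (K * t) * l" using l0 rh(3) by (intro mult_right_mono mult_left_mono) auto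
      also have "\<dots> \<le> 1/2 * l" using tK l0 by (intro mult_right_mono) auto
      finally show ?thesis by simp
    qed
    then have lw: "len w \<le> l"
      using w(3) norm_triangle_ineq2[of "\<phi> w" "(1/2) *\<^sub>R \<phi> u"] by (simp add: len_def l_def)
    define c where "c = w \<otimes> a"
    have dc: "norm (\<phi> c - \<phi> a) \<le> 2 * l"
      using right_quotient_bounds(2)[OF ar w(2)] lw by (simp add: c_def)
    have "len c < 6 * s"
    proof -
      have "len c \<le> norm (\<phi> c - \<phi> a) + len a"
        using norm_triangle_ineq2[of "\<phi> c" "\<phi> a"] by (simp add: len_def)
      also have "\<dots> \<le> 2 * l + len a" using dc by simp
      finally have "len c \<le> 2 * l + len a" .
      then show ?thesis
        using len_mult_le[OF w(2) ar] lw nb_len[OF as] lD Ds s(1) unfolding c_def by linarith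
    qed
    then have c6: "c \<in> nb (6 * s)" using nb_mult_U[OF w(2) ar] by (auto simp: c_def intro: nbI)
    have cr: "c \<in> nb \<rho>" using c6 s(7) nb_mono by blast
    \<comment> \<open>The points a, c = w a and w2 a are successive translates by w. Their second
      difference is O(l^2), and w2 a is within O(l^2) of b; so c is within O(l^2) of the midpoint of
      a and b.\<close>
    define w2 where "w2 = w \<otimes> w"
    have "len w2 < \<rho>" using len_mult_le[OF w(2) w(2)] lw l0 t(4) rho_pos unfolding w2_def by linarith
    then have w2: "w2 \<in> nb \<rho>" using nb_mult_U[OF w(2) w(2)] by (auto simp: w2_def intro: nbI)
    have Cl2: "C * len w * len w \<le> C * l\<^sup>2"
      using lw C_pos l0 unfolding power2_eq_square mult.assoc by (intro mult_left_mono mult_mono) auto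
    have e1: "norm (\<phi> w2 - \<phi> u) \<le> C * l\<^sup>2 + 2 * (K * l\<^sup>2)"
    proof -
      have eq: "\<phi> w2 - \<phi> u = (\<phi> w2 - \<phi> w - \<phi> w) + 2 *\<^sub>R (\<phi> w - (1/2) *\<^sub>R \<phi> u)"
        by (simp add: algebra_simps scaleR_2)
      have "norm (\<phi> w2 - \<phi> w - \<phi> w) \<le> C * l\<^sup>2"
        using mult_approx[OF w(2) w(2)] Cl2 unfolding w2_def by linarith
      moreover have "norm (2 *\<^sub>R (\<phi> w - (1/2) *\<^sub>R \<phi> u)) \<le> 2 * (K * l\<^sup>2)" using w(3) by simp
      ultimately show ?thesis unfolding eq by (rule norm_triangle_mono)
    qed
    have e2: "norm (\<phi> (w2 \<otimes> a) - \<phi> b) \<le> 2 * (C * l\<^sup>2 + 2 * (K * l\<^sup>2))"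
    proof -
      have "norm (\<phi> (w2 \<otimes> a) - \<phi> b - (\<phi> w2 - \<phi> u)) \<le> norm (\<phi> w2 - \<phi> u) / 8"
        using mult_diff_left[OF w2 ur(1) ar] C_len_mult_le(2)[OF ar, of "norm (\<phi> w2 - \<phi> u)"]
        unfolding b_def by simp
      then have "norm (\<phi> (w2 \<otimes> a) - \<phi> b) \<le> 2 * norm (\<phi> w2 - \<phi> u)"
        using norm_triangle_ineq2[of "\<phi> (w2 \<otimes> a) - \<phi> b" "\<phi> w2 - \<phi> u"] norm_ge_zero[of "\<phi> w2 - \<phi> u"]
        by linarith
      also have "\<dots> \<le> 2 * (C * l\<^sup>2 + 2 * (K * l\<^sup>2))"
        by (rule mult_left_mono[OF e1]) simp
      finally show ?thesis .
    qed
    have e3: "norm (\<phi> (w2 \<otimes> a) - \<phi> c - \<phi> c + \<phi> a) \<le> 2 * (C * l\<^sup>2)"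
    proof -
      have "w \<otimes> c = w2 \<otimes> a" using wc ac by (simp add: c_def w2_def m_assoc)
      then have "norm (\<phi> (w2 \<otimes> a) - \<phi> c - \<phi> c + \<phi> a) \<le> C * len w * norm (\<phi> c - \<phi> a)"
        using mult_diff_right[OF w(2) cr ar] by (simp add: c_def algebra_simps)
      also have "\<dots> \<le> C * l * (2 * l)" using lw dc C_pos l0 by (intro mult_mono mult_left_mono) auto
      finally show ?thesis by (simp add: power2_eq_square)
    qed
    obtain p where p: "p \<in> U" "\<phi> p = (1/2) *\<^sub>R (\<phi> b + \<phi> a)"
      using midpoint_in_U[of b a] nb_U nb_len ar br unfolding len_def by blast
    have "len p < s"
    proof -
      have "len p \<le> (1/2) * (len b + len a)"
        using norm_triangle_ineq[of "\<phi> b" "\<phi> a"] p(2) by (simp add: len_def)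
      then show ?thesis using nb_len[OF as] nb_len[OF bs] by simp
    qed
    then have ps: "p \<in> nb s" using p by (auto intro: nbI)
    have cp: "norm (\<phi> c - \<phi> p) \<le> 8 * (C + K) * D\<^sup>2"
    proof -
      have eq: "2 *\<^sub>R (\<phi> c - \<phi> p) = (\<phi> (w2 \<otimes> a) - \<phi> b) - (\<phi> (w2 \<otimes> a) - \<phi> c - \<phi> c + \<phi> a)"
        by (simp add: p(2) algebra_simps scaleR_2)
      have "2 * norm (\<phi> c - \<phi> p) = norm (2 *\<^sub>R (\<phi> c - \<phi> p))" by simp
      also have "\<dots> \<le> 2 * (C * l\<^sup>2 + 2 * (K * l\<^sup>2)) + 2 * (C * l\<^sup>2)"
        unfolding eq using norm_triangle_ineq4[of "\<phi> (w2 \<otimes> a) - \<phi> b" "\<phi> (w2 \<otimes> a) - \<phi> c - \<phi> c + \<phi> a"] e2 e3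
        by linarith
      finally have "norm (\<phi> c - \<phi> p) \<le> 2 * (C + K) * l\<^sup>2" by (simp add: algebra_simps)
      also have "\<dots> \<le> 2 * (C + K) * (2 * D)\<^sup>2"
        using lD l0 C_pos rh(3) by (intro mult_left_mono power_mono) auto
      also have "\<dots> = 8 * (C + K) * D\<^sup>2" by (simp add: power2_eq_square)
      finally show ?thesis .
    qed
    have p6: "p \<in> nb (6 * s)" and p_r: "p \<in> nb r" and ar': "a \<in> nb r" and br': "b \<in> nb r"
      using ps as bs nb_mono s(1,2,4) by (auto elim!: nb_mono)
    have "f a \<le> f c" using min[OF w(1)] by (simp add: c_def)
    also have "f c \<le> f p + M * (6 * s) * norm (\<phi> c - \<phi> p)" by (rule f_lip[OF s(2) c6 p6])
    also have "\<dots> \<le> f p + M * (6 * s) * (8 * (C + K) * D\<^sup>2)"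
      using cp f(5) s(1) by (intro add_left_mono mult_left_mono) auto
    also have "\<dots> = f p + (B * s) * D\<^sup>2" by (simp add: B_def)
    also have "\<dots> \<le> f a - \<kappa> * D\<^sup>2 + (B * s) * D\<^sup>2"
      using f_convex[OF br' ar' p_r p(2), of "f a"] fu by (simp add: b_def D_def)
    finally have "(\<kappa> - B * s) * D\<^sup>2 \<le> 0" by (simp add: algebra_simps)
    then have "D = 0" using sB by (simp add: mult_le_0_iff)
    then have "len u = 0" using lD l0 unfolding l_def by linarith
    then show "u = \<one>" using len_eq_0 nb_U[OF ut] by blast
  qed
  show ?thesis
    by (rule that[of f "s\<^sup>2"]) (use f s(1) unique in auto)
qed

text \<open>\<open>d g\<close> is the minimum of f(inv h g) over h in \<open>H\<close>, and
  \<open>r g\<close> is where it is attained. Conjugation invariance of \<open>f\<close> makes the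
  substitution of h l k for l and h g k for g harmless, which gives both invariance statements.
  Continuity of \<open>r\<close> is a closed graph argument with compact target
  \<open>H\<close>.\<close>

lemma equivariant_retraction:
  obtains d r \<epsilon> where "continuous_map TG euclideanreal d" "\<epsilon> > (0::real)" "d \<one> = 0"
    "\<And>g h k. g \<in> carrier G \<Longrightarrow> h \<in> H \<Longrightarrow> k \<in> H \<Longrightarrow> d (h \<otimes> g \<otimes> k) = d g"
    "continuous_map (subtopology TG {g \<in> carrier G. d g < \<epsilon>}) (subtopology TG H) r" "r \<one> = \<one>"
    "\<And>g. g \<in> carrier G \<Longrightarrow> d g < \<epsilon> \<Longrightarrow> r g \<in> H"
    "\<And>g h k. g \<in> carrier G \<Longrightarrow> d g < \<epsilon> \<Longrightarrow> h \<in> H \<Longrightarrow> k \<in> H \<Longrightarrow> r (h \<otimes> g \<otimes> k) = h \<otimes> r g \<otimes> k"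
proof -
  obtain f \<epsilon> where f: "continuous_map TG euclideanreal f" and eps: "\<epsilon> > (0::real)" and f1: "f \<one> = 0"
    and f0: "\<And>g. g \<in> carrier G \<Longrightarrow> 0 \<le> f g"
    and f_inv: "\<And>g k. g \<in> carrier G \<Longrightarrow> k \<in> H \<Longrightarrow> f (conj k g) = f g"
    and f_uniq: "\<And>a u. a \<in> carrier G \<Longrightarrow> u \<in> H \<Longrightarrow> f a < \<epsilon> \<Longrightarrow> f (u \<otimes> a) = f a \<Longrightarrow>
       (\<And>w. w \<in> H \<Longrightarrow> f a \<le> f (w \<otimes> a)) \<Longrightarrow> u = \<one>"
    using coset_minimiser by blast
  let ?P = "prod_topology TG (subtopology TG H)"
  have cont: "continuous_map ?P TG (\<lambda>p. inv (snd p) \<otimes> fst p)"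
    by (intro cont_mult cont_inv continuous_map_fst continuous_map_compose[OF continuous_map_snd cont_from_H, unfolded o_def])
  have cF: "continuous_map ?P euclideanreal (\<lambda>p. f (inv (snd p) \<otimes> fst p))"
    using continuous_map_compose[OF cont f] by (simp add: o_def)
  have ne: "topspace (subtopology TG H) \<noteq> {}" using H_closed(3) topspace_H by blast
  obtain d where d: "continuous_map TG euclideanreal d"
    and d_ex: "\<And>g. g \<in> carrier G \<Longrightarrow> \<exists>h\<in>H. d g = f (inv h \<otimes> g)"
    and d_le: "\<And>g h. g \<in> carrier G \<Longrightarrow> h \<in> H \<Longrightarrow> d g \<le> f (inv h \<otimes> g)"
    by (rule compact_minimum[OF compact_H ne cF, unfolded topspace_H topspace_TG fst_conv snd_conv]) blast
  have shift: "f (inv (h \<otimes> l \<otimes> k) \<otimes> (h \<otimes> g \<otimes> k)) = f (inv l \<otimes> g)"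
    if "g \<in> carrier G" "h \<in> H" "k \<in> H" "l \<in> H" for g h k l
  proof -
    have c: "h \<in> carrier G" "k \<in> carrier G" "l \<in> carrier G" using that H_carrier by auto
    have "inv (h \<otimes> l \<otimes> k) \<otimes> (h \<otimes> g \<otimes> k) = conj (inv k) (inv l \<otimes> g)"
      using c that by (simp add: conj_def m_assoc inv_mult_group)
    then show ?thesis using f_inv[of "inv l \<otimes> g" "inv k"] c that by simp
  qed
  have d_mono: "d (h \<otimes> g \<otimes> k) \<le> d g" if gc: "g \<in> carrier G" and "h \<in> H" "k \<in> H" for g h k
  proof -
    obtain l where l: "l \<in> H" "d g = f (inv l \<otimes> g)" using d_ex[OF gc] by auto
    have "h \<otimes> g \<otimes> k \<in> carrier G" "h \<otimes> l \<otimes> k \<in> H" using gc that l(1) H_carrier by auto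
    from d_le[OF this] show ?thesis unfolding shift[OF that l(1)] l(2) .
  qed
  have d_inv: "d (h \<otimes> g \<otimes> k) = d g" if "g \<in> carrier G" "h \<in> H" "k \<in> H" for g h k
  proof (rule antisym[OF d_mono[OF that]])
    have c: "h \<in> carrier G" "k \<in> carrier G" using that H_carrier by auto
    have "inv h \<otimes> (h \<otimes> g \<otimes> k) \<otimes> inv k = g" using c that by (simp add: m_assoc)
    moreover have "h \<otimes> g \<otimes> k \<in> carrier G" using that c by simp
    ultimately show "d g \<le> d (h \<otimes> g \<otimes> k)"
      using d_mono[of "h \<otimes> g \<otimes> k" "inv h" "inv k"] that(2,3) subgroup.m_inv_closed[OF subgroup_H] by simp
  qed
  define r where "r g = (THE h. h \<in> H \<and> f (inv h \<otimes> g) = d g)" for g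
  have uniq: "h = k" if g: "g \<in> carrier G" "d g < \<epsilon>" and h: "h \<in> H" "f (inv h \<otimes> g) = d g"
      and k: "k \<in> H" "f (inv k \<otimes> g) = d g" for g h k
  proof -
    have c: "h \<in> carrier G" "k \<in> carrier G" using h k H_carrier by auto
    \<comment> \<open>Left multiplication by this element takes inv h g to inv k g, the other
      minimiser of \<open>f\<close> on the same coset.\<close>
    have "inv k \<otimes> h = \<one>"
    proof (rule f_uniq[of "inv h \<otimes> g"])
      show "f (inv k \<otimes> h \<otimes> (inv h \<otimes> g)) = f (inv h \<otimes> g)"
        using c g h k by (simp add: m_assoc)
      fix w assume w: "w \<in> H"
      have "w \<otimes> (inv h \<otimes> g) = inv (h \<otimes> inv w) \<otimes> g"
        using c g H_carrier[OF w] by (simp add: inv_mult_group m_assoc)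
      then show "f (inv h \<otimes> g) \<le> f (w \<otimes> (inv h \<otimes> g))"
        using d_le[of g "h \<otimes> inv w"] h g w by simp
    qed (use c g h k in auto)
    then show ?thesis using inv_cancel(2)[OF c(2) c(1)] r_one[OF c(2)] by simp
  qed
  have r_prop: "r g \<in> H \<and> f (inv (r g) \<otimes> g) = d g" if g: "g \<in> carrier G" "d g < \<epsilon>" for g
    unfolding r_def
  proof (rule theI')
    show "\<exists>!h. h \<in> H \<and> f (inv h \<otimes> g) = d g" using d_ex[OF g(1)] uniq[OF g] by metis
  qed
  have r_eq: "r g = h" if "g \<in> carrier G" "d g < \<epsilon>" "h \<in> H" "f (inv h \<otimes> g) = d g" for g h
    using uniq[OF that(1,2)] r_prop[OF that(1,2)] that(3,4) by blast
  have d1: "d \<one> = 0"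
  proof (rule antisym)
    show "d \<one> \<le> 0" using d_le[of \<one> \<one>] f1 by simp
    obtain h where "h \<in> H" "d \<one> = f (inv h \<otimes> \<one>)" using d_ex[of \<one>] by auto
    then show "0 \<le> d \<one>" using f0 H_carrier by simp
  qed
  show ?thesis
  proof (rule that[of d \<epsilon> r])
    show "r \<one> = \<one>" by (rule r_eq) (use eps d1 f1 in auto)
    show "r (h \<otimes> g \<otimes> k) = h \<otimes> r g \<otimes> k" if "g \<in> carrier G" "d g < \<epsilon>" "h \<in> H" "k \<in> H" for g h k
    proof (rule r_eq)
      show "f (inv (h \<otimes> r g \<otimes> k) \<otimes> (h \<otimes> g \<otimes> k)) = d (h \<otimes> g \<otimes> k)"
        using shift[of g h k "r g"] r_prop that d_inv by simp
    qed (use that d_inv r_prop H_carrier in auto)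
    let ?O = "{g \<in> carrier G. d g < \<epsilon>}"
    have tO: "topspace (subtopology TG ?O) = ?O" by (auto simp: topspace_TG)
    show "continuous_map (subtopology TG ?O) (subtopology TG H) r"
      unfolding continuous_map_closedin
    proof (intro conjI allI impI)
      show "r \<in> topspace (subtopology TG ?O) \<rightarrow> topspace (subtopology TG H)"
        unfolding tO topspace_H using r_prop by auto
      fix S assume S: "closedin (subtopology TG H) S"
      \<comment> \<open>Over the region where d is below \<epsilon>, this closed set is the graph of
        \<open>r\<close> restricted to values in S; projecting it along compact \<open>H\<close>
        preserves closedness.\<close>
      define A where "A = {p \<in> topspace ?P. f (inv (snd p) \<otimes> fst p) - d (fst p) \<in> {0}} \<inter> {p \<in> topspace ?P. snd p \<in> S}"
      have "continuous_map ?P euclideanreal (\<lambda>p. f (inv (snd p) \<otimes> fst p) - d (fst p))"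
        using cF continuous_map_compose[OF continuous_map_fst d, unfolded o_def]
        by (intro continuous_map_diff) auto
      then have "closedin ?P A"
        unfolding A_def
        by (intro closedin_Int closedin_continuous_map_preimage[where Y = euclideanreal]
            closedin_continuous_map_preimage[OF continuous_map_snd S]) auto
      then have "closedin TG (fst ` A)"
        using closed_map_fst[OF compact_H] by (auto simp: closed_map_def)
      moreover have "{g \<in> topspace (subtopology TG ?O). r g \<in> S} = fst ` A \<inter> ?O"
      proof (intro equalityI subsetI)
        fix g assume "g \<in> {g \<in> topspace (subtopology TG ?O). r g \<in> S}"
        then have g: "g \<in> ?O" "r g \<in> S" unfolding tO by auto
        then have "(g, r g) \<in> A" using r_prop[of g] H_carrier by (auto simp: A_def topspace_TG)
        then show "g \<in> fst ` A \<inter> ?O" using g by force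
      next
        fix g assume g: "g \<in> fst ` A \<inter> ?O"
        then obtain h where h: "(g,h) \<in> A" by force
        then have "h \<in> H" "h \<in> S" "f (inv h \<otimes> g) = d g" by (auto simp: A_def)
        then have "r g = h" using r_eq g by blast
        then show "g \<in> {g \<in> topspace (subtopology TG ?O). r g \<in> S}" using g \<open>h \<in> S\<close> unfolding tO by auto
      qed
      ultimately show "closedin (subtopology TG ?O) {g \<in> topspace (subtopology TG ?O). r g \<in> S}"
        by (auto simp: closedin_subtopology)
    qed
  qed (use d eps d1 d_inv r_prop in auto)
qed

end

section \<open>Local coordinates of a Lie group\<close>

text \<open>\<open>smooth_k\<close> provides continuity of derivatives one direction at a time.
  Bounding the operator norm by finitely many basis values turns this into a locally uniform
  bound.\<close>

lemma linear_norm_le_Basis: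
  fixes L :: "'a::euclidean_space \<Rightarrow> 'b::real_normed_vector"
  assumes "linear L"
  shows "norm (L v) \<le> (\<Sum>b\<in>Basis. norm (L b)) * norm v"
proof -
  have "L v = L (\<Sum>b\<in>Basis. (v \<bullet> b) *\<^sub>R b)" by (simp add: euclidean_representation)
  also have "\<dots> = (\<Sum>b\<in>Basis. (v \<bullet> b) *\<^sub>R L b)"
    using assms by (simp add: linear_sum linear_scale)
  finally have "norm (L v) \<le> (\<Sum>b\<in>Basis. norm ((v \<bullet> b) *\<^sub>R L b))" by (simp only: norm_sum)
  also have "\<dots> \<le> (\<Sum>b\<in>Basis. norm v * norm (L b))"
    by (intro sum_mono) (simp add: Basis_le_norm mult_right_mono)
  finally show ?thesis by (simp add: mult.commute flip: sum_distrib_left)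
qed

text \<open>The mean value inequality is applied twice: in the second variable to the first partial
  derivatives, then in the first variable to the difference of two slices. \<open>T\<close> may have
  empty interior, when charts take values in a proper subspace; derivatives within \<open>T\<close>
  still restrict to the convex slices, on which the inequality is applied.\<close>

lemma smooth_mixed_difference:
  fixes \<mu> :: "'e::euclidean_space \<times> 'e \<Rightarrow> 'f::real_normed_vector"
  assumes smooth: "smooth_on T \<mu>" and S: "convex S" "p0 \<in> S" and r0: "r0 > 0"
    and sub: "(S \<inter> ball p0 r0) \<times> (S \<inter> ball p0 r0) \<subseteq> T"
  obtains r C where "r > 0" "r \<le> r0" "C > 0"
    "\<And>w w' x y. w \<in> S \<inter> ball p0 r \<Longrightarrow> w' \<in> S \<inter> ball p0 r \<Longrightarrow> x \<in> S \<inter> ball p0 r \<Longrightarrow> y \<in> S \<inter> ball p0 r \<Longrightarrow>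
      norm (\<mu> (w,x) - \<mu> (w,y) - \<mu> (w',x) + \<mu> (w',y)) \<le> C * norm (w - w') * norm (x - y)"
proof -
  have "smooth_k (Suc (Suc 0)) T \<mu>" using smooth unfolding smooth_on_def by blast
  then obtain Df where Df: "\<And>p. p \<in> T \<Longrightarrow> (\<mu> has_derivative Df p) (at p within T)"
    and "\<And>v. \<exists>D2. (\<forall>p\<in>T. ((\<lambda>p. Df p v) has_derivative D2 p) (at p within T)) \<and> (\<forall>w. continuous_on T (\<lambda>p. D2 p w))"
    by auto
  then obtain D2 where D2: "\<And>v p. p \<in> T \<Longrightarrow> ((\<lambda>p. Df p v) has_derivative D2 v p) (at p within T)"
    and D2c: "\<And>v w. continuous_on T (\<lambda>p. D2 v p w)" by metis
  define g where "g p = (\<Sum>b\<in>Basis. \<Sum>c\<in>Basis. norm (D2 (b,0) p (0,c)))" for p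
  have gc: "continuous_on T g"
    unfolding g_def by (intro continuous_intros D2c)
  have p0T: "(p0,p0) \<in> T" using sub S r0 by auto
  define K where "K = g (p0,p0) + 1"
  have K: "K > 0" unfolding K_def g_def by (intro add_nonneg_pos sum_nonneg) auto
  obtain \<delta> where \<delta>: "\<delta> > 0" "\<And>p. p \<in> T \<Longrightarrow> dist p (p0,p0) < \<delta> \<Longrightarrow> dist (g p) (g (p0,p0)) < 1"
    using gc p0T unfolding continuous_on_iff by (meson zero_less_one)
  define r where "r = min r0 (\<delta>/2)"
  have r: "r > 0" "r \<le> r0" "r \<le> \<delta>/2" using r0 \<delta> by (auto simp: r_def)
  define B where "B = S \<inter> ball p0 r"
  have cB: "convex B" unfolding B_def using S by (intro convex_Int) auto
  have BT: "(w,z) \<in> T" if "w \<in> B" "z \<in> B" for w z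
    using that sub r(2) by (auto simp: B_def)
  have gK: "g (w,z) \<le> K" if "w \<in> B" "z \<in> B" for w z
  proof -
    have "dist (w,z) (p0,p0) \<le> dist w p0 + dist z p0"
      unfolding dist_norm by (simp add: norm_Pair sqrt_sum_squares_le_sum)
    also have "\<dots> < \<delta>" using that r(3) by (auto simp: B_def dist_commute)
    finally have "dist (g (w,z)) (g (p0,p0)) < 1" using \<delta>(2) BT that by blast
    then show ?thesis by (simp add: K_def dist_real_def)
  qed
  have step1: "norm (Df (w,x) (b,0) - Df (w,y) (b,0)) \<le> K * norm (x - y)"
    if b: "b \<in> Basis" and w: "w \<in> B" and x: "x \<in> B" and y: "y \<in> B" for b w x y
  proof (rule differentiable_bound[OF cB _ _ x y])
    fix z assume z: "z \<in> B"
    show "((\<lambda>z. Df (w,z) (b,0)) has_derivative (\<lambda>v. D2 (b,0) (w,z) (0,v))) (at z within B)"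
      by (rule has_derivative_in_compose2[where g = "\<lambda>p. Df p (b,0)" and t = T and f = "\<lambda>z. (w,z)"])
        (use D2 BT w z in \<open>auto intro!: derivative_eq_intros\<close>)
    show "onorm (\<lambda>v. D2 (b,0) (w,z) (0,v)) \<le> K"
    proof (rule onorm_le)
      fix v
      have lin: "linear (D2 (b,0) (w,z))" using D2 BT w z has_derivative_linear by blast
      have "linear (\<lambda>v. D2 (b,0) (w,z) (0,v))"
        using linear_compose[of "\<lambda>v. (0,v)" "D2 (b,0) (w,z)"] lin by (simp add: o_def linear_iff)
      from linear_norm_le_Basis[OF this, of v]
      have "norm (D2 (b,0) (w,z) (0,v)) \<le> (\<Sum>c\<in>Basis. norm (D2 (b,0) (w,z) (0,c))) * norm v" .
      also have "(\<Sum>c\<in>Basis. norm (D2 (b,0) (w,z) (0,c))) \<le> g (w,z)"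
        unfolding g_def using b
        by (intro member_le_sum[where f = "\<lambda>b. \<Sum>c\<in>Basis. norm (D2 (b,0) (w,z) (0,c))"]) (auto intro: sum_nonneg)
      also have "\<dots> \<le> K" using gK w z by blast
      finally show "norm (D2 (b,0) (w,z) (0,v)) \<le> K * norm v" by (simp add: mult_right_mono)
    qed
  qed
  define C where "C = real DIM('e) * K"
  have C: "C > 0" using K by (simp add: C_def)
  have "norm (\<mu> (w,x) - \<mu> (w,y) - \<mu> (w',x) + \<mu> (w',y)) \<le> C * norm (w - w') * norm (x - y)"
    if w: "w \<in> B" and w': "w' \<in> B" and x: "x \<in> B" and y: "y \<in> B" for w w' x y
  proof -
    have "norm ((\<mu> (w,x) - \<mu> (w,y)) - (\<mu> (w',x) - \<mu> (w',y))) \<le> (C * norm (x - y)) * norm (w - w')"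
    proof (rule differentiable_bound[OF cB _ _ w w'])
      fix z assume z: "z \<in> B"
      have d: "((\<lambda>w. \<mu> (w,x)) has_derivative (\<lambda>u. Df (z,x) (u,0))) (at z within B)" if x: "x \<in> B" for x
        by (rule has_derivative_in_compose2[where g = \<mu> and t = T and f = "\<lambda>w. (w,x)"])
          (use Df BT x z in \<open>auto intro!: derivative_eq_intros\<close>)
      show "((\<lambda>w. \<mu> (w,x) - \<mu> (w,y)) has_derivative (\<lambda>u. Df (z,x) (u,0) - Df (z,y) (u,0))) (at z within B)"
        by (intro has_derivative_diff d x y)
      show "onorm (\<lambda>u. Df (z,x) (u,0) - Df (z,y) (u,0)) \<le> C * norm (x - y)"
      proof (rule onorm_le)
        fix u
        have lin: "linear (\<lambda>u. Df (z,x) (u,0) - Df (z,y) (u,0))"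
          using has_derivative_linear[OF has_derivative_diff[OF d[OF x] d[OF y]]] .
        have "norm (Df (z,x) (u,0) - Df (z,y) (u,0))
            \<le> (\<Sum>b\<in>Basis. norm (Df (z,x) (b,0) - Df (z,y) (b,0))) * norm u"
          by (rule linear_norm_le_Basis[OF lin])
        also have "\<dots> \<le> (\<Sum>b\<in>(Basis::'e set). K * norm (x - y)) * norm u"
          by (intro mult_right_mono sum_mono step1 z x y) auto
        finally show "norm (Df (z,x) (u,0) - Df (z,y) (u,0)) \<le> C * norm (x - y) * norm u"
          by (simp add: C_def)
      qed
    qed
    then show ?thesis by (simp add: algebra_simps)
  qed
  then show ?thesis using that[of r C] r C unfolding B_def by blast
qed

text \<open>One chart around the identity serves for both factors and for the product, and is
  recentred at the origin. Smoothness then speaks of multiplication near a single point of the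
  product of the model subspace with itself.\<close>

lemma lie_coords_exist:
  fixes G :: "('g, 'b) monoid_scheme"
  assumes "lie_group G TG TYPE('e::euclidean_space)"
  obtains U and \<phi> :: "'g \<Rightarrow> 'e::euclidean_space" and C \<rho> where "lie_coords G TG U \<phi> C \<rho>"
proof -
  have tg: "topological_group G TG" and haus: "Hausdorff_space TG" using assms by (auto simp: lie_group_def)
  interpret group G using tg by (simp add: topological_group_def)
  have top: "topspace TG = carrier G"
    and multc: "continuous_map (prod_topology TG TG) TG (\<lambda>(x,y). x \<otimes>\<^bsub>G\<^esub> y)"
    using tg by (auto simp: topological_group_def)
  obtain S :: "'e set" and A where at: "smooth_atlas TG S A"
    and sm: "\<forall>(U,\<phi>)\<in>A. \<forall>(V,\<psi>)\<in>A. \<forall>(W,\<kappa>)\<in>A.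
          smooth_on {(a,b). a \<in> \<phi> ` U \<and> b \<in> \<psi> ` V \<and> inv_into U \<phi> a \<otimes>\<^bsub>G\<^esub> inv_into V \<psi> b \<in> W}
                    (\<lambda>(a,b). \<kappa> (inv_into U \<phi> a \<otimes>\<^bsub>G\<^esub> inv_into V \<psi> b))"
    using assms unfolding lie_group_def by blast
  have S: "subspace S" and cover: "\<Union>(fst ` A) = topspace TG"
    and charts: "\<forall>(U,\<phi>)\<in>A. openin TG U \<and> openin (top_of_set S) (\<phi> ` U) \<and>
                 homeomorphic_map (subtopology TG U) (top_of_set (\<phi> ` U)) \<phi>"
    using at unfolding smooth_atlas_def by blast+
  have "\<one>\<^bsub>G\<^esub> \<in> \<Union>(fst ` A)" using cover top by simp
  then obtain U f where UA: "(U,f) \<in> A" and oneU: "\<one>\<^bsub>G\<^esub> \<in> U" by auto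
  have Uo: "openin TG U" and fUo: "openin (top_of_set S) (f ` U)"
    and hm: "homeomorphic_map (subtopology TG U) (top_of_set (f ` U)) f"
    using charts UA by auto
  have UG: "U \<subseteq> carrier G" using openin_subset[OF Uo] top by simp
  have tU: "topspace (subtopology TG U) = U" using UG top by auto
  have fcont: "continuous_map (subtopology TG U) (top_of_set (f ` U)) f"
    and fopen: "open_map (subtopology TG U) (top_of_set (f ` U)) f"
    using hm by (auto simp: homeomorphic_map_def homeomorphic_imp_open_map hm intro: homeomorphic_imp_continuous_map)
  have finj: "inj_on f U" using homeomorphic_imp_injective_map[OF hm] tU by simp
  obtain finv where fm: "homeomorphic_maps (subtopology TG U) (top_of_set (f ` U)) f finv"
    using hm homeomorphic_map_maps by blast
  have finv: "finv (f g) = g" if "g \<in> U" for g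
    using fm that tU unfolding homeomorphic_maps_def by auto
  have finvc: "continuous_map (top_of_set (f ` U)) (subtopology TG U) finv"
    using fm unfolding homeomorphic_maps_def by auto
  have fUS: "f ` U \<subseteq> S" using openin_subset[OF fUo] by simp
  define p0 where "p0 = f \<one>\<^bsub>G\<^esub>"
  have p0: "p0 \<in> S" using oneU fUS by (auto simp: p0_def)
  have image_ball: "\<exists>e>0. S \<inter> ball p0 e \<subseteq> f ` (V \<inter> U)" if V: "openin TG V" "\<one>\<^bsub>G\<^esub> \<in> V" for V
  proof -
    have "openin (subtopology TG U) (V \<inter> U)" using V(1) by (auto simp: openin_subtopology)
    then have "openin (top_of_set (f ` U)) (f ` (V \<inter> U))" using fopen unfolding open_map_def by blast
    then have "openin (top_of_set S) (f ` (V \<inter> U))" using fUo openin_trans by blast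
    moreover have "p0 \<in> f ` (V \<inter> U)" using V oneU by (auto simp: p0_def)
    ultimately obtain e where "e > 0" "ball p0 e \<inter> S \<subseteq> f ` (V \<inter> U)"
      using openin_contains_ball by (metis (no_types, lifting))
    then show ?thesis by (auto simp: Int_commute)
  qed
  let ?W = "{p \<in> topspace (prod_topology TG TG). (case p of (x,y) \<Rightarrow> x \<otimes>\<^bsub>G\<^esub> y) \<in> U}"
  have Wo: "openin (prod_topology TG TG) ?W" by (rule openin_continuous_map_preimage[OF multc Uo])
  have W1: "(\<one>\<^bsub>G\<^esub>, \<one>\<^bsub>G\<^esub>) \<in> ?W" using oneU top by simp
  obtain N1 N2 where N: "openin TG N1" "openin TG N2" "\<one>\<^bsub>G\<^esub> \<in> N1" "\<one>\<^bsub>G\<^esub> \<in> N2" "N1 \<times> N2 \<subseteq> ?W"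
    using Wo[unfolded openin_prod_topology_alt, rule_format, OF W1] by (elim exE conjE)
  have "openin TG (N1 \<inter> N2)" using N by blast
  then obtain e1 where e1: "e1 > 0" "S \<inter> ball p0 e1 \<subseteq> f ` (N1 \<inter> N2 \<inter> U)" using image_ball N by (metis IntI)
  have inN: "g \<in> N1 \<inter> N2" if g: "g \<in> U" "f g \<in> S \<inter> ball p0 e1" for g
  proof -
    obtain g' where "g' \<in> N1 \<inter> N2 \<inter> U" "f g = f g'" using g(2) e1(2) by blast
    then show ?thesis using finj g(1) by (auto simp: inj_on_def)
  qed
  have multU: "a \<otimes>\<^bsub>G\<^esub> b \<in> U" if "a \<in> U" "b \<in> U" "f a \<in> ball p0 e1" "f b \<in> ball p0 e1" for a b
  proof -
    have "a \<in> N1" "b \<in> N2" using inN[of a] inN[of b] that fUS by auto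
    then have "(a,b) \<in> ?W" using N(5) by blast
    then show ?thesis by simp
  qed
  define T where "T = {(a,b). a \<in> f ` U \<and> b \<in> f ` U \<and> inv_into U f a \<otimes>\<^bsub>G\<^esub> inv_into U f b \<in> U}"
  define \<mu> where "\<mu> = (\<lambda>(a,b). f (inv_into U f a \<otimes>\<^bsub>G\<^esub> inv_into U f b))"
  have mu: "\<mu> (f a, f b) = f (a \<otimes>\<^bsub>G\<^esub> b)" if "a \<in> U" "b \<in> U" for a b
    using that finj by (simp add: \<mu>_def inv_into_f_f)
  have smT: "smooth_on T \<mu>" using sm UA unfolding T_def \<mu>_def by fast
  have sub: "(S \<inter> ball p0 e1) \<times> (S \<inter> ball p0 e1) \<subseteq> T"
  proof (clarify)
    fix a b assume a: "a \<in> S" "a \<in> ball p0 e1" and b: "b \<in> S" "b \<in> ball p0 e1"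
    obtain a' b' where ab: "a' \<in> U" "a = f a'" "b' \<in> U" "b = f b'" using e1(2) a b by blast
    then show "(a,b) \<in> T" using multU[of a' b'] a b finj by (auto simp: T_def inv_into_f_f)
  qed
  obtain r C where r: "r > 0" "r \<le> e1" "C > 0"
    and md: "\<And>w w' x y. w \<in> S \<inter> ball p0 r \<Longrightarrow> w' \<in> S \<inter> ball p0 r \<Longrightarrow> x \<in> S \<inter> ball p0 r \<Longrightarrow> y \<in> S \<inter> ball p0 r \<Longrightarrow>
      norm (\<mu> (w,x) - \<mu> (w,y) - \<mu> (w',x) + \<mu> (w',y)) \<le> C * norm (w - w') * norm (x - y)"
    using smooth_mixed_difference[OF smT subspace_imp_convex[OF S] p0 e1(1) sub] by blast
  \<comment> \<open>\<open>r/2\<close> puts \<rho> strictly inside the radius of the difference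
    estimate, and \<open>1 / (8*C)\<close> yields the bound that absorbs errors.\<close>
  define \<rho> where "\<rho> = min (r/2) (1 / (8*C))"
  have \<rho>: "\<rho> > 0" "\<rho> < r" "\<rho> \<le> 1 / (8*C)" using r by (auto simp: \<rho>_def)
  define \<phi> where "\<phi> g = f g - p0" for g
  have nphi: "norm (\<phi> g) = dist p0 (f g)" for g by (simp add: \<phi>_def dist_norm norm_minus_commute)
  have "lie_coords G TG U \<phi> C \<rho>"
  proof (unfold_locales)
    show "topological_group G TG" by fact
    show "U \<subseteq> carrier G" "\<one>\<^bsub>G\<^esub> \<in> U" by fact+
    show "\<phi> \<one>\<^bsub>G\<^esub> = 0" by (simp add: \<phi>_def p0_def)
    show "inj_on \<phi> U" using finj by (auto simp: \<phi>_def inj_on_def)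
    show "\<rho> > 0" "C > 0" by fact+
    show "C * \<rho> \<le> 1/8" using \<rho>(3) r(3) by (simp add: field_simps)
    show "openin TG {g \<in> U. norm (\<phi> g) < s}" if "0 < s" "s \<le> \<rho>" for s
    proof -
      have "openin (top_of_set (f ` U)) (f ` U \<inter> ball p0 s)" by (simp add: openin_open_Int)
      from openin_continuous_map_preimage[OF fcont this]
      have "openin (subtopology TG U) {g \<in> U. norm (\<phi> g) < s}"
        unfolding tU by (rule back_subst[of "openin _"]) (auto simp: nphi)
      then show ?thesis using Uo openin_trans_full by blast
    qed
    show "\<exists>s>0. s \<le> \<rho> \<and> {g \<in> U. norm (\<phi> g) < s} \<subseteq> V" if V: "openin TG V" "\<one>\<^bsub>G\<^esub> \<in> V" for V
    proof -
      obtain e where e: "e > 0" "S \<inter> ball p0 e \<subseteq> f ` (V \<inter> U)" using image_ball[OF V] by blast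
      have "{g \<in> U. norm (\<phi> g) < min e \<rho>} \<subseteq> V"
      proof
        fix g assume "g \<in> {g \<in> U. norm (\<phi> g) < min e \<rho>}"
        then have g: "g \<in> U" "f g \<in> S \<inter> ball p0 e" using fUS by (auto simp: nphi)
        then obtain g' where "g' \<in> V \<inter> U" "f g = f g'" using e(2) by blast
        then show "g \<in> V" using finj g(1) by (auto simp: inj_on_def)
      qed
      then show ?thesis using e(1) \<rho>(1) by (intro exI[of _ "min e \<rho>"]) auto
    qed
    have Sball: "S \<inter> ball p0 e1 \<subseteq> f ` U" using e1(2) by blast
    show "closedin TG {g \<in> U. norm (\<phi> g) \<le> s}" if "0 \<le> s" "s < \<rho>" for s
    proof -
      have "cball p0 s \<subseteq> ball p0 e1" using that \<rho>(2) r(2) by auto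
      then have K: "S \<inter> cball p0 s \<subseteq> f ` U" using Sball by blast
      \<comment> \<open>A closed set in the chart could fail to be closed in the group. A compact
        one, carried back by the inverse chart, is closed because the group is Hausdorff.\<close>
      have "compact (S \<inter> cball p0 s)" using closed_subspace[OF S] by (simp add: closed_Int_compact)
      then have "compactin (top_of_set (f ` U)) (S \<inter> cball p0 s)"
        using K by (simp add: compactin_subtopology)
      then have "compactin (subtopology TG U) (finv ` (S \<inter> cball p0 s))"
        using image_compactin finvc by blast
      then have "compactin TG (finv ` (S \<inter> cball p0 s))" by (simp add: compactin_subtopology)
      moreover have "finv ` (S \<inter> cball p0 s) = {g \<in> U. norm (\<phi> g) \<le> s}"
      proof (intro equalityI subsetI)
        fix g assume "g \<in> finv ` (S \<inter> cball p0 s)"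
        then obtain q where q: "q \<in> S \<inter> cball p0 s" "g = finv q" by blast
        then obtain g' where "g' \<in> U" "q = f g'" using K by blast
        then show "g \<in> {g \<in> U. norm (\<phi> g) \<le> s}" using q finv by (auto simp: nphi)
      next
        fix g assume "g \<in> {g \<in> U. norm (\<phi> g) \<le> s}"
        then have "g \<in> U" "f g \<in> S \<inter> cball p0 s" using fUS by (auto simp: nphi)
        then show "g \<in> finv ` (S \<inter> cball p0 s)" using finv by (metis image_eqI)
      qed
      ultimately show ?thesis using compactin_imp_closedin[OF haus] by simp
    qed
    show "\<exists>p\<in>U. \<phi> p = (1/2) *\<^sub>R (\<phi> x + \<phi> y)"
      if xy: "x \<in> U" "y \<in> U" "norm (\<phi> x) < \<rho>" "norm (\<phi> y) < \<rho>" for x y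
    proof -
      define q where "q = (1/2) *\<^sub>R (f x + f y)"
      have qS: "q \<in> S" unfolding q_def using S xy fUS by (intro subspace_scale subspace_add) auto
      have eq: "q - p0 = (1/2) *\<^sub>R (\<phi> x + \<phi> y)"
      proof -
        have "p0 = (1/2) *\<^sub>R (p0 + p0)" by (simp flip: scaleR_2)
        then show ?thesis unfolding q_def \<phi>_def by (metis add_diff_add scaleR_right_diff_distrib)
      qed
      have "norm (q - p0) \<le> (1/2) * (norm (\<phi> x) + norm (\<phi> y))"
        unfolding eq using norm_triangle_ineq[of "\<phi> x" "\<phi> y"] by simp
      then have "q \<in> ball p0 e1" using xy \<rho>(2) r(2) by (simp add: dist_norm norm_minus_commute)
      then obtain p where "p \<in> U" "q = f p" using Sball qS by blast
      then show ?thesis using eq by (auto simp: \<phi>_def)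
    qed
    show "x \<otimes>\<^bsub>G\<^esub> y \<in> U"
      if "x \<in> U" "y \<in> U" "norm (\<phi> x) < \<rho>" "norm (\<phi> y) < \<rho>" for x y
      using that multU \<rho>(2) r(2) by (simp add: nphi)
    show "norm (\<phi> (a \<otimes>\<^bsub>G\<^esub> b) - \<phi> (a \<otimes>\<^bsub>G\<^esub> b') - \<phi> (a' \<otimes>\<^bsub>G\<^esub> b) + \<phi> (a' \<otimes>\<^bsub>G\<^esub> b'))
         \<le> C * norm (\<phi> a - \<phi> a') * norm (\<phi> b - \<phi> b')"
      if "a \<in> U" "a' \<in> U" "b \<in> U" "b' \<in> U" "norm (\<phi> a) < \<rho>"
         "norm (\<phi> a') < \<rho>" "norm (\<phi> b) < \<rho>" "norm (\<phi> b') < \<rho>" for a a' b b'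
    proof -
      have "f a \<in> S \<inter> ball p0 r" "f a' \<in> S \<inter> ball p0 r" "f b \<in> S \<inter> ball p0 r" "f b' \<in> S \<inter> ball p0 r"
        using that fUS \<rho>(2) by (auto simp: nphi)
      from md[OF this] show ?thesis using that by (simp add: mu \<phi>_def)
    qed
  qed
  then show ?thesis using that by blast
qed

section \<open>Twisted products\<close>

locale twisted = top_group G TG for G (structure) and TG +
  fixes H and X :: "'x topology" and act
  assumes subgroup_H: "subgroup H G" and action: "continuous_action G TG H X act"
begin

abbreviation "P \<equiv> prod_topology TG X"
abbreviation "q \<equiv> twclass G H act"
abbreviation "Z \<equiv> twisted_product G TG H X act"
abbreviation "ga \<equiv> twisted_action G"
abbreviation "I \<equiv> top_of_set {0..1::real}"

lemma H_carrier: "h \<in> H \<Longrightarrow> h \<in> carrier G"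
  using subgroup.mem_carrier[OF subgroup_H] .

lemmas H_closed [simp] = subgroup.m_closed[OF subgroup_H] subgroup.m_inv_closed[OF subgroup_H]
  subgroup.one_closed[OF subgroup_H]

lemma act_closed [simp]: "h \<in> H \<Longrightarrow> x \<in> topspace X \<Longrightarrow> act h x \<in> topspace X"
  and act_one [simp]: "x \<in> topspace X \<Longrightarrow> act \<one> x = x"
  and act_mult: "h \<in> H \<Longrightarrow> k \<in> H \<Longrightarrow> x \<in> topspace X \<Longrightarrow> act (h \<otimes> k) x = act h (act k x)"
  and act_cont: "continuous_map (prod_topology (subtopology TG H) X) X (\<lambda>(h,x). act h x)"
  using action by (auto simp: continuous_action_def)

lemma act_inv [simp]: "h \<in> H \<Longrightarrow> x \<in> topspace X \<Longrightarrow> act (inv h) (act h x) = x"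
  using act_mult[of "inv h" h x] H_carrier by simp

lemma q_shift:
  assumes "g \<in> carrier G" "x \<in> topspace X" "h \<in> H"
  shows "q (g \<otimes> inv h, act h x) = q (g, x)"
proof (intro equalityI subsetI)
  fix p assume "p \<in> q (g \<otimes> inv h, act h x)"
  then obtain k where k: "k \<in> H" "p = (g \<otimes> inv h \<otimes> inv k, act k (act h x))"
    by (auto simp: twclass_def)
  have "p = (g \<otimes> inv (k \<otimes> h), act (k \<otimes> h) x)"
    using k assms H_carrier by (simp add: act_mult m_assoc inv_mult_group)
  then show "p \<in> q (g, x)" using k assms by (auto simp: twclass_def)
next
  fix p assume "p \<in> q (g, x)"
  then obtain k where k: "k \<in> H" "p = (g \<otimes> inv k, act k x)"
    by (auto simp: twclass_def)
  have c: "h \<in> carrier G" "k \<in> carrier G" using k assms H_carrier by auto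
  have "p = (g \<otimes> inv h \<otimes> inv (k \<otimes> inv h), act (k \<otimes> inv h) (act h x))"
    using k assms c by (simp add: act_mult m_assoc inv_mult_group)
  then show "p \<in> q (g \<otimes> inv h, act h x)" using k assms by (auto simp: twclass_def)
qed

lemma q_self: "g \<in> carrier G \<Longrightarrow> x \<in> topspace X \<Longrightarrow> (g,x) \<in> q (g,x)"
  unfolding twclass_def by (auto intro!: exI[of _ \<one>])

lemma q_eq_iff:
  assumes "g \<in> carrier G" "x \<in> topspace X" "g' \<in> carrier G" "x' \<in> topspace X"
  shows "q (g,x) = q (g',x') \<longleftrightarrow> (\<exists>h\<in>H. g' = g \<otimes> inv h \<and> x' = act h x)"
proof
  assume "q (g,x) = q (g',x')"
  then have "(g',x') \<in> q (g,x)" using q_self assms by blast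
  then show "\<exists>h\<in>H. g' = g \<otimes> inv h \<and> x' = act h x" by (auto simp: twclass_def)
qed (use q_shift assms in auto)

lemma topspace_Z: "topspace Z = q ` (carrier G \<times> topspace X)"
  by (simp add: twisted_product_def topspace_quotient_topology topspace_TG)

lemma Z_cases:
  assumes "z \<in> topspace Z"
  obtains g x where "g \<in> carrier G" "x \<in> topspace X" "z = q (g,x)"
  using assms unfolding topspace_Z by auto

lemma q_in_Z [simp]: "g \<in> carrier G \<Longrightarrow> x \<in> topspace X \<Longrightarrow> q (g,x) \<in> topspace Z"
  unfolding topspace_Z by auto

lemma openin_Z: "openin Z W \<longleftrightarrow> W \<subseteq> topspace Z \<and> openin P {p \<in> topspace P. q p \<in> W}"
  unfolding topspace_Z by (simp add: twisted_product_def openin_quotient_topology topspace_TG)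

lemma q_cont: "continuous_map P Z q"
  unfolding continuous_map_def using openin_Z by (auto simp: topspace_TG)

lemma act_cont_gen:
  assumes "continuous_map Y TG f" "f \<in> topspace Y \<rightarrow> H" "continuous_map Y X g"
  shows "continuous_map Y X (\<lambda>y. act (f y) (g y))"
proof -
  have "continuous_map Y (subtopology TG H) f" using assms(1,2) by (auto simp: continuous_map_in_subtopology)
  from continuous_map_compose[OF continuous_map_pairedI[OF this assms(3)] act_cont]
  show ?thesis by (simp add: o_def)
qed

text \<open>As for any orbit map, the saturation of an open set is a union, over h in
  \<open>H\<close>, of its preimages under the continuous maps (g,x) -> (g inv h, h x).\<close>

lemma q_open: "open_map P Z q"
  unfolding open_map_def
proof (intro allI impI)
  fix W assume W: "openin P W"
  have WP: "W \<subseteq> carrier G \<times> topspace X" using openin_subset[OF W] by (simp add: topspace_TG)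
  have cont: "continuous_map P P (\<lambda>p. (fst p \<otimes> inv h, act h (snd p)))" if "h \<in> H" for h
    using that H_carrier[OF that]
    by (intro continuous_map_pairedI cont_mult act_cont_gen continuous_map_fst continuous_map_snd)
      (auto simp: topspace_TG)
  have "openin P (\<Union>h\<in>H. {p \<in> topspace P. (fst p \<otimes> inv h, act h (snd p)) \<in> W})"
    by (intro openin_Union ballI) (use openin_continuous_map_preimage[OF cont W] in auto)
  moreover have "{p \<in> topspace P. q p \<in> q ` W} = (\<Union>h\<in>H. {p \<in> topspace P. (fst p \<otimes> inv h, act h (snd p)) \<in> W})"
  proof (intro equalityI subsetI)
    fix p assume "p \<in> {p \<in> topspace P. q p \<in> q ` W}"
    then obtain w where p: "p \<in> carrier G \<times> topspace X" "w \<in> W" "q p = q w" by (auto simp: topspace_TG)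
    obtain g x where gx: "p = (g,x)" by (cases p)
    obtain g' x' where gx': "w = (g',x')" by (cases w)
    have "\<exists>h\<in>H. g' = g \<otimes> inv h \<and> x' = act h x"
      using p WP q_eq_iff[of g x g' x'] gx gx' by auto
    then show "p \<in> (\<Union>h\<in>H. {p \<in> topspace P. (fst p \<otimes> inv h, act h (snd p)) \<in> W})"
      using p gx gx' by (auto simp: topspace_TG)
  next
    fix p assume "p \<in> (\<Union>h\<in>H. {p \<in> topspace P. (fst p \<otimes> inv h, act h (snd p)) \<in> W})"
    then obtain h where h: "h \<in> H" "p \<in> topspace P" "(fst p \<otimes> inv h, act h (snd p)) \<in> W" by blast
    then have "q p = q (fst p \<otimes> inv h, act h (snd p))"
      using q_shift[of "fst p" "snd p" h] by (auto simp: topspace_TG)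
    then show "p \<in> {p \<in> topspace P. q p \<in> q ` W}" using h by auto
  qed
  ultimately show "openin Z (q ` W)" using WP by (auto simp: openin_Z topspace_Z)
qed

lemma ga_q: "g \<in> carrier G \<Longrightarrow> g0 \<in> carrier G \<Longrightarrow> ga g (q (g0,x)) = q (g \<otimes> g0, x)"
  using H_carrier by (auto simp: twisted_action_def twclass_def m_assoc image_iff; force simp: m_assoc)

text \<open>The choice is not continuous. Functions defined through it are first shown to be
  independent of it, and their continuity is then checked on representatives by
  \<open>continuous_map_descend\<close>.\<close>

definition rep :: "('a \<times> 'x) set \<Rightarrow> 'a \<times> 'x" where "rep z = (SOME p. p \<in> z)"

lemma rep_q:
  assumes "g \<in> carrier G" "x \<in> topspace X"
  obtains h where "h \<in> H" "rep (q (g,x)) = (g \<otimes> inv h, act h x)"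
proof -
  have "rep (q (g,x)) \<in> q (g,x)" unfolding rep_def using q_self[OF assms] by (rule someI)
  then show ?thesis using that by (auto simp: twclass_def)
qed

lemma twisted_set_iff:
  assumes "invariant_set H act U" "U \<subseteq> topspace X" "g \<in> carrier G" "x \<in> topspace X"
  shows "q (g,x) \<in> twisted_set G H act U \<longleftrightarrow> x \<in> U"
proof
  assume "q (g,x) \<in> twisted_set G H act U"
  then obtain g' x' where gx': "g' \<in> carrier G" "x' \<in> U" "q (g',x') = q (g,x)"
    by (auto simp: twisted_set_def)
  then obtain h where "h \<in> H" "x = act h x'"
    using q_eq_iff[of g' x' g x] assms by auto
  then show "x \<in> U" using assms(1) gx' by (auto simp: invariant_set_def)
qed (use assms in \<open>auto simp: twisted_set_def\<close>)

section \<open>From homotopies of \<open>X\<close> to homotopies of the twisted product\<close>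

lemma q_I_open: "open_map (prod_topology P I) (prod_topology Z I) (\<lambda>p. (q (fst p), snd p))"
  by (rule open_map_prod[OF q_open, of I I "\<lambda>t. t"]) (simp add: open_map_def)

text \<open>\<open>H\<close>-equivariance of the given homotopy is precisely independence of the
  representative for the induced one, and \<open>G\<close>-equivariance is automatic since
  \<open>G\<close> acts on the first coordinate alone.\<close>

lemma compressible_twisted:
  assumes U: "U \<subseteq> topspace X" "invariant_set H act U"
    and B: "B \<subseteq> topspace X"
    and c: "compressible H act X U B"
  shows "compressible (carrier G) ga Z (twisted_set G H act U) (twisted_set G H act B)"
proof -
  let ?U = "twisted_set G H act U"
  obtain F where F: "continuous_map (prod_topology (subtopology X U) I) X F"
    "\<And>x. x \<in> U \<Longrightarrow> F (x,0) = x" "\<And>x. x \<in> U \<Longrightarrow> F (x,1) \<in> B"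
    "\<And>h x t. h \<in> H \<Longrightarrow> x \<in> U \<Longrightarrow> t \<in> {0..1} \<Longrightarrow> F (act h x, t) = act h (F (x,t))"
    using c unfolding compressible_def by blast
  have tU: "topspace (subtopology X U) = U" using U by auto
  have FX: "F (x,t) \<in> topspace X" if "x \<in> U" "t \<in> {0..1}" for x t
    using F(1) that tU unfolding continuous_map_def by auto
  define F' where "F' = (\<lambda>(z,t). q (fst (rep z), F (snd (rep z), t)))"
  have F'q: "F' (q (g,x), t) = q (g, F (x,t))" if gx: "g \<in> carrier G" "x \<in> U" "t \<in> {0..1}" for g x t
  proof -
    obtain h where h: "h \<in> H" "rep (q (g,x)) = (g \<otimes> inv h, act h x)"
      using rep_q[of g x] gx U by blast
    have "F' (q (g,x), t) = q (g \<otimes> inv h, act h (F (x,t)))"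
      unfolding F'_def using h F(4)[OF h(1) gx(2,3)] by simp
    then show ?thesis using q_shift[OF gx(1) FX[OF gx(2,3)] h(1)] by simp
  qed
  have cases: "\<exists>g x. g \<in> carrier G \<and> x \<in> U \<and> z = q (g,x)" if "z \<in> ?U" for z
    using that by (auto simp: twisted_set_def)
  show ?thesis unfolding compressible_def
  proof (intro exI[of _ F'] conjI ballI)
    fix z assume "z \<in> ?U"
    then obtain g x where z: "g \<in> carrier G" "x \<in> U" "z = q (g,x)" using cases by blast
    show "F' (z,0) = z" using F'q[OF z(1,2), of 0] z F(2) by simp
    show "F' (z,1) \<in> twisted_set G H act B"
      using F'q[OF z(1,2), of 1] z F(3) by (auto simp: twisted_set_def)
    fix k t assume "k \<in> carrier G" "t \<in> {0..1::real}"
    then show "F' (ga k z, t) = ga k (F' (z,t))"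
      using F'q[OF _ z(2)] z by (simp add: ga_q)
  next
    let ?S = "?U \<times> {0..1}"
    let ?A = "{a \<in> topspace (prod_topology P I). (q (fst a), snd a) \<in> ?S}"
    have Aeq: "?A = (carrier G \<times> U) \<times> {0..1}"
      using twisted_set_iff[OF U(2,1)] U by (auto simp: topspace_TG)
    have c1: "continuous_map (subtopology (prod_topology P I) ?A) (prod_topology (subtopology X U) I) (\<lambda>a. (snd (fst a), snd a))"
      unfolding Aeq
      by (intro continuous_map_pairedI continuous_map_into_subtopology continuous_map_from_subtopology
          continuous_map_snd continuous_map_snd_of continuous_map_compose[OF continuous_map_fst continuous_map_snd, unfolded o_def]) auto
    have "continuous_map (subtopology (prod_topology P I) ?A) TG (\<lambda>a. fst (fst a))"
      by (intro continuous_map_from_subtopology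
          continuous_map_compose[OF continuous_map_fst continuous_map_fst, unfolded o_def])
    from continuous_map_compose[OF continuous_map_pairedI[OF this continuous_map_compose[OF c1 F(1)]] q_cont]
    have c2: "continuous_map (subtopology (prod_topology P I) ?A) Z (\<lambda>a. q (fst (fst a), F (snd (fst a), snd a)))"
      by (simp add: o_def)
    have "continuous_map (subtopology (prod_topology Z I) ?S) Z F'"
    proof (rule continuous_map_descend[OF q_I_open _ _ c2])
      show "topspace (prod_topology Z I) \<subseteq> (\<lambda>p. (q (fst p), snd p)) ` topspace (prod_topology P I)"
        by (force simp: topspace_Z topspace_TG)
      show "F' \<in> topspace (prod_topology Z I) \<inter> ?S \<rightarrow> topspace Z"
      proof
        fix p assume "p \<in> topspace (prod_topology Z I) \<inter> ?S"
        then obtain g x t where "g \<in> carrier G" "x \<in> U" "p = (q (g,x), t)" "t \<in> {0..1}"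
          using cases by (cases p) blast
        then show "F' p \<in> topspace Z" using F'q FX by simp
      qed
      fix a assume "a \<in> topspace (prod_topology P I)" "(q (fst a), snd a) \<in> ?S"
      then have "a \<in> (carrier G \<times> U) \<times> {0..1}" using Aeq by blast
      then show "F' (q (fst a), snd a) = q (fst (fst a), F (snd (fst a), snd a))"
        using F'q by auto
    qed
    then show "continuous_map (prod_topology (subtopology Z ?U) I) Z F'"
      by (simp add: prod_topology_subtopology(1))
  qed
qed

end

section \<open>Equivariant lifting\<close>

locale twisted_retraction = twisted G TG H X act
  for G (structure) and TG :: "'a topology" and H and X :: "'x topology" and act +
  fixes d :: "'a \<Rightarrow> real" and r :: "'a \<Rightarrow> 'a" and \<epsilon> :: real
  assumes d_cont: "continuous_map TG euclideanreal d" and eps: "\<epsilon> > 0" and d_one: "d \<one> = 0"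
    and d_inv: "\<And>g h k. g \<in> carrier G \<Longrightarrow> h \<in> H \<Longrightarrow> k \<in> H \<Longrightarrow> d (h \<otimes> g \<otimes> k) = d g"
    and r_cont: "continuous_map (subtopology TG {g \<in> carrier G. d g < \<epsilon>}) (subtopology TG H) r"
    and r_one: "r \<one> = \<one>"
    and r_in_H: "\<And>g. g \<in> carrier G \<Longrightarrow> d g < \<epsilon> \<Longrightarrow> r g \<in> H"
    and r_equiv: "\<And>g h k. g \<in> carrier G \<Longrightarrow> d g < \<epsilon> \<Longrightarrow> h \<in> H \<Longrightarrow> k \<in> H \<Longrightarrow>
      r (h \<otimes> g \<otimes> k) = h \<otimes> r g \<otimes> k"
begin

text \<open>\<open>gap\<close> measures the distance of the \<open>G/H\<close>-components of two points, and \<open>transport\<close> is an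
  element of \<open>G\<close> carrying the first component to the second when they are close.\<close>

definition gap :: "('a \<times> 'x) set \<times> ('a \<times> 'x) set \<Rightarrow> real" where
  "gap w = d (inv (fst (rep (fst w))) \<otimes> fst (rep (snd w)))"

definition transport :: "('a \<times> 'x) set \<times> ('a \<times> 'x) set \<Rightarrow> 'a" where
  "transport w = fst (rep (snd w)) \<otimes> inv (r (inv (fst (rep (fst w))) \<otimes> fst (rep (snd w)))) \<otimes> inv (fst (rep (fst w)))"

text \<open>If z lies over the coset g1 H, then inv g1 z lies over the base coset, so it is [1,y]
  for exactly one y, and this is y. For other pairs the acting element is outside \<open>H\<close>
  and the value is meaningless.\<close>

definition fibre_coord :: "'a \<times> ('a \<times> 'x) set \<Rightarrow> 'x" where
  "fibre_coord w = act (inv (fst w) \<otimes> fst (rep (snd w))) (snd (rep (snd w)))"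

lemma quotient_shift:
  assumes "g1 \<in> carrier G" "g2 \<in> carrier G" "h \<in> H" "k \<in> H"
  shows "inv (g1 \<otimes> inv h) \<otimes> (g2 \<otimes> inv k) = h \<otimes> (inv g1 \<otimes> g2) \<otimes> inv k"
  using assms H_carrier by (simp add: inv_mult_group m_assoc)

lemma gap_q:
  assumes "g1 \<in> carrier G" "x1 \<in> topspace X" "g2 \<in> carrier G" "x2 \<in> topspace X"
  shows "gap (q (g1,x1), q (g2,x2)) = d (inv g1 \<otimes> g2)"
proof -
  obtain h where h: "h \<in> H" "rep (q (g1,x1)) = (g1 \<otimes> inv h, act h x1)" using rep_q assms(1,2) by blast
  obtain k where k: "k \<in> H" "rep (q (g2,x2)) = (g2 \<otimes> inv k, act k x2)" using rep_q assms(3,4) by blast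
  show ?thesis
    using h k assms quotient_shift[OF assms(1,3) h(1) k(1)] d_inv[of "inv g1 \<otimes> g2" h "inv k"]
    by (simp add: gap_def)
qed

lemma transport_q:
  assumes "g1 \<in> carrier G" "x1 \<in> topspace X" "g2 \<in> carrier G" "x2 \<in> topspace X" "d (inv g1 \<otimes> g2) < \<epsilon>"
  shows "transport (q (g1,x1), q (g2,x2)) = g2 \<otimes> inv (r (inv g1 \<otimes> g2)) \<otimes> inv g1"
proof -
  obtain h where h: "h \<in> H" "rep (q (g1,x1)) = (g1 \<otimes> inv h, act h x1)" using rep_q assms(1,2) by blast
  obtain k where k: "k \<in> H" "rep (q (g2,x2)) = (g2 \<otimes> inv k, act k x2)" using rep_q assms(3,4) by blast
  have c: "h \<in> carrier G" "k \<in> carrier G" "r (inv g1 \<otimes> g2) \<in> carrier G"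
    using h k H_carrier r_in_H[of "inv g1 \<otimes> g2"] assms by auto
  have req: "r (h \<otimes> (inv g1 \<otimes> g2) \<otimes> inv k) = h \<otimes> r (inv g1 \<otimes> g2) \<otimes> inv k"
    using r_equiv[of "inv g1 \<otimes> g2" h "inv k"] assms h k by simp
  have "transport (q (g1,x1), q (g2,x2)) = g2 \<otimes> inv k \<otimes> inv (h \<otimes> r (inv g1 \<otimes> g2) \<otimes> inv k) \<otimes> inv (g1 \<otimes> inv h)"
    unfolding transport_def fst_conv snd_conv h(2) k(2) quotient_shift[OF assms(1,3) h(1) k(1)] req ..
  also have "\<dots> = g2 \<otimes> inv (r (inv g1 \<otimes> g2)) \<otimes> inv g1"
    using c assms by (simp add: inv_mult_group m_assoc)
  finally show ?thesis .
qed

lemma fibre_coord_q: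
  assumes "g1 \<in> carrier G" "g \<in> carrier G" "x \<in> topspace X" "inv g1 \<otimes> g \<in> H"
  shows "fibre_coord (g1, q (g,x)) = act (inv g1 \<otimes> g) x"
proof -
  obtain h where h: "h \<in> H" "rep (q (g,x)) = (g \<otimes> inv h, act h x)" using rep_q assms(2,3) by blast
  have hc: "h \<in> carrier G" using h H_carrier by blast
  have "inv g1 \<otimes> (g \<otimes> inv h) = (inv g1 \<otimes> g) \<otimes> inv h" using assms hc by (simp add: m_assoc)
  then have "fibre_coord (g1, q (g,x)) = act ((inv g1 \<otimes> g) \<otimes> inv h) (act h x)"
    by (simp add: fibre_coord_def h(2))
  also have "\<dots> = act (inv g1 \<otimes> g) x"
    using assms h by (subst act_mult) auto
  finally show ?thesis .
qed

text \<open>The condition says that the point lies over the coset g1 H. It is written with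
  \<open>rep\<close> so that it is a predicate on points of \<open>Z\<close>, and must therefore not
  depend on the choice.\<close>

lemma rep_coset:
  assumes "g \<in> carrier G" "x \<in> topspace X" "g1 \<in> carrier G"
  shows "inv g1 \<otimes> fst (rep (q (g,x))) \<in> H \<longleftrightarrow> inv g1 \<otimes> g \<in> H"
proof -
  obtain h where h: "h \<in> H" "rep (q (g,x)) = (g \<otimes> inv h, act h x)" using rep_q assms(1,2) by blast
  have hc: "h \<in> carrier G" using h H_carrier by blast
  have eq: "inv g1 \<otimes> (g \<otimes> inv h) = (inv g1 \<otimes> g) \<otimes> inv h" using assms hc by (simp add: m_assoc)
  show ?thesis
  proof
    assume "inv g1 \<otimes> fst (rep (q (g,x))) \<in> H"
    then have "(inv g1 \<otimes> g) \<otimes> inv h \<otimes> h \<in> H" using h eq by (simp del: l_inv)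
    then show "inv g1 \<otimes> g \<in> H" using assms hc by (simp add: m_assoc)
  next
    assume "inv g1 \<otimes> g \<in> H"
    then show "inv g1 \<otimes> fst (rep (q (g,x))) \<in> H" using h eq by simp
  qed
qed

lemma q_q_open: "open_map (prod_topology P P) (prod_topology Z Z) (\<lambda>p. (q (fst p), q (snd p)))"
  by (rule open_map_prod[OF q_open q_open])

lemma quotient_cont:
  "continuous_map (prod_topology P P) TG (\<lambda>p. inv (fst (fst p)) \<otimes> fst (snd p))"
  by (intro cont_mult cont_inv continuous_map_compose[OF continuous_map_fst continuous_map_fst, unfolded o_def]
      continuous_map_compose[OF continuous_map_snd continuous_map_fst, unfolded o_def])

lemma gap_cont: "continuous_map (prod_topology Z Z) euclideanreal gap"
proof -
  have "continuous_map (subtopology (prod_topology Z Z) UNIV) euclideanreal gap"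
  proof (rule continuous_map_descend[OF q_q_open])
    show "topspace (prod_topology Z Z) \<subseteq> (\<lambda>p. (q (fst p), q (snd p))) ` topspace (prod_topology P P)"
      by (force simp: topspace_Z topspace_TG)
    show "continuous_map (subtopology (prod_topology P P) {a \<in> topspace (prod_topology P P). (q (fst a), q (snd a)) \<in> UNIV})
        euclideanreal (\<lambda>p. d (inv (fst (fst p)) \<otimes> fst (snd p)))"
      by (intro continuous_map_from_subtopology continuous_map_compose[OF quotient_cont d_cont, unfolded o_def])
    show "gap (q (fst a), q (snd a)) = d (inv (fst (fst a)) \<otimes> fst (snd a))"
      if "a \<in> topspace (prod_topology P P)" for a
      using that gap_q[of "fst (fst a)" "snd (fst a)" "fst (snd a)" "snd (snd a)"] by (auto simp: topspace_TG)
  qed auto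
  then show ?thesis by simp
qed

lemma transport_closed:
  assumes "z1 \<in> topspace Z" "z2 \<in> topspace Z" "gap (z1,z2) < \<epsilon>"
  shows "transport (z1,z2) \<in> carrier G"
proof -
  obtain g1 x1 where z1: "g1 \<in> carrier G" "x1 \<in> topspace X" "z1 = q (g1,x1)" using Z_cases assms(1) by blast
  obtain g2 x2 where z2: "g2 \<in> carrier G" "x2 \<in> topspace X" "z2 = q (g2,x2)" using Z_cases assms(2) by blast
  have "d (inv g1 \<otimes> g2) < \<epsilon>" using assms(3) gap_q z1 z2 by simp
  then show ?thesis using transport_q z1 z2 r_in_H[of "inv g1 \<otimes> g2"] H_carrier by simp
qed

lemma transport_cont:
  "continuous_map (subtopology (prod_topology Z Z) {w. gap w < \<epsilon>}) TG transport"
proof (rule continuous_map_descend[OF q_q_open])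
  let ?A = "{a \<in> topspace (prod_topology P P). (q (fst a), q (snd a)) \<in> {w. gap w < \<epsilon>}}"
  show "topspace (prod_topology Z Z) \<subseteq> (\<lambda>p. (q (fst p), q (snd p))) ` topspace (prod_topology P P)"
    by (force simp: topspace_Z topspace_TG)
  have gap: "gap (q (fst a), q (snd a)) = d (inv (fst (fst a)) \<otimes> fst (snd a))"
    if "a \<in> topspace (prod_topology P P)" for a
    using that gap_q[of "fst (fst a)" "snd (fst a)" "fst (snd a)" "snd (snd a)"] by (auto simp: topspace_TG)
  have "continuous_map (subtopology (prod_topology P P) ?A) (subtopology TG {g \<in> carrier G. d g < \<epsilon>})
     (\<lambda>p. inv (fst (fst p)) \<otimes> fst (snd p))"
    using gap by (auto simp: continuous_map_in_subtopology topspace_TG intro!: continuous_map_from_subtopology quotient_cont)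
  from continuous_map_compose[OF this r_cont]
  have r: "continuous_map (subtopology (prod_topology P P) ?A) TG (\<lambda>p. r (inv (fst (fst p)) \<otimes> fst (snd p)))"
    by (simp add: o_def continuous_map_in_subtopology)
  show "continuous_map (subtopology (prod_topology P P) ?A) TG
     (\<lambda>p. fst (snd p) \<otimes> inv (r (inv (fst (fst p)) \<otimes> fst (snd p))) \<otimes> inv (fst (fst p)))"
    by (intro cont_mult cont_inv r continuous_map_from_subtopology
        continuous_map_compose[OF continuous_map_fst continuous_map_fst, unfolded o_def]
        continuous_map_compose[OF continuous_map_snd continuous_map_fst, unfolded o_def])
  show "transport (q (fst a), q (snd a)) = fst (snd a) \<otimes> inv (r (inv (fst (fst a)) \<otimes> fst (snd a))) \<otimes> inv (fst (fst a))"
    if "a \<in> topspace (prod_topology P P)" "(q (fst a), q (snd a)) \<in> {w. gap w < \<epsilon>}" for a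
    using that gap[OF that(1)] transport_q[of "fst (fst a)" "snd (fst a)" "fst (snd a)" "snd (snd a)"]
    by (auto simp: topspace_TG)
qed (use transport_closed in \<open>auto simp: topspace_TG\<close>)

lemma fibre_coord_cont:
  "continuous_map (subtopology (prod_topology TG Z) {w. inv (fst w) \<otimes> fst (rep (snd w)) \<in> H}) X fibre_coord"
proof (rule continuous_map_descend[OF open_map_prod[OF _ q_open, of TG TG "\<lambda>g. g"]])
  let ?S = "{w. inv (fst w) \<otimes> fst (rep (snd w)) \<in> H}"
  let ?A = "{a \<in> topspace (prod_topology TG P). (fst a, q (snd a)) \<in> ?S}"
  show "open_map TG TG (\<lambda>g. g)" by (simp add: open_map_def)
  show "topspace (prod_topology TG Z) \<subseteq> (\<lambda>p. (fst p, q (snd p))) ` topspace (prod_topology TG P)"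
    by (force simp: topspace_Z topspace_TG)
  show "fibre_coord \<in> topspace (prod_topology TG Z) \<inter> ?S \<rightarrow> topspace X"
  proof
    fix w assume w: "w \<in> topspace (prod_topology TG Z) \<inter> ?S"
    then obtain g1 z where gz: "w = (g1,z)" "g1 \<in> carrier G" "z \<in> topspace Z" by (auto simp: topspace_TG)
    then obtain g x where z: "g \<in> carrier G" "x \<in> topspace X" "z = q (g,x)" using Z_cases by blast
    have "inv g1 \<otimes> g \<in> H" using w gz z rep_coset[of g x g1] by simp
    then show "fibre_coord w \<in> topspace X" using fibre_coord_q[of g1 g x] gz z by simp
  qed
  have mem: "inv (fst a) \<otimes> fst (snd a) \<in> H" if "a \<in> ?A" for a
    using that rep_coset[of "fst (snd a)" "snd (snd a)" "fst a"] by (auto simp: topspace_TG)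
  have c: "continuous_map (subtopology (prod_topology TG P) ?A) TG (\<lambda>a. inv (fst a) \<otimes> fst (snd a))"
    by (intro cont_mult cont_inv continuous_map_from_subtopology continuous_map_fst
        continuous_map_compose[OF continuous_map_snd continuous_map_fst, unfolded o_def])
  show "continuous_map (subtopology (prod_topology TG P) ?A) X (\<lambda>a. act (inv (fst a) \<otimes> fst (snd a)) (snd (snd a)))"
    by (rule act_cont_gen[OF c])
      (use mem in \<open>auto intro: continuous_map_from_subtopology
        continuous_map_compose[OF continuous_map_snd continuous_map_snd, unfolded o_def]\<close>)
  show "fibre_coord (fst a, q (snd a)) = act (inv (fst a) \<otimes> fst (snd a)) (snd (snd a))"
    if "a \<in> topspace (prod_topology TG P)" "(fst a, q (snd a)) \<in> ?S" for a
    using mem[of a] that fibre_coord_q[of "fst a" "fst (snd a)" "snd (snd a)"] by (auto simp: topspace_TG)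
qed

section \<open>Transport on the diagonal, under translation, and along cosets\<close>

lemma gap_self: "z \<in> topspace Z \<Longrightarrow> gap (z,z) = 0"
  by (erule Z_cases) (simp add: gap_q d_one)

lemma transport_self: "z \<in> topspace Z \<Longrightarrow> transport (z,z) = \<one>"
  by (erule Z_cases) (simp add: transport_q d_one r_one eps)

lemma gap_ga:
  assumes "g \<in> carrier G" "z1 \<in> topspace Z" "z2 \<in> topspace Z"
  shows "gap (ga g z1, ga g z2) = gap (z1,z2)"
proof -
  obtain g1 x1 where z1: "g1 \<in> carrier G" "x1 \<in> topspace X" "z1 = q (g1,x1)" using Z_cases assms(2) by blast
  obtain g2 x2 where z2: "g2 \<in> carrier G" "x2 \<in> topspace X" "z2 = q (g2,x2)" using Z_cases assms(3) by blast
  show ?thesis using z1 z2 assms(1) by (simp add: ga_q gap_q inv_mult_group m_assoc)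
qed

lemma transport_ga:
  assumes "g \<in> carrier G" "z1 \<in> topspace Z" "z2 \<in> topspace Z" "gap (z1,z2) < \<epsilon>"
  shows "transport (ga g z1, ga g z2) = g \<otimes> transport (z1,z2) \<otimes> inv g"
proof -
  obtain g1 x1 where z1: "g1 \<in> carrier G" "x1 \<in> topspace X" "z1 = q (g1,x1)" using Z_cases assms(2) by blast
  obtain g2 x2 where z2: "g2 \<in> carrier G" "x2 \<in> topspace X" "z2 = q (g2,x2)" using Z_cases assms(3) by blast
  have d: "d (inv g1 \<otimes> g2) < \<epsilon>" using assms(4) gap_q z1 z2 by simp
  have eq: "inv (g \<otimes> g1) \<otimes> (g \<otimes> g2) = inv g1 \<otimes> g2" using z1 z2 assms(1) by (simp add: inv_mult_group m_assoc)
  have rc: "r (inv g1 \<otimes> g2) \<in> carrier G" using r_in_H[OF _ d] z1 z2 H_carrier by simp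
  show ?thesis
    using z1 z2 assms(1) d eq rc transport_q[of "g \<otimes> g1" x1 "g \<otimes> g2" x2] transport_q[of g1 x1 g2 x2]
    by (simp add: ga_q inv_mult_group m_assoc)
qed

text \<open>The inductive step of the lift: if l carries the base coset to that of z1, then
  transport times l carries it to that of z2.\<close>

lemma transport_coset:
  assumes "z1 \<in> topspace Z" "z2 \<in> topspace Z" "gap (z1,z2) < \<epsilon>" "l \<in> carrier G"
    and "inv l \<otimes> fst (rep z1) \<in> H"
  shows "inv (transport (z1,z2) \<otimes> l) \<otimes> fst (rep z2) \<in> H"
proof -
  obtain g1 x1 where z1: "g1 \<in> carrier G" "x1 \<in> topspace X" "z1 = q (g1,x1)" using Z_cases assms(1) by blast
  obtain g2 x2 where z2: "g2 \<in> carrier G" "x2 \<in> topspace X" "z2 = q (g2,x2)" using Z_cases assms(2) by blast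
  have d: "d (inv g1 \<otimes> g2) < \<epsilon>" using assms(3) gap_q z1 z2 by simp
  have rH: "r (inv g1 \<otimes> g2) \<in> H" using r_in_H[OF _ d] z1 z2 by simp
  then have rc: "r (inv g1 \<otimes> g2) \<in> carrier G" using H_carrier by blast
  have "inv l \<otimes> g1 \<in> H" using assms(4,5) rep_coset z1 by simp
  then have "(inv l \<otimes> g1) \<otimes> r (inv g1 \<otimes> g2) \<in> H" using rH by (rule subgroup.m_closed[OF subgroup_H])
  moreover have "inv (transport (z1,z2) \<otimes> l) \<otimes> g2 = (inv l \<otimes> g1) \<otimes> r (inv g1 \<otimes> g2)"
    using z1 z2 rc assms(4) transport_q[OF z1(1,2) z2(1,2) d] by (simp add: inv_mult_group m_assoc)
  moreover have "transport (z1,z2) \<otimes> l \<in> carrier G" using transport_closed assms by simp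
  ultimately show ?thesis using rep_coset[OF z2(1,2)] z2(3) by simp
qed

text \<open>An explicit Lebesgue number: \<open>m x\<close> is the minimum over s, t of the larger
  of \<bar>s - t\<bar> and \<epsilon> - gap. It is positive, since the gap vanishes on the diagonal
  and the first term is positive off it. If \<bar>s - t\<bar> is below the minimum, the second term
  must be at least \<open>m x\<close>, so the gap is less than \<epsilon>. The formula involves x
  only through the gaps along its path, hence the last clause.\<close>

lemma uniform_time_step:
  assumes \<Phi>: "continuous_map (prod_topology Y I) Z \<Phi>"
  obtains m where "continuous_map Y euclideanreal m" "\<And>x. x \<in> topspace Y \<Longrightarrow> m x > 0"
    "\<And>x s t. x \<in> topspace Y \<Longrightarrow> s \<in> {0..1} \<Longrightarrow> t \<in> {0..1} \<Longrightarrow> \<bar>s - t\<bar> < m x \<Longrightarrow> gap (\<Phi> (x,s), \<Phi> (x,t)) < \<epsilon>"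
    "\<And>x y. x \<in> topspace Y \<Longrightarrow> y \<in> topspace Y \<Longrightarrow>
      (\<And>s t. s \<in> {0..1} \<Longrightarrow> t \<in> {0..1} \<Longrightarrow> gap (\<Phi> (x,s), \<Phi> (x,t)) = gap (\<Phi> (y,s), \<Phi> (y,t))) \<Longrightarrow> m x = m y"
proof -
  define F where "F = (\<lambda>(x,(s,t)). max \<bar>s - t\<bar> (\<epsilon> - gap (\<Phi> (x,s), \<Phi> (x,t))))"
  let ?K = "prod_topology I I"
  have \<Phi>Z: "\<Phi> (x,t) \<in> topspace Z" if "x \<in> topspace Y" "t \<in> {0..1}" for x t
    using \<Phi> that unfolding continuous_map_def by auto
  have ev: "continuous_map (prod_topology Y ?K) Z (\<lambda>p. \<Phi> (fst p, f (snd p)))" if f: "continuous_map ?K I f" for f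
    by (rule continuous_map_compose[OF _ \<Phi>, unfolded o_def])
      (intro continuous_map_pairedI continuous_map_fst continuous_map_compose[OF continuous_map_snd f, unfolded o_def])
  have g: "continuous_map (prod_topology Y ?K) euclideanreal (\<lambda>p. gap (\<Phi> (fst p, fst (snd p)), \<Phi> (fst p, snd (snd p))))"
    by (rule continuous_map_compose[OF continuous_map_pairedI gap_cont, unfolded o_def])
      (intro ev continuous_map_fst continuous_map_snd)+
  have I: "continuous_map I euclideanreal (\<lambda>t. t)" by (simp add: continuous_map_from_subtopology)
  have st: "continuous_map (prod_topology Y ?K) euclideanreal (\<lambda>p. fst (snd p))"
    "continuous_map (prod_topology Y ?K) euclideanreal (\<lambda>p. snd (snd p))"
    by (rule continuous_map_compose[OF _ I, unfolded o_def],
        intro continuous_map_compose[OF continuous_map_snd continuous_map_fst, unfolded o_def]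
          continuous_map_compose[OF continuous_map_snd continuous_map_snd, unfolded o_def])+
  have "F = (\<lambda>p. max \<bar>fst (snd p) - snd (snd p)\<bar> (\<epsilon> - gap (\<Phi> (fst p, fst (snd p)), \<Phi> (fst p, snd (snd p)))))"
    by (auto simp: F_def)
  then have cF: "continuous_map (prod_topology Y ?K) euclideanreal F"
    using st g by (auto intro!: continuous_map_real_max continuous_map_real_abs continuous_map_diff)
  have K: "compact_space ?K" "topspace ?K \<noteq> {}" by (auto intro!: compact_space_subtopology compact_Times)
  obtain m where m: "continuous_map Y euclideanreal m"
    and m_ex: "\<And>y. y \<in> topspace Y \<Longrightarrow> \<exists>k\<in>topspace ?K. m y = F (y,k)"
    and m_le: "\<And>y k. y \<in> topspace Y \<Longrightarrow> k \<in> topspace ?K \<Longrightarrow> m y \<le> F (y,k)"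
    using compact_minimum[OF K cF] by blast
  show ?thesis
  proof (rule that[OF m])
    fix x assume x: "x \<in> topspace Y"
    obtain s t where st: "s \<in> {0..1}" "t \<in> {0..1}" "m x = F (x,(s,t))" using m_ex[OF x] by auto
    show "m x > 0"
    proof (cases "s = t")
      case True
      then show ?thesis using st gap_self[OF \<Phi>Z[OF x st(2)]] eps by (simp add: F_def)
    next
      case False
      then show ?thesis using st by (simp add: F_def)
    qed
  next
    fix x s t assume a: "x \<in> topspace Y" "s \<in> {0..1}" "t \<in> {0..1}" "\<bar>s - t\<bar> < m x"
    have "m x \<le> F (x,(s,t))" using m_le[of x "(s,t)"] a by simp
    then have "m x \<le> \<epsilon> - gap (\<Phi> (x,s), \<Phi> (x,t))" using a(4) by (simp add: F_def le_max_iff_disj)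
    then show "gap (\<Phi> (x,s), \<Phi> (x,t)) < \<epsilon>" using a(4) by linarith
  next
    fix x y assume x: "x \<in> topspace Y" and y: "y \<in> topspace Y"
      and "\<And>s t. s \<in> {0..1} \<Longrightarrow> t \<in> {0..1} \<Longrightarrow> gap (\<Phi> (x,s), \<Phi> (x,t)) = gap (\<Phi> (y,s), \<Phi> (y,t))"
    then have F: "F (x,k) = F (y,k)" if "k \<in> topspace ?K" for k
      using that by (auto simp: F_def)
    show "m x = m y"
      using m_ex[OF x] m_ex[OF y] m_le[OF x] m_le[OF y] F by (metis order_antisym)
  qed
qed

text \<open>The subdivision has about 1 / m x steps, a number that may be unbounded over
  \<open>Y\<close>. Extra steps contribute factors \<open>\<one>\<close>, so the products with
  different numbers of steps agree where both suffice and can be glued. \<open>Y\<close> carries no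
  action here; equivariance is stated for two points whose whole paths are translates by g.\<close>

lemma coset_lift:
  assumes \<Phi>: "continuous_map (prod_topology Y I) Z \<Phi>"
    and start: "\<And>x. x \<in> topspace Y \<Longrightarrow> fst (rep (\<Phi> (x,0))) \<in> H"
  obtains \<Lambda> where "continuous_map (prod_topology Y I) TG \<Lambda>"
    "\<And>x. x \<in> topspace Y \<Longrightarrow> \<Lambda> (x,0) = \<one>"
    "\<And>x t. x \<in> topspace Y \<Longrightarrow> t \<in> {0..1} \<Longrightarrow> inv (\<Lambda> (x,t)) \<otimes> fst (rep (\<Phi> (x,t))) \<in> H"
    "\<And>x y g t. x \<in> topspace Y \<Longrightarrow> y \<in> topspace Y \<Longrightarrow> g \<in> carrier G \<Longrightarrow> t \<in> {0..1} \<Longrightarrow>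
      \<forall>s\<in>{0..1}. \<Phi> (y,s) = ga g (\<Phi> (x,s)) \<Longrightarrow> \<Lambda> (y,t) = g \<otimes> \<Lambda> (x,t) \<otimes> inv g"
proof -
  obtain m where m: "continuous_map Y euclideanreal m" "\<And>x. x \<in> topspace Y \<Longrightarrow> m x > 0"
    and m_gap: "\<And>x s t. x \<in> topspace Y \<Longrightarrow> s \<in> {0..1} \<Longrightarrow> t \<in> {0..1} \<Longrightarrow> \<bar>s - t\<bar> < m x \<Longrightarrow> gap (\<Phi> (x,s), \<Phi> (x,t)) < \<epsilon>"
    and m_eq: "\<And>x y. x \<in> topspace Y \<Longrightarrow> y \<in> topspace Y \<Longrightarrow>
      (\<And>s t. s \<in> {0..1} \<Longrightarrow> t \<in> {0..1} \<Longrightarrow> gap (\<Phi> (x,s), \<Phi> (x,t)) = gap (\<Phi> (y,s), \<Phi> (y,t))) \<Longrightarrow> m x = m y"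
    using uniform_time_step[OF \<Phi>] by blast
  have \<Phi>Z: "\<Phi> (x,t) \<in> topspace Z" if "x \<in> topspace Y" "t \<in> {0..1}" for x t
    using \<Phi> that unfolding continuous_map_def by auto
  \<comment> \<open>Halved because the gap bound requires a strict inequality with
    \<open>m x\<close>.\<close>
  define e where "e x = m x / 2" for x
  have e: "e x > 0" "e x < m x" if "x \<in> topspace Y" for x using m(2)[OF that] by (auto simp: e_def)
  have e_cont: "continuous_map Y euclideanreal e"
    unfolding e_def using m(1) by (intro continuous_map_real_divide) auto
  \<comment> \<open>Subdivision times are cut off at the endpoint t. This makes the products
    continuous in t, and all steps after t is reached are trivial.\<close>
  define T where "T n p = min (real n * e (fst p)) (snd p)" for n p
  \<comment> \<open>New factors go on the left, since each transport acts on the coset already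
    reached.\<close>
  define lam where "lam n = rec_nat (\<lambda>p. \<one>) (\<lambda>n l p. transport (\<Phi> (fst p, T n p), \<Phi> (fst p, T (Suc n) p)) \<otimes> l p) n" for n
  have lam_0: "lam 0 p = \<one>"
    and lam_Suc: "lam (Suc n) p = transport (\<Phi> (fst p, T n p), \<Phi> (fst p, T (Suc n) p)) \<otimes> lam n p" for n p
    by (simp_all add: lam_def)
  have T01: "T n (x,t) \<in> {0..1}" if "x \<in> topspace Y" "t \<in> {0..1}" for n x t
    using e(1)[OF that(1)] that(2) by (auto simp: T_def)
  have TT: "\<bar>T n (x,t) - T (Suc n) (x,t)\<bar> < m x" if "x \<in> topspace Y" for n x t
  proof -
    have "\<bar>T n (x,t) - T (Suc n) (x,t)\<bar> \<le> e x" using e(1)[OF that] by (auto simp: T_def min_def algebra_simps)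
    then show ?thesis using e(2)[OF that] by linarith
  qed
  have gapT: "gap (\<Phi> (x, T n (x,t)), \<Phi> (x, T (Suc n) (x,t))) < \<epsilon>" if "x \<in> topspace Y" "t \<in> {0..1}" for n x t
    using m_gap T01 TT that by blast
  have lam_G: "lam n (x,t) \<in> carrier G" if "x \<in> topspace Y" "t \<in> {0..1}" for n x t
    by (induction n) (use transport_closed \<Phi>Z T01 gapT that in \<open>auto simp: lam_0 lam_Suc\<close>)
  have lam_H: "inv (lam n (x,t)) \<otimes> fst (rep (\<Phi> (x, T n (x,t)))) \<in> H" if xt: "x \<in> topspace Y" "t \<in> {0..1}" for n x t
  proof (induction n)
    case 0
    have "fst (rep (\<Phi> (x,0))) \<in> carrier G" using start[OF xt(1)] H_carrier by blast
    then show ?case using start[OF xt(1)] xt(2) by (simp add: lam_0 T_def)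
  next
    case (Suc n)
    then show ?case
      using transport_coset[OF \<Phi>Z[OF xt(1) T01[OF xt]] \<Phi>Z[OF xt(1) T01[OF xt]] gapT[OF xt] lam_G[OF xt]]
      by (simp add: lam_Suc)
  qed
  have lam_equiv: "lam n (y,t) = g \<otimes> lam n (x,t) \<otimes> inv g"
    if x: "x \<in> topspace Y" and y: "y \<in> topspace Y" and g: "g \<in> carrier G" and t: "t \<in> {0..1}"
      and eq: "\<And>s. s \<in> {0..1} \<Longrightarrow> \<Phi> (y,s) = ga g (\<Phi> (x,s))" and ee: "e y = e x" for n x y g t
  proof (induction n)
    case 0
    then show ?case using g by (simp add: lam_0)
  next
    case (Suc n)
    let ?\<tau> = "transport (\<Phi> (x, T n (x,t)), \<Phi> (x, T (Suc n) (x,t)))"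
    have TTT: "T k (y,t) = T k (x,t)" for k using ee by (simp add: T_def)
    have tc: "?\<tau> \<in> carrier G" using transport_closed \<Phi>Z T01 gapT x t by blast
    have "transport (\<Phi> (y, T n (y,t)), \<Phi> (y, T (Suc n) (y,t))) = g \<otimes> ?\<tau> \<otimes> inv g"
      unfolding TTT eq[OF T01[OF x t]] by (rule transport_ga[OF g \<Phi>Z[OF x T01[OF x t]] \<Phi>Z[OF x T01[OF x t]] gapT[OF x t]])
    then show ?case
      using Suc g tc lam_G[OF x t] by (simp add: lam_Suc m_assoc)
  qed
  have lam_stable: "lam k (x,t) = lam n (x,t)"
    if x: "x \<in> topspace Y" and t: "t \<in> {0..1}" and n: "real n * e x \<ge> 1" and k: "n \<le> k" for n k x t
    using k
  proof (induction k rule: dec_induct)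
    case (step k)
    have "real n * e x \<le> real k * e x" using step(1) e(1)[OF x] by (intro mult_right_mono) auto
    moreover have "real k * e x \<le> real (Suc k) * e x" using e(1)[OF x] by (intro mult_right_mono) auto
    ultimately have "T k (x,t) = t" "T (Suc k) (x,t) = t" using n t by (auto simp: T_def min_def)
    then show ?case using step transport_self[OF \<Phi>Z[OF x t]] lam_G[OF x t] by (simp add: lam_Suc)
  qed simp
  define N where "N x = nat \<lceil>1 / e x\<rceil>" for x
  have N: "real (N x) * e x \<ge> 1" if "x \<in> topspace Y" for x
  proof -
    have "1 / e x \<le> real (N x)" unfolding N_def by linarith
    then show ?thesis using e(1)[OF that] by (simp add: field_simps)
  qed
  define \<Lambda> where "\<Lambda> p = lam (N (fst p)) p" for p
  have \<Lambda>_eq: "\<Lambda> (x,t) = lam n (x,t)" if "x \<in> topspace Y" "t \<in> {0..1}" "real n * e x \<ge> 1" for n x t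
    using lam_stable[OF that(1,2) N[OF that(1)], of "max n (N x)"] lam_stable[OF that, of "max n (N x)"]
    by (simp add: \<Lambda>_def)
  have I: "continuous_map I euclideanreal (\<lambda>t. t)" by (simp add: continuous_map_from_subtopology)
  have T_cont: "continuous_map (prod_topology Y I) I (T n)" for n
  proof -
    have "continuous_map (prod_topology Y I) euclideanreal (T n)"
      unfolding T_def
      by (intro continuous_map_real_min continuous_map_real_mult continuous_map_compose[OF continuous_map_fst e_cont, unfolded o_def]
          continuous_map_compose[OF continuous_map_snd I, unfolded o_def]) auto
    then show ?thesis using T01 by (force simp: continuous_map_in_subtopology)
  qed
  have lam_cont: "continuous_map (prod_topology Y I) TG (lam n)" for n
  proof (induction n)
    case 0
    then show ?case by (simp add: lam_0[abs_def] topspace_TG)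
  next
    case (Suc n)
    have c: "continuous_map (prod_topology Y I) Z (\<lambda>p. \<Phi> (fst p, T k p))" for k
      by (rule continuous_map_compose[OF continuous_map_pairedI[OF continuous_map_fst T_cont] \<Phi>, unfolded o_def])
    have "continuous_map (prod_topology Y I) (subtopology (prod_topology Z Z) {w. gap w < \<epsilon>})
       (\<lambda>p. (\<Phi> (fst p, T n p), \<Phi> (fst p, T (Suc n) p)))"
      using gapT by (auto simp: continuous_map_in_subtopology intro!: continuous_map_pairedI c)
    from cont_mult[OF continuous_map_compose[OF this transport_cont] Suc]
    show ?case by (simp add: lam_Suc[abs_def] o_def)
  qed
  show ?thesis
  proof (rule that[of \<Lambda>])
    \<comment> \<open>The strict inequality makes these sets open; one step more than
      \<open>N x\<close> achieves it, so they cover.\<close>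
    define W where "W n = {p \<in> topspace (prod_topology Y I). real n * e (fst p) \<in> {1<..}}" for n
    have "continuous_map (prod_topology Y I) euclideanreal (\<lambda>p. real n * e (fst p))" for n
      by (intro continuous_map_real_mult continuous_map_compose[OF continuous_map_fst e_cont, unfolded o_def]) auto
    then have Wo: "openin (prod_topology Y I) (W n)" for n
      unfolding W_def by (rule openin_continuous_map_preimage) simp
    show "continuous_map (prod_topology Y I) TG \<Lambda>"
    proof (rule pasting_lemma[where I = UNIV and T = W and f = lam])
      show "continuous_map (subtopology (prod_topology Y I) (W n)) TG (lam n)" for n
        by (rule continuous_map_from_subtopology[OF lam_cont])
      show "lam i p = lam j p" if "p \<in> topspace (prod_topology Y I) \<inter> W i \<inter> W j" for i j p
        using that \<Lambda>_eq[of "fst p" "snd p" i] \<Lambda>_eq[of "fst p" "snd p" j] by (auto simp: W_def)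
      show "\<exists>j. j \<in> UNIV \<and> p \<in> W j \<and> \<Lambda> p = lam j p" if p: "p \<in> topspace (prod_topology Y I)" for p
      proof -
        obtain x t where xt: "p = (x,t)" "x \<in> topspace Y" "t \<in> {0..1}" using p by auto
        have "real (Suc (N x)) * e x > 1" using N[OF xt(2)] e(1)[OF xt(2)] by (simp add: algebra_simps)
        then show ?thesis
          using p xt \<Lambda>_eq[OF xt(2,3), of "Suc (N x)"] by (intro exI[of _ "Suc (N x)"]) (auto simp: W_def)
      qed
    qed (use Wo in auto)
    fix x assume x: "x \<in> topspace Y"
    have "lam n (x,0) = \<one>" for n
    proof (induction n)
      case (Suc n)
      have "T k (x,0) = 0" for k using e(1)[OF x] by (simp add: T_def)
      then show ?case using Suc transport_self[OF \<Phi>Z[OF x]] by (simp add: lam_Suc)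
    qed (simp add: lam_0)
    then show "\<Lambda> (x,0) = \<one>" by (simp add: \<Lambda>_def)
    fix t :: real assume t: "t \<in> {0..1}"
    have "T (N x) (x,t) = t" using N[OF x] t by (simp add: T_def min_def)
    then show "inv (\<Lambda> (x,t)) \<otimes> fst (rep (\<Phi> (x,t))) \<in> H"
      using lam_H[OF x t, of "N x"] by (simp add: \<Lambda>_def)
    fix y g assume y: "y \<in> topspace Y" and g: "g \<in> carrier G"
      and "\<forall>s\<in>{0..1}. \<Phi> (y,s) = ga g (\<Phi> (x,s))"
    then have eq: "\<And>s. s \<in> {0..1} \<Longrightarrow> \<Phi> (y,s) = ga g (\<Phi> (x,s))" by blast
    \<comment> \<open>Translation preserves gaps, so both points have the same subdivision times and
      their products correspond factor by factor.\<close>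
    have "m x = m y" by (rule m_eq[OF x y]) (use eq gap_ga[OF g] \<Phi>Z[OF x] in simp)
    then have ee: "e y = e x" by (simp add: e_def)
    then have "N y = N x" by (simp add: N_def)
    then show "\<Lambda> (y,t) = g \<otimes> \<Lambda> (x,t) \<otimes> inv g"
      using lam_equiv[OF x y g t eq ee] by (simp add: \<Lambda>_def)
  qed
qed

lemma compressible_untwisted:
  assumes W: "W \<subseteq> topspace Z" "invariant_set (carrier G) ga W"
    and B: "B \<subseteq> topspace X" "invariant_set H act B"
    and c: "compressible (carrier G) ga Z W (twisted_set G H act B)"
  shows "compressible H act X {x \<in> topspace X. q (\<one>, x) \<in> W} B"
proof -
  define U where "U = {x \<in> topspace X. q (\<one>, x) \<in> W}"
  have UX: "U \<subseteq> topspace X" by (auto simp: U_def)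
  have tU: "topspace (subtopology X U) = U" using UX by auto
  have q_act: "q (\<one>, act h x) = ga h (q (\<one>, x))" if "h \<in> H" "x \<in> topspace X" for h x
    using q_shift[of h x h] that H_carrier by (simp add: ga_q)
  have U_inv: "act h x \<in> U" if "h \<in> H" "x \<in> U" for h x
    using that q_act W(2) H_carrier by (auto simp: U_def invariant_set_def)
  from c obtain F where F: "continuous_map (prod_topology (subtopology Z W) I) Z F"
    "\<And>z. z \<in> W \<Longrightarrow> F (z,0) = z" "\<And>z. z \<in> W \<Longrightarrow> F (z,1) \<in> twisted_set G H act B"
    "\<And>g z t. g \<in> carrier G \<Longrightarrow> z \<in> W \<Longrightarrow> t \<in> {0..1} \<Longrightarrow> F (ga g z, t) = ga g (F (z,t))"
    unfolding compressible_def by (elim exE conjE) (simp only: Ball_def)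
  let ?Y = "subtopology X U"
  define \<Phi> where "\<Phi> p = F (q (\<one>, fst p), snd p)" for p
  have emb: "continuous_map ?Y (subtopology Z W) (\<lambda>x. q (\<one>, x))"
  proof -
    have "continuous_map ?Y Z (\<lambda>x. q (\<one>, x))"
      by (rule continuous_map_compose[OF continuous_map_pairedI q_cont, unfolded o_def])
        (auto simp: topspace_TG continuous_map_from_subtopology)
    then show ?thesis by (auto simp: continuous_map_in_subtopology U_def)
  qed
  have \<Phi>: "continuous_map (prod_topology ?Y I) Z \<Phi>"
    unfolding \<Phi>_def
    by (rule continuous_map_compose[OF continuous_map_pairedI F(1), unfolded o_def])
      (intro continuous_map_compose[OF continuous_map_fst emb, unfolded o_def] continuous_map_snd)+
  have \<Phi>Z: "\<Phi> (x,t) \<in> topspace Z" if "x \<in> U" "t \<in> {0..1}" for x t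
    using \<Phi> that tU unfolding continuous_map_def by auto
  have \<Phi>0: "\<Phi> (x,0) = q (\<one>, x)" if "x \<in> U" for x using F(2) that by (simp add: \<Phi>_def U_def)
  have \<Phi>h: "\<Phi> (act h x, t) = ga h (\<Phi> (x,t))" if "h \<in> H" "x \<in> U" "t \<in> {0..1}" for h x t
    using that F(4)[of h "q (\<one>, x)" t] q_act H_carrier by (simp add: \<Phi>_def U_def)
  have start: "fst (rep (\<Phi> (x,0))) \<in> H" if "x \<in> topspace ?Y" for x
  proof -
    have x: "x \<in> U" "x \<in> topspace X" using that UX by auto
    obtain h where h: "h \<in> H" "rep (q (\<one>, x)) = (\<one> \<otimes> inv h, act h x)" using rep_q[of \<one> x] x by blast
    then show ?thesis using \<Phi>0 x H_carrier[OF h(1)] by simp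
  qed
  obtain \<Lambda> where \<Lambda>: "continuous_map (prod_topology ?Y I) TG \<Lambda>"
    "\<And>x. x \<in> U \<Longrightarrow> \<Lambda> (x,0) = \<one>"
    "\<And>x t. x \<in> U \<Longrightarrow> t \<in> {0..1} \<Longrightarrow> inv (\<Lambda> (x,t)) \<otimes> fst (rep (\<Phi> (x,t))) \<in> H"
    "\<And>x y g t. x \<in> U \<Longrightarrow> y \<in> U \<Longrightarrow> g \<in> carrier G \<Longrightarrow> t \<in> {0..1} \<Longrightarrow>
      \<forall>s\<in>{0..1}. \<Phi> (y,s) = ga g (\<Phi> (x,s)) \<Longrightarrow> \<Lambda> (y,t) = g \<otimes> \<Lambda> (x,t) \<otimes> inv g"
    by (rule coset_lift[OF \<Phi> start, unfolded tU]) blast+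
  have \<Lambda>G: "\<Lambda> (x,t) \<in> carrier G" if "x \<in> U" "t \<in> {0..1}" for x t
    using \<Lambda>(1) that tU unfolding continuous_map_def by (auto simp: topspace_TG)
  \<comment> \<open>The lift brings the homotopy back over the base coset, where its second
    coordinate is a point of \<open>X\<close>.\<close>
  define K where "K p = fibre_coord (\<Lambda> p, \<Phi> p)" for p
  have K_q: "K (x,t) = act (inv (\<Lambda> (x,t)) \<otimes> g) y \<and> inv (\<Lambda> (x,t)) \<otimes> g \<in> H"
    if "x \<in> U" "t \<in> {0..1}" "\<Phi> (x,t) = q (g,y)" "g \<in> carrier G" "y \<in> topspace X" for x t g y
    using \<Lambda>(3)[OF that(1,2)] rep_coset[OF that(4,5) \<Lambda>G[OF that(1,2)]] fibre_coord_q[OF \<Lambda>G[OF that(1,2)] that(4,5)] that(3)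
    by (simp add: K_def)
  have "continuous_map (prod_topology ?Y I) (subtopology (prod_topology TG Z) {w. inv (fst w) \<otimes> fst (rep (snd w)) \<in> H}) (\<lambda>p. (\<Lambda> p, \<Phi> p))"
    using \<Lambda>(1,3) \<Phi> tU by (auto simp: continuous_map_in_subtopology intro!: continuous_map_pairedI)
  from continuous_map_compose[OF this fibre_coord_cont]
  have K_cont: "continuous_map (prod_topology ?Y I) X K" by (simp add: K_def[abs_def] o_def)
  have "compressible H act X U B" unfolding compressible_def
  proof (intro exI[of _ K] conjI ballI)
    show "continuous_map (prod_topology (subtopology X U) I) X K" by (rule K_cont)
    fix x assume x: "x \<in> U"
    have xX: "x \<in> topspace X" using x UX by blast
    show "K (x,0) = x" using K_q[OF x _ \<Phi>0[OF x]] xX \<Lambda>(2)[OF x] by simp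
    show "K (x,1) \<in> B"
    proof -
      have "\<Phi> (x,1) \<in> twisted_set G H act B" using F(3) x by (simp add: \<Phi>_def U_def)
      then obtain g b where g: "g \<in> carrier G" "b \<in> B" "\<Phi> (x,1) = q (g,b)" by (auto simp: twisted_set_def)
      \<comment> \<open>The final point [g,b] is returned to the base fibre by an element that acts
        on b through \<open>H\<close>; invariance of \<open>B\<close> keeps the result in
        \<open>B\<close>.\<close>
      then show ?thesis using K_q[OF x _ g(3,1)] B by (auto simp: invariant_set_def)
    qed
    fix h t assume h: "h \<in> H" and t: "t \<in> {0..1::real}"
    have hc: "h \<in> carrier G" using h H_carrier by blast
    obtain g y where gy: "g \<in> carrier G" "y \<in> topspace X" "\<Phi> (x,t) = q (g,y)" using Z_cases[OF \<Phi>Z[OF x t]] by blast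
    have hx: "\<Phi> (act h x, t) = q (h \<otimes> g, y)" using \<Phi>h[OF h x t] gy hc by (simp add: ga_q)
    have \<Lambda>h: "\<Lambda> (act h x, t) = h \<otimes> \<Lambda> (x,t) \<otimes> inv h"
      by (rule \<Lambda>(4)[OF x U_inv[OF h x] hc t]) (use \<Phi>h[OF h x] in blast)
    have lc: "\<Lambda> (x,t) \<in> carrier G" by (rule \<Lambda>G[OF x t])
    \<comment> \<open>Conjugating the lift by h while translating the homotopy by h leaves a single
      factor h on the left; this is the equivariance of \<open>K\<close>.\<close>
    have "inv (\<Lambda> (act h x, t)) \<otimes> (h \<otimes> g) = h \<otimes> (inv (\<Lambda> (x,t)) \<otimes> g)"
      unfolding \<Lambda>h using hc lc gy(1) by (simp add: inv_mult_group m_assoc)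
    then have "K (act h x, t) = act (h \<otimes> (inv (\<Lambda> (x,t)) \<otimes> g)) y"
      using K_q[OF U_inv[OF h x] t hx] hc gy by simp
    also have "\<dots> = act h (K (x,t))" using K_q[OF x t gy(3,1,2)] act_mult[OF h _ gy(2)] by simp
    finally show "K (act h x, t) = act h (K (x,t))" .
  qed
  then show ?thesis by (simp add: U_def)
qed

text \<open>Stated for each \<open>k\<close> separately, so that it settles both whether a finite
  cover exists and what the least size is. Covers pass to the twisted product as sets [G,U], and
  back by pulling them along x -> [1,x].\<close>

lemma cat_cover_exists_twisted_iff:
  assumes B: "\<forall>B\<in>\<B>. B \<subseteq> topspace X \<and> invariant_set H act B"
  shows "cat_cover_exists H act X \<B> k \<longleftrightarrow>
    cat_cover_exists (carrier G) ga Z ((\<lambda>B. twisted_set G H act B) ` \<B>) k"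
proof
  assume "cat_cover_exists H act X \<B> k"
  then obtain U where U: "(\<Union>i<k. U i) = topspace X"
    "\<And>i. i < k \<Longrightarrow> openin X (U i) \<and> invariant_set H act (U i) \<and> (\<exists>A\<in>\<B>. compressible H act X (U i) A)"
    unfolding cat_cover_exists_def by blast
  show "cat_cover_exists (carrier G) ga Z ((\<lambda>B. twisted_set G H act B) ` \<B>) k"
    unfolding cat_cover_exists_def
  proof (intro exI[of _ "\<lambda>i. twisted_set G H act (U i)"] conjI allI impI)
    show "(\<Union>i<k. twisted_set G H act (U i)) = topspace Z"
      unfolding topspace_Z U(1)[symmetric] by (auto simp: twisted_set_def)
    fix i assume i: "i < k"
    have Ui: "openin X (U i)" "invariant_set H act (U i)" "U i \<subseteq> topspace X"
      using U(2)[OF i] openin_subset by auto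
    have "openin P (carrier G \<times> U i)" using Ui(1) by (simp add: openin_prod_Times_iff flip: topspace_TG)
    then show "openin Z (twisted_set G H act (U i))"
      using q_open unfolding open_map_def twisted_set_def by blast
    show "invariant_set (carrier G) ga (twisted_set G H act (U i))"
      by (auto simp: invariant_set_def twisted_set_def ga_q)
    show "\<exists>A\<in>(\<lambda>B. twisted_set G H act B) ` \<B>. compressible (carrier G) ga Z (twisted_set G H act (U i)) A"
      using U(2)[OF i] compressible_twisted[OF Ui(3,2)] B by blast
  qed
next
  assume "cat_cover_exists (carrier G) ga Z ((\<lambda>B. twisted_set G H act B) ` \<B>) k"
  then obtain W where W: "(\<Union>i<k. W i) = topspace Z"
    "\<forall>i<k. openin Z (W i) \<and> invariant_set (carrier G) ga (W i) \<and>
      (\<exists>B\<in>\<B>. compressible (carrier G) ga Z (W i) (twisted_set G H act B))"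
    unfolding cat_cover_exists_def bex_simps by (elim exE conjE)
  show "cat_cover_exists H act X \<B> k"
    unfolding cat_cover_exists_def
  proof (intro exI[of _ "\<lambda>i. {x \<in> topspace X. q (\<one>, x) \<in> W i}"] conjI allI impI)
    show "(\<Union>i<k. {x \<in> topspace X. q (\<one>, x) \<in> W i}) = topspace X"
      using W(1) q_in_Z[OF one_closed] by blast
    fix i assume i: "i < k"
    have Wi: "openin Z (W i)" "invariant_set (carrier G) ga (W i)" "W i \<subseteq> topspace Z"
      using W(2) i openin_subset by auto
    have "continuous_map X Z (\<lambda>x. q (\<one>, x))"
      by (rule continuous_map_compose[OF continuous_map_pairedI q_cont, unfolded o_def]) (auto simp: topspace_TG)
    then show "openin X {x \<in> topspace X. q (\<one>, x) \<in> W i}"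
      by (rule openin_continuous_map_preimage[OF _ Wi(1)])
    show "invariant_set H act {x \<in> topspace X. q (\<one>, x) \<in> W i}"
      unfolding invariant_set_def
    proof (intro ballI)
      fix h x assume h: "h \<in> H" and x: "x \<in> {x \<in> topspace X. q (\<one>, x) \<in> W i}"
      have "q (\<one>, act h x) = ga h (q (\<one>, x))"
        using q_shift[of h x h] h x H_carrier by (simp add: ga_q)
      then show "act h x \<in> {x \<in> topspace X. q (\<one>, x) \<in> W i}"
        using h x Wi(2) H_carrier by (auto simp: invariant_set_def)
    qed
    show "\<exists>A\<in>\<B>. compressible H act X {x \<in> topspace X. q (\<one>, x) \<in> W i} A"
    proof -
      obtain A where "A \<in> \<B>" "compressible (carrier G) ga Z (W i) (twisted_set G H act A)"
        using W(2) i by blast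
      then show ?thesis using compressible_untwisted[OF Wi(3,2), of A] B by blast
    qed
  qed
qed

end

theorem theorem5p2:
  fixes G :: "('g, 'b) monoid_scheme" and TG :: "'g topology" and H :: "'g set"
    and X :: "'x topology" and act :: "'g \<Rightarrow> 'x \<Rightarrow> 'x" and \<B> :: "'x set set"
  assumes "lie_group G TG TYPE('e::euclidean_space)"
    and "compact_space TG"
    and "subgroup H G" and "closedin TG H"
    and "continuous_action G TG H X act"
    and "metrizable_space X"
    and "\<forall>B\<in>\<B>. B \<subseteq> topspace X \<and> invariant_set H act B"
  shows "equiv_cat H act X \<B> =
         equiv_cat (carrier G) (twisted_action G) (twisted_product G TG H X act)
                   ((\<lambda>B. twisted_set G H act B) ` \<B>)"
proof -
  obtain U and \<phi> :: "'g \<Rightarrow> 'e" and C \<rho> where lc: "lie_coords G TG U \<phi> C \<rho>"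
    using lie_coords_exist[OF assms(1)] by blast
  interpret compact_lie_subgroup G TG U \<phi> C \<rho> H
    using lc assms(2-4) by (simp add: compact_lie_subgroup_def compact_lie_coords_def
        compact_lie_coords_axioms_def compact_lie_subgroup_axioms_def)
  obtain d r \<epsilon> where "continuous_map TG euclideanreal d" "\<epsilon> > (0::real)" "d \<one>\<^bsub>G\<^esub> = 0"
    "\<And>g h k. g \<in> carrier G \<Longrightarrow> h \<in> H \<Longrightarrow> k \<in> H \<Longrightarrow> d (h \<otimes>\<^bsub>G\<^esub> g \<otimes>\<^bsub>G\<^esub> k) = d g"
    "continuous_map (subtopology TG {g \<in> carrier G. d g < \<epsilon>}) (subtopology TG H) r" "r \<one>\<^bsub>G\<^esub> = \<one>\<^bsub>G\<^esub>"
    "\<And>g. g \<in> carrier G \<Longrightarrow> d g < \<epsilon> \<Longrightarrow> r g \<in> H"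
    "\<And>g h k. g \<in> carrier G \<Longrightarrow> d g < \<epsilon> \<Longrightarrow> h \<in> H \<Longrightarrow> k \<in> H \<Longrightarrow> r (h \<otimes>\<^bsub>G\<^esub> g \<otimes>\<^bsub>G\<^esub> k) = h \<otimes>\<^bsub>G\<^esub> r g \<otimes>\<^bsub>G\<^esub> k"
    by (rule equivariant_retraction) blast
  then interpret twisted_retraction G TG H X act d r \<epsilon>
    using assms(3,5) H_carrier by unfold_locales auto
  show ?thesis
    unfolding equiv_cat_def cat_cover_exists_twisted_iff[OF assms(7)] ..
qed

end
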